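(* Let $\langle\ |\ \rangle:\Lambda\otimes\mathcal{L}\to B$ be a dual pairing between two left bialgebroids $\Lambda,\mathcal{L}$ over a unital algebra $B$, and suppose that $\mathcal{L}$ is a left Hopf algebroid. If $F=F^i\diamond_BF_i\in\Lambda\diamond_B\Lambda$ (summation over $i$ understood) is an invertible left 2-cocycle in $\Lambda$, then there is a dual pairing between $\Lambda^F$ and $\mathcal{L}^{\Gamma_F}$ given by $$[\alpha|X]=\big\langle F^i\alpha\,\big|\,X_+\overline{\langle F_i|X_-\rangle}\big\rangle,\qquad\forall X\in\mathcal{L},\ \alpha\in\Lambda,$$ where $\Gamma_F$ is the invertible left 2-cocycle on $\mathcal{L}$ given by $\Gamma_F(X\otimes_{\overline B}Y)=\langle F^i|X\overline{\langle F_i|Y\rangle}\rangle$.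
   Context: All algebras are unital over a field $\mathbb{K}$ and $\otimes$ is over $\mathbb K$. $\overline{B}$ is the opposite algebra of $B$, with anti-isomorphism $b\mapsto\overline b$. Standing assumption: all $B$-module and $\overline B$-module structures are faithfully flat. Left bialgebroid over $B$: a unital algebra $\mathcal{L}$ with algebra maps $s:B\to\mathcal{L}$, $t:B^{op}\to\mathcal{L}$ with commuting images; in $\mathcal{L}$ one writes $b$ for $s(b)$ and $\overline b$ for $t(b)$. Put $P\diamond_B Q=P\otimes Q/\langle \overline b p\otimes q-p\otimes bq\rangle$. With the $B$-bimodule structure $a.X.b=a\overline bX$, $\mathcal{L}$ is a $B$-coring with coproduct $\Delta:\mathcal{L}\to\mathcal{L}\diamond_B\mathcal{L}$, $\Delta(X)=X_{(1)}\diamond X_{(2)}$, and counit $\varepsilon:\mathcal{L}\to B$, such that (i) $\Delta$ has image in the Takeuchi product $\{\sum_i X_i\diamond Y_i: \sum_i X_i\overline b\diamond Y_i=\sum_i X_i\diamond Y_ib\ \forall b\in B\}$ and is an algebra map into it (factorwise product); (ii) $\varepsilon(1)=1$ and $\varepsilon(X\varepsilon(Y))=\varepsilon(XY)=\varepsilon(X\overline{\varepsilon(Y)})$. $\mathcal{L}$ is a left Hopf algebroid if $\lambda:\mathcal{L}\otimes_{\overline B}\mathcal{L}\to\mathcal{L}\diamond_B\mathcal{L}$, $\lambda(X\otimes Y)=X_{(1)}\diamond X_{(2)}Y$ is invertible, where $\mathcal{L}\otimes_{\overline B}\mathcal{L}=\mathcal{L}\otimes\mathcal{L}/\langle X\overline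 b\otimes Y-X\otimes\overline bY\rangle$; write $X_+\otimes_{\overline B}X_-=\lambda^{-1}(X\diamond 1)$. Dual pairing between left bialgebroids $\Lambda$ and $\mathcal{H}$ over $B$: a linear map $\langle\ |\ \rangle:\Lambda\otimes\mathcal{H}\to B$ such that for $a,b,c,d,f\in B$, $x,y\in\Lambda$, $g,h\in\mathcal{H}$: (1) $\langle a\overline b\,x\,c\overline d|g\rangle f=a\langle x|c\overline f\,g\,d\overline b\rangle$; (2) $\langle x|gh\rangle=\langle x_{(1)}|g\overline{\langle x_{(2)}|h\rangle}\rangle=\langle\overline{\langle x_{(2)}|h\rangle}x_{(1)}|g\rangle$; (3) $\langle xy|g\rangle=\langle x\langle y|g_{(1)}\rangle|g_{(2)}\rangle=\langle x|\langle y|g_{(1)}\rangle g_{(2)}\rangle$; (4) $\langle x|1\rangle=\varepsilon(x)$; (5) $\langle1|g\rangle=\varepsilon(g)$. Left 2-cocycle in $\Lambda$: an element $F=F^i\diamond_BF_i\in\Lambda\diamond_B\Lambda$ with $(\varepsilon\diamond_B\mathrm{id})F=1=(\mathrm{id}\diamond_B\varepsilon)F$ and $(\Delta\diamond_B\mathrm{id})(F)\,F^{12}=(\mathrm{id}\diamond_B\Delta)(F)\,F^{23}$, where $F^{12}=F\otimes1$, $F^{23}=1\otimes F$. It gives an algebra $B^F$: the vector space $B$ with product $a\cdot_Fb=\varepsilon(F^ia)\varepsilon(F_ib)$, and maps $s^F(b)=\varepsilon(F^ib)F_i$, $t^F(b)=\overline{\varepsilon(F_ib)}F^i$. $F$ is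 invertible if for all left $\Lambda$-modules $M,N$ the map $F^\#:M\diamond_{B^F}N\to M\diamond_BN$, $m\otimes n\mapsto F^i\triangleright m\diamond_BF_i\triangleright n$ is invertible, where $M\diamond_{B^F}N=M\otimes N/\langle t^F(b)\triangleright m\otimes n-m\otimes s^F(b)\triangleright n\rangle$. Then $\Lambda^F$ is the left bialgebroid over $B^F$ with the same product, unit and counit as $\Lambda$, source and target $s^F,t^F$, and coproduct $\Delta^F(\alpha)=(F^\#)^{-1}(\alpha_{(1)}F^i\diamond_B\alpha_{(2)}F_i)$. Left 2-cocycle on $\mathcal{L}$: a left $\overline B$-linear map $\Gamma:\mathcal{L}\otimes_{\overline B}\mathcal{L}\to B$ ($\Gamma(\overline bX,Y)=\Gamma(X,Y)b$) with $\Gamma(X,\Gamma(Y_{(1)},Z_{(1)})Y_{(2)}Z_{(2)})=\Gamma(\Gamma(X_{(1)},Y_{(1)})X_{(2)}Y_{(2)},Z)$ and $\Gamma(1,X)=\varepsilon(X)=\Gamma(X,1)$. $B^\Gamma$ is the vector space $B$ with product $a\cdot_\Gamma b=\Gamma(s(a),s(b))$. Left $\mathcal{L}$-comodule: a $B$-bimodule $M$ with coassociative, counital $\delta:M\to\mathcal{L}\diamond_BM$, $\delta(m)=m_{(-1)}\otimes m_{(0)}$, with $m_{(-1)}\overline b\diamond m_{(0)}=m_{(-1)}\diamond m_{(0)}b$ and $\delta(bmb')=bm_{(-1)}b'\otimes m_{(0)}$; it is a $B^\Gamma$-bimodule by $a\cdot_\Gamma m=\Gamma(a,m_{(-1)})m_{(0)}$,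 $m\cdot_\Gamma a=\Gamma(m_{(-1)},a)m_{(0)}$. $\Gamma$ is invertible if $M\otimes_{B^\Gamma}N\to M\otimes_BN$, $m\otimes n\mapsto\Gamma(m_{(-1)},n_{(-1)})m_{(0)}\otimes n_{(0)}$ is invertible for all left $\mathcal{L}$-comodules $M,N$. For invertible $\Gamma$, $\mathcal{L}^\Gamma$ is the left Hopf algebroid over $B^\Gamma$ on the vector space $\mathcal{L}$ with the same $s,t$, product $X\cdot_\Gamma Y=\Gamma(X_{(1)},Y_{(1)})\,X_{(2)+}Y_{(2)+}\,\overline{\Gamma(Y_{(2)-},X_{(2)-})}$, coproduct $\Delta^\Gamma=(\Gamma^\#)^{-1}\circ\Delta$ and counit $\varepsilon^\Gamma(X)=\Gamma(X_+,X_-)$, where $\Gamma^\#:\mathcal{L}^\Gamma\diamond_{B^\Gamma}\mathcal{L}^\Gamma\to\mathcal{L}\diamond_B\mathcal{L}$, $X\diamond Y\mapsto X_+\overline{\Gamma(X_-,Y_{(1)})}\diamond Y_{(2)}$ is invertible and $\mathcal{L}^\Gamma\diamond_{B^\Gamma}\mathcal{L}^\Gamma=\mathcal{L}\otimes\mathcal{L}/\langle\overline b\cdot_\Gamma X\otimes Y-X\otimes b\cdot_\Gamma Y\rangle$. The algebras $B^F$ and $B^{\Gamma_F}$ coincide, so $\Lambda^F$ and $\mathcal{L}^{\Gamma_F}$ have the same base. *)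

theory Defs
  imports Complex_Main "HOL-Library.Multiset"
begin

text \<open>
  The addition of every structure is that of its type; all the other operations are record fields,
  since twisting changes products on a fixed vector space.
\<close>

section \<open>Vector spaces, algebras, modules\<close>

record ('k, 'v) vspace =
  car :: "'v set"
  smul :: "'k \<Rightarrow> 'v \<Rightarrow> 'v"

definition is_vspace :: "('k::field, 'v::ab_group_add, 'z) vspace_scheme \<Rightarrow> bool" where
  "is_vspace V \<longleftrightarrow> vector_space (smul V) \<and> module.subspace (smul V) (car V)"

record ('k, 'a) algebra = "('k, 'a) vspace" +
  mult :: "'a \<Rightarrow> 'a \<Rightarrow> 'a"  (infixl "\<cdot>\<index>" 70)
  one :: "'a"  ("\<one>\<index>")

text \<open>The carrier of an algebra is its whole type; proper carriers occur only for modules and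
  comodules, which are quantified over. The zero algebra is allowed.\<close>

locale unital_algebra =
  fixes A :: "('k::field, 'a::ab_group_add, 'z) algebra_scheme"
  assumes vspace: "vector_space (smul A)"
    and carrier: "car A = UNIV"
    and linear_left: "\<And>y. Vector_Spaces.linear (smul A) (smul A) (\<lambda>x. x \<cdot>\<^bsub>A\<^esub> y)"
    and linear_right: "\<And>x. Vector_Spaces.linear (smul A) (smul A) (\<lambda>y. x \<cdot>\<^bsub>A\<^esub> y)"
    and assoc: "\<And>x y z. (x \<cdot>\<^bsub>A\<^esub> y) \<cdot>\<^bsub>A\<^esub> z = x \<cdot>\<^bsub>A\<^esub> (y \<cdot>\<^bsub>A\<^esub> z)"
    and one_left: "\<And>x. \<one>\<^bsub>A\<^esub> \<cdot>\<^bsub>A\<^esub> x = x"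
    and one_right: "\<And>x. x \<cdot>\<^bsub>A\<^esub> \<one>\<^bsub>A\<^esub> = x"

definition opposite :: "('k, 'a, 'z) algebra_scheme \<Rightarrow> ('k, 'a, 'z) algebra_scheme" where
  "opposite A = A\<lparr>mult := \<lambda>x y. y \<cdot>\<^bsub>A\<^esub> x\<rparr>"

record ('k, 'a, 'm) lmod = "('k, 'm) vspace" +
  act :: "'a \<Rightarrow> 'm \<Rightarrow> 'm"

definition mod_of :: "('k, 'm, 'z) vspace_scheme \<Rightarrow> ('a \<Rightarrow> 'm \<Rightarrow> 'm) \<Rightarrow> ('k, 'a, 'm) lmod" where
  "mod_of V f = \<lparr>car = car V, smul = smul V, act = f\<rparr>"

text \<open>Left modules; right modules over an algebra are left modules over its opposite.\<close>

definition left_module ::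
  "('k::field, 'a::ab_group_add, 'y) algebra_scheme \<Rightarrow> ('k, 'a, 'm::ab_group_add) lmod \<Rightarrow> bool" where
  "left_module A M \<longleftrightarrow> is_vspace M
    \<and> (\<forall>a. \<forall>m\<in>car M. act M a m \<in> car M)
    \<and> (\<forall>a b. \<forall>m\<in>car M. act M (a + b) m = act M a m + act M b m)
    \<and> (\<forall>a. \<forall>m\<in>car M. \<forall>n\<in>car M. act M a (m + n) = act M a m + act M a n)
    \<and> (\<forall>k a. \<forall>m\<in>car M. act M (smul A k a) m = smul M k (act M a m))
    \<and> (\<forall>k a. \<forall>m\<in>car M. act M a (smul M k m) = smul M k (act M a m))
    \<and> (\<forall>a b. \<forall>m\<in>car M. act M (a \<cdot>\<^bsub>A\<^esub> b) m = act M a (act M b m))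
    \<and> (\<forall>m\<in>car M. act M \<one>\<^bsub>A\<^esub> m = m)"

section \<open>Tensor products\<close>

text \<open>
  An element of a tensor product is represented by a formal sum of pure tensors, that is, by a
  multiset of tuples; two formal sums represent the same element iff they are related by the
  congruence generated by the defining relations. Maps into a tensor product are given by
  representatives, and their properties are stated modulo that congruence. A Sweedler expression
  in \<open>x\<^sub>(\<^sub>1\<^sub>)\<close>, \<open>x\<^sub>(\<^sub>2\<^sub>)\<close> becomes a sum over the pairs in a representative. Negatives need no
  separate treatment, since \<open>p \<otimes> q + (-p) \<otimes> q = 0 \<otimes> q = 0\<close>.
\<close>

inductive congruence :: "('x multiset \<Rightarrow> 'x multiset \<Rightarrow> bool) \<Rightarrow> 'x multiset \<Rightarrow> 'x multiset \<Rightarrow> bool"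
  for R where
  base: "R u v \<Longrightarrow> congruence R u v"
| refl: "congruence R u u"
| sym: "congruence R u v \<Longrightarrow> congruence R v u"
| trans: "congruence R u v \<Longrightarrow> congruence R v w \<Longrightarrow> congruence R u w"
| add: "congruence R u v \<Longrightarrow> congruence R u' v' \<Longrightarrow> congruence R (u + u') (v + v')"

text \<open>The quotient of \<open>P \<otimes> Q\<close> (over the field) by \<open>r b p \<otimes> q - p \<otimes> l b q\<close>.\<close>

inductive rel2 ::
  "('k, 'p::ab_group_add, 'y) vspace_scheme \<Rightarrow> ('k, 'q::ab_group_add, 'z) vspace_scheme
   \<Rightarrow> ('c \<Rightarrow> 'p \<Rightarrow> 'p) \<Rightarrow> ('c \<Rightarrow> 'q \<Rightarrow> 'q) \<Rightarrow> ('p \<times> 'q) multiset \<Rightarrow> ('p \<times> 'q) multiset \<Rightarrow> bool"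
  for P Q r l where
  "\<lbrakk>p \<in> car P; p' \<in> car P; q \<in> car Q\<rbrakk> \<Longrightarrow> rel2 P Q r l {#(p + p', q)#} {#(p, q), (p', q)#}"
| "\<lbrakk>p \<in> car P; q \<in> car Q; q' \<in> car Q\<rbrakk> \<Longrightarrow> rel2 P Q r l {#(p, q + q')#} {#(p, q), (p, q')#}"
| "q \<in> car Q \<Longrightarrow> rel2 P Q r l {#(0, q)#} {#}"
| "\<lbrakk>p \<in> car P; q \<in> car Q\<rbrakk> \<Longrightarrow> rel2 P Q r l {#(smul P k p, q)#} {#(p, smul Q k q)#}"
| "\<lbrakk>p \<in> car P; q \<in> car Q\<rbrakk> \<Longrightarrow> rel2 P Q r l {#(r b p, q)#} {#(p, l b q)#}"

definition tensor2_eq where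
  "tensor2_eq P Q r l = congruence (rel2 P Q r l)"

definition formal_sums ::
  "('k, 'p, 'y) vspace_scheme \<Rightarrow> ('k, 'q, 'z) vspace_scheme \<Rightarrow> ('p \<times> 'q) multiset set" where
  "formal_sums P Q = {u. set_mset u \<subseteq> car P \<times> car Q}"

text \<open>The same for three factors, balanced by \<open>r, l\<close> over the first and by \<open>r', l'\<close> over the
  second tensor sign.\<close>

inductive rel3 ::
  "('k, 'p::ab_group_add, 'x) vspace_scheme \<Rightarrow> ('k, 'q::ab_group_add, 'y) vspace_scheme
   \<Rightarrow> ('k, 's::ab_group_add, 'z) vspace_scheme
   \<Rightarrow> ('c \<Rightarrow> 'p \<Rightarrow> 'p) \<Rightarrow> ('c \<Rightarrow> 'q \<Rightarrow> 'q) \<Rightarrow> ('c \<Rightarrow> 'q \<Rightarrow> 'q) \<Rightarrow> ('c \<Rightarrow> 's \<Rightarrow> 's)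
   \<Rightarrow> ('p \<times> 'q \<times> 's) multiset \<Rightarrow> ('p \<times> 'q \<times> 's) multiset \<Rightarrow> bool"
  for P Q S r l r' l' where
  "\<lbrakk>p \<in> car P; p' \<in> car P; q \<in> car Q; s \<in> car S\<rbrakk>
   \<Longrightarrow> rel3 P Q S r l r' l' {#(p + p', q, s)#} {#(p, q, s), (p', q, s)#}"
| "\<lbrakk>p \<in> car P; q \<in> car Q; q' \<in> car Q; s \<in> car S\<rbrakk>
   \<Longrightarrow> rel3 P Q S r l r' l' {#(p, q + q', s)#} {#(p, q, s), (p, q', s)#}"
| "\<lbrakk>p \<in> car P; q \<in> car Q; s \<in> car S; s' \<in> car S\<rbrakk>
   \<Longrightarrow> rel3 P Q S r l r' l' {#(p, q, s + s')#} {#(p, q, s), (p, q, s')#}"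
| "\<lbrakk>q \<in> car Q; s \<in> car S\<rbrakk> \<Longrightarrow> rel3 P Q S r l r' l' {#(0, q, s)#} {#}"
| "\<lbrakk>p \<in> car P; q \<in> car Q; s \<in> car S\<rbrakk>
   \<Longrightarrow> rel3 P Q S r l r' l' {#(smul P k p, q, s)#} {#(p, smul Q k q, s)#}"
| "\<lbrakk>p \<in> car P; q \<in> car Q; s \<in> car S\<rbrakk>
   \<Longrightarrow> rel3 P Q S r l r' l' {#(p, smul Q k q, s)#} {#(p, q, smul S k s)#}"
| "\<lbrakk>p \<in> car P; q \<in> car Q; s \<in> car S\<rbrakk>
   \<Longrightarrow> rel3 P Q S r l r' l' {#(r b p, q, s)#} {#(p, l b q, s)#}"
| "\<lbrakk>p \<in> car P; q \<in> car Q; s \<in> car S\<rbrakk>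
   \<Longrightarrow> rel3 P Q S r l r' l' {#(p, r' b q, s)#} {#(p, q, l' b s)#}"

definition tensor3_eq where
  "tensor3_eq P Q S r l r' l' = congruence (rel3 P Q S r l r' l')"

text \<open>\<open>f\<close>, given on formal sums, descends to a bijective map \<open>D/E \<rightarrow> D'/E'\<close>.\<close>

definition invertible_mod ::
  "'x set \<Rightarrow> ('x \<Rightarrow> 'x \<Rightarrow> bool) \<Rightarrow> 'y set \<Rightarrow> ('y \<Rightarrow> 'y \<Rightarrow> bool) \<Rightarrow> ('x \<Rightarrow> 'y) \<Rightarrow> bool" where
  "invertible_mod D E D' E' f \<longleftrightarrow>
     (\<forall>u\<in>D. f u \<in> D') \<and> (\<forall>u\<in>D. \<forall>v\<in>D. E u v \<longleftrightarrow> E' (f u) (f v)) \<and> (\<forall>w\<in>D'. \<exists>u\<in>D. E' (f u) w)"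

section \<open>Faithful flatness\<close>

definition module_map ::
  "('k, 'a, 'm::ab_group_add) lmod \<Rightarrow> ('k, 'a, 'n::ab_group_add) lmod \<Rightarrow> ('m \<Rightarrow> 'n) \<Rightarrow> bool" where
  "module_map M N f \<longleftrightarrow>
     (\<forall>m\<in>car M. f m \<in> car N)
   \<and> (\<forall>m\<in>car M. \<forall>m'\<in>car M. f (m + m') = f m + f m')
   \<and> (\<forall>k. \<forall>m\<in>car M. f (smul M k m) = smul N k (f m))
   \<and> (\<forall>a. \<forall>m\<in>car M. f (act M a m) = act N a (f m))"

text \<open>
  A left module \<open>M\<close> over \<open>A\<close> is faithfully flat if a sequence \<open>N' \<rightarrow> N \<rightarrow> N''\<close> of right
  \<open>A\<close>-modules is exact iff \<open>N' \<otimes>\<^sub>A M \<rightarrow> N \<otimes>\<^sub>A M \<rightarrow> N'' \<otimes>\<^sub>A M\<close> is. The test modules live on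
  subspaces of the type of \<open>A\<close>. Up to isomorphism these include all ideals and, through linear
  complements, all cyclic modules of \<open>A\<close>, which suffice to detect faithful flatness.
\<close>

definition faithfully_flat ::
  "('k::field, 'a::ab_group_add, 'z) algebra_scheme \<Rightarrow> ('k, 'a, 'm::ab_group_add) lmod \<Rightarrow> bool" where
  "faithfully_flat A M \<longleftrightarrow> left_module A M \<and>
     (\<forall>(N' :: ('k, 'a, 'a) lmod) (N :: ('k, 'a, 'a) lmod) (N'' :: ('k, 'a, 'a) lmod) f g.
        left_module (opposite A) N' \<and> left_module (opposite A) N \<and> left_module (opposite A) N''
        \<and> module_map N' N f \<and> module_map N N'' g \<longrightarrow>
        ({n \<in> car N. g n = 0} = f ` car N' \<longleftrightarrow>
         (\<forall>u\<in>formal_sums N M.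
            tensor2_eq N'' M (act N'') (act M) (image_mset (\<lambda>(n, m). (g n, m)) u) {#} \<longleftrightarrow>
            (\<exists>v\<in>formal_sums N' M.
               tensor2_eq N M (act N) (act M) (image_mset (\<lambda>(n, m). (f n, m)) v) u))))"

section \<open>Left bialgebroids and left Hopf algebroids\<close>

record ('k, 'b, 'a) bialgebroid = "('k, 'a) algebra" +
  src :: "'b \<Rightarrow> 'a"
  tgt :: "'b \<Rightarrow> 'a"
  cop :: "'a \<Rightarrow> ('a \<times> 'a) multiset"
  cou :: "'a \<Rightarrow> 'b"

text \<open>Equality in \<open>L \<diamond>\<^sub>B L\<close>, in \<open>L \<diamond>\<^sub>B L \<diamond>\<^sub>B L\<close>, and in \<open>L \<otimes> L\<close> over the opposite of \<open>B\<close>.\<close>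

definition diamond_eq ::
  "('k, 'b, 'a::ab_group_add) bialgebroid \<Rightarrow> ('a \<times> 'a) multiset \<Rightarrow> ('a \<times> 'a) multiset \<Rightarrow> bool" where
  "diamond_eq L = tensor2_eq L L (\<lambda>b x. tgt L b \<cdot>\<^bsub>L\<^esub> x) (\<lambda>b y. src L b \<cdot>\<^bsub>L\<^esub> y)"

definition diamond3_eq ::
  "('k, 'b, 'a::ab_group_add) bialgebroid
   \<Rightarrow> ('a \<times> 'a \<times> 'a) multiset \<Rightarrow> ('a \<times> 'a \<times> 'a) multiset \<Rightarrow> bool" where
  "diamond3_eq L = tensor3_eq L L L (\<lambda>b x. tgt L b \<cdot>\<^bsub>L\<^esub> x) (\<lambda>b y. src L b \<cdot>\<^bsub>L\<^esub> y)
                                    (\<lambda>b x. tgt L b \<cdot>\<^bsub>L\<^esub> x) (\<lambda>b y. src L b \<cdot>\<^bsub>L\<^esub> y)"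

definition over_op_eq ::
  "('k, 'b, 'a::ab_group_add) bialgebroid \<Rightarrow> ('a \<times> 'a) multiset \<Rightarrow> ('a \<times> 'a) multiset \<Rightarrow> bool" where
  "over_op_eq L = tensor2_eq L L (\<lambda>b x. x \<cdot>\<^bsub>L\<^esub> tgt L b) (\<lambda>b y. tgt L b \<cdot>\<^bsub>L\<^esub> y)"

locale left_bialgebroid =
  B: unital_algebra B + L: unital_algebra L
  for B :: "('k::field, 'b::ab_group_add) algebra"
    and L :: "('k, 'b, 'a::ab_group_add) bialgebroid" +
  assumes src_linear: "Vector_Spaces.linear (smul B) (smul L) (src L)"
    and src_one: "src L \<one>\<^bsub>B\<^esub> = \<one>\<^bsub>L\<^esub>"
    and src_mult: "\<And>a b. src L (a \<cdot>\<^bsub>B\<^esub> b) = src L a \<cdot>\<^bsub>L\<^esub> src L b"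
    and tgt_linear: "Vector_Spaces.linear (smul B) (smul L) (tgt L)"
    and tgt_one: "tgt L \<one>\<^bsub>B\<^esub> = \<one>\<^bsub>L\<^esub>"
    and tgt_mult: "\<And>a b. tgt L (a \<cdot>\<^bsub>B\<^esub> b) = tgt L b \<cdot>\<^bsub>L\<^esub> tgt L a"
    and src_tgt_commute: "\<And>a b. src L a \<cdot>\<^bsub>L\<^esub> tgt L b = tgt L b \<cdot>\<^bsub>L\<^esub> src L a"
    \<comment> \<open>\<open>B\<close>-coring\<close>
    and cop_add: "\<And>X Y. diamond_eq L (cop L (X + Y)) (cop L X + cop L Y)"
    and cop_smul: "\<And>k X. diamond_eq L (cop L (smul L k X))
                     (\<Sum>(X1, X2)\<in>#cop L X. {#(smul L k X1, X2)#})"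
    and cop_bimodule: "\<And>a b X. diamond_eq L (cop L (src L a \<cdot>\<^bsub>L\<^esub> tgt L b \<cdot>\<^bsub>L\<^esub> X))
                     (\<Sum>(X1, X2)\<in>#cop L X. {#(src L a \<cdot>\<^bsub>L\<^esub> X1, tgt L b \<cdot>\<^bsub>L\<^esub> X2)#})"
    and coassoc: "\<And>X. diamond3_eq L
                     (\<Sum>(X1, X2)\<in>#cop L X. \<Sum>(X11, X12)\<in>#cop L X1. {#(X11, X12, X2)#})
                     (\<Sum>(X1, X2)\<in>#cop L X. \<Sum>(X21, X22)\<in>#cop L X2. {#(X1, X21, X22)#})"
    and cou_linear: "Vector_Spaces.linear (smul L) (smul B) (cou L)"
    and cou_bimodule: "\<And>a b X. cou L (src L a \<cdot>\<^bsub>L\<^esub> tgt L b \<cdot>\<^bsub>L\<^esub> X) = a \<cdot>\<^bsub>B\<^esub> cou L X \<cdot>\<^bsub>B\<^esub> b"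
    and counit_left: "\<And>X. (\<Sum>(X1, X2)\<in>#cop L X. src L (cou L X1) \<cdot>\<^bsub>L\<^esub> X2) = X"
    and counit_right: "\<And>X. (\<Sum>(X1, X2)\<in>#cop L X. tgt L (cou L X2) \<cdot>\<^bsub>L\<^esub> X1) = X"
    \<comment> \<open>the coproduct is an algebra map into the Takeuchi product\<close>
    and cop_takeuchi: "\<And>b X. diamond_eq L
                     (\<Sum>(X1, X2)\<in>#cop L X. {#(X1 \<cdot>\<^bsub>L\<^esub> tgt L b, X2)#})
                     (\<Sum>(X1, X2)\<in>#cop L X. {#(X1, X2 \<cdot>\<^bsub>L\<^esub> src L b)#})"
    and cop_one: "diamond_eq L (cop L \<one>\<^bsub>L\<^esub>) {#(\<one>\<^bsub>L\<^esub>, \<one>\<^bsub>L\<^esub>)#}"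
    and cop_mult: "\<And>X Y. diamond_eq L (cop L (X \<cdot>\<^bsub>L\<^esub> Y))
                     (\<Sum>(X1, X2)\<in>#cop L X. \<Sum>(Y1, Y2)\<in>#cop L Y. {#(X1 \<cdot>\<^bsub>L\<^esub> Y1, X2 \<cdot>\<^bsub>L\<^esub> Y2)#})"
    and cou_one: "cou L \<one>\<^bsub>L\<^esub> = \<one>\<^bsub>B\<^esub>"
    and cou_src: "\<And>X Y. cou L (X \<cdot>\<^bsub>L\<^esub> src L (cou L Y)) = cou L (X \<cdot>\<^bsub>L\<^esub> Y)"
    and cou_tgt: "\<And>X Y. cou L (X \<cdot>\<^bsub>L\<^esub> tgt L (cou L Y)) = cou L (X \<cdot>\<^bsub>L\<^esub> Y)"

text \<open>The left and right module structures of \<open>L\<close> over \<open>B\<close> (by \<open>src\<close>) and over the opposite of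
  \<open>B\<close> (by \<open>tgt\<close>) are faithfully flat.\<close>

definition faithfully_flat_structures ::
  "('k::field, 'b::ab_group_add) algebra \<Rightarrow> ('k, 'b, 'a::ab_group_add) bialgebroid \<Rightarrow> bool" where
  "faithfully_flat_structures B L \<longleftrightarrow>
     faithfully_flat B (mod_of L (\<lambda>b x. src L b \<cdot>\<^bsub>L\<^esub> x))
   \<and> faithfully_flat (opposite B) (mod_of L (\<lambda>b x. x \<cdot>\<^bsub>L\<^esub> src L b))
   \<and> faithfully_flat (opposite B) (mod_of L (\<lambda>b x. tgt L b \<cdot>\<^bsub>L\<^esub> x))
   \<and> faithfully_flat B (mod_of L (\<lambda>b x. x \<cdot>\<^bsub>L\<^esub> tgt L b))"

definition galois_map ::
  "('k, 'b, 'a) bialgebroid \<Rightarrow> ('a \<times> 'a) multiset \<Rightarrow> ('a \<times> 'a) multiset" where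
  "galois_map L u = (\<Sum>(X, Y)\<in>#u. \<Sum>(X1, X2)\<in>#cop L X. {#(X1, X2 \<cdot>\<^bsub>L\<^esub> Y)#})"

locale left_hopf_algebroid = left_bialgebroid B L
  for B :: "('k::field, 'b::ab_group_add) algebra"
    and L :: "('k, 'b, 'a::ab_group_add) bialgebroid" +
  assumes galois_invertible:
    "invertible_mod UNIV (over_op_eq L) UNIV (diamond_eq L) (galois_map L)"

text \<open>A representative of \<open>X\<^sub>+ \<otimes> X\<^sub>-\<close>; it is unique modulo \<open>over_op_eq L\<close>.\<close>

definition translation ::
  "('k, 'b, 'a::ab_group_add) bialgebroid \<Rightarrow> 'a \<Rightarrow> ('a \<times> 'a) multiset" where
  "translation L X = (SOME u. diamond_eq L (galois_map L u) {#(X, \<one>\<^bsub>L\<^esub>)#})"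

section \<open>Dual pairings\<close>

locale dual_pairing =
  Lam: left_bialgebroid B Lam + H: left_bialgebroid B H
  for B :: "('k::field, 'b::ab_group_add) algebra"
    and Lam :: "('k, 'b, 'l::ab_group_add) bialgebroid"
    and H :: "('k, 'b, 'h::ab_group_add) bialgebroid" +
  fixes br :: "'l \<Rightarrow> 'h \<Rightarrow> 'b"
  assumes linear_left: "\<And>g. Vector_Spaces.linear (smul Lam) (smul B) (\<lambda>x. br x g)"
    and linear_right: "\<And>x. Vector_Spaces.linear (smul H) (smul B) (\<lambda>g. br x g)"
    and pair_bimodule: "\<And>a b c d f x g.
      br (src Lam a \<cdot>\<^bsub>Lam\<^esub> tgt Lam b \<cdot>\<^bsub>Lam\<^esub> x \<cdot>\<^bsub>Lam\<^esub> src Lam c \<cdot>\<^bsub>Lam\<^esub> tgt Lam d) g \<cdot>\<^bsub>B\<^esub> f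
      = a \<cdot>\<^bsub>B\<^esub> br x (src H c \<cdot>\<^bsub>H\<^esub> tgt H f \<cdot>\<^bsub>H\<^esub> g \<cdot>\<^bsub>H\<^esub> src H d \<cdot>\<^bsub>H\<^esub> tgt H b)"
    and pair_mult_right: "\<And>x g h.
      br x (g \<cdot>\<^bsub>H\<^esub> h) = (\<Sum>(x1, x2)\<in>#cop Lam x. br x1 (g \<cdot>\<^bsub>H\<^esub> tgt H (br x2 h)))"
    and pair_mult_right': "\<And>x g h.
      br x (g \<cdot>\<^bsub>H\<^esub> h) = (\<Sum>(x1, x2)\<in>#cop Lam x. br (tgt Lam (br x2 h) \<cdot>\<^bsub>Lam\<^esub> x1) g)"
    and pair_mult_left: "\<And>x y g.
      br (x \<cdot>\<^bsub>Lam\<^esub> y) g = (\<Sum>(g1, g2)\<in>#cop H g. br (x \<cdot>\<^bsub>Lam\<^esub> src Lam (br y g1)) g2)"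
    and pair_mult_left': "\<And>x y g.
      br (x \<cdot>\<^bsub>Lam\<^esub> y) g = (\<Sum>(g1, g2)\<in>#cop H g. br x (src H (br y g1) \<cdot>\<^bsub>H\<^esub> g2))"
    and pair_one_right: "\<And>x. br x \<one>\<^bsub>H\<^esub> = cou Lam x"
    and pair_one_left: "\<And>g. br \<one>\<^bsub>Lam\<^esub> g = cou H g"

section \<open>Cocycles in a left bialgebroid and the twist of the coproduct\<close>

definition left_2_cocycle_in ::
  "('k, 'b, 'l::ab_group_add) bialgebroid \<Rightarrow> ('l \<times> 'l) multiset \<Rightarrow> bool" where
  "left_2_cocycle_in Lam F \<longleftrightarrow>
     (\<Sum>(p, q)\<in>#F. src Lam (cou Lam p) \<cdot>\<^bsub>Lam\<^esub> q) = \<one>\<^bsub>Lam\<^esub>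
   \<and> (\<Sum>(p, q)\<in>#F. tgt Lam (cou Lam q) \<cdot>\<^bsub>Lam\<^esub> p) = \<one>\<^bsub>Lam\<^esub>
   \<and> diamond3_eq Lam
       (\<Sum>(p, q)\<in>#F. \<Sum>(p1, p2)\<in>#cop Lam p. \<Sum>(p', q')\<in>#F. {#(p1 \<cdot>\<^bsub>Lam\<^esub> p', p2 \<cdot>\<^bsub>Lam\<^esub> q', q)#})
       (\<Sum>(p, q)\<in>#F. \<Sum>(q1, q2)\<in>#cop Lam q. \<Sum>(p', q')\<in>#F. {#(p, q1 \<cdot>\<^bsub>Lam\<^esub> p', q2 \<cdot>\<^bsub>Lam\<^esub> q')#})"

definition twist_base ::
  "('k, 'b::ab_group_add) algebra \<Rightarrow> ('k, 'b, 'l) bialgebroid \<Rightarrow> ('l \<times> 'l) multiset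
   \<Rightarrow> ('k, 'b) algebra" where
  "twist_base B Lam F = B\<lparr>mult := \<lambda>a b.
     \<Sum>(p, q)\<in>#F. cou Lam (p \<cdot>\<^bsub>Lam\<^esub> src Lam a) \<cdot>\<^bsub>B\<^esub> cou Lam (q \<cdot>\<^bsub>Lam\<^esub> src Lam b)\<rparr>"

definition twist_src ::
  "('k, 'b, 'l::ab_group_add) bialgebroid \<Rightarrow> ('l \<times> 'l) multiset \<Rightarrow> 'b \<Rightarrow> 'l" where
  "twist_src Lam F b = (\<Sum>(p, q)\<in>#F. src Lam (cou Lam (p \<cdot>\<^bsub>Lam\<^esub> src Lam b)) \<cdot>\<^bsub>Lam\<^esub> q)"

definition twist_tgt ::
  "('k, 'b, 'l::ab_group_add) bialgebroid \<Rightarrow> ('l \<times> 'l) multiset \<Rightarrow> 'b \<Rightarrow> 'l" where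
  "twist_tgt Lam F b = (\<Sum>(p, q)\<in>#F. tgt Lam (cou Lam (q \<cdot>\<^bsub>Lam\<^esub> src Lam b)) \<cdot>\<^bsub>Lam\<^esub> p)"

definition F_sharp ::
  "('l \<times> 'l) multiset \<Rightarrow> ('k, 'l, 'm) lmod \<Rightarrow> ('k, 'l, 'n) lmod
   \<Rightarrow> ('m \<times> 'n) multiset \<Rightarrow> ('m \<times> 'n) multiset" where
  "F_sharp F M N u = (\<Sum>(m, n)\<in>#u. \<Sum>(p, q)\<in>#F. {#(act M p m, act N q n)#})"

text \<open>
  HOL cannot quantify over types inside a formula, so \<open>M\<close> and \<open>N\<close> range over all left modules
  carried by subspaces of vector spaces on the type \<open>'u\<close>. With \<open>'u\<close> the type of \<open>Lam\<close> this includes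
  the regular module.
\<close>

definition cocycle_in_invertible ::
  "'u::ab_group_add itself \<Rightarrow> ('k::field, 'b, 'l::ab_group_add) bialgebroid
   \<Rightarrow> ('l \<times> 'l) multiset \<Rightarrow> bool" where
  "cocycle_in_invertible U Lam F \<longleftrightarrow>
     (\<forall>(M :: ('k, 'l, 'u) lmod) (N :: ('k, 'l, 'u) lmod). left_module Lam M \<and> left_module Lam N \<longrightarrow>
        invertible_mod
          (formal_sums M N)
          (tensor2_eq M N (\<lambda>b. act M (twist_tgt Lam F b)) (\<lambda>b. act N (twist_src Lam F b)))
          (formal_sums M N)
          (tensor2_eq M N (\<lambda>b. act M (tgt Lam b)) (\<lambda>b. act N (src Lam b)))
          (F_sharp F M N))"

text \<open>The coproduct at \<open>x\<close> is a representative of the inverse image of \<open>x\<^sub>1 F\<^sup>i \<diamond> x\<^sub>2 F\<^sub>i\<close> under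
  \<open>F_sharp\<close> on the regular module.\<close>

definition twist ::
  "('k, 'b, 'l::ab_group_add) bialgebroid \<Rightarrow> ('l \<times> 'l) multiset \<Rightarrow> ('k, 'b, 'l) bialgebroid" where
  "twist Lam F = Lam\<lparr>
     src := twist_src Lam F,
     tgt := twist_tgt Lam F,
     cop := \<lambda>x. SOME u. diamond_eq Lam
       (F_sharp F (mod_of Lam (mult Lam)) (mod_of Lam (mult Lam)) u)
       (\<Sum>(x1, x2)\<in>#cop Lam x. \<Sum>(p, q)\<in>#F. {#(x1 \<cdot>\<^bsub>Lam\<^esub> p, x2 \<cdot>\<^bsub>Lam\<^esub> q)#})\<rparr>"

section \<open>Cocycles on a left bialgebroid and the twist of the product\<close>

definition left_2_cocycle_on ::
  "('k::field, 'b::ab_group_add) algebra \<Rightarrow> ('k, 'b, 'h::ab_group_add) bialgebroid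
   \<Rightarrow> ('h \<Rightarrow> 'h \<Rightarrow> 'b) \<Rightarrow> bool" where
  "left_2_cocycle_on B L \<Gamma> \<longleftrightarrow>
     (\<forall>Y. Vector_Spaces.linear (smul L) (smul B) (\<lambda>X. \<Gamma> X Y))
   \<and> (\<forall>X. Vector_Spaces.linear (smul L) (smul B) (\<lambda>Y. \<Gamma> X Y))
   \<and> (\<forall>b X Y. \<Gamma> (X \<cdot>\<^bsub>L\<^esub> tgt L b) Y = \<Gamma> X (tgt L b \<cdot>\<^bsub>L\<^esub> Y))
   \<and> (\<forall>b X Y. \<Gamma> (tgt L b \<cdot>\<^bsub>L\<^esub> X) Y = \<Gamma> X Y \<cdot>\<^bsub>B\<^esub> b)
   \<and> (\<forall>X Y Z.
        (\<Sum>(Y1, Y2)\<in>#cop L Y. \<Sum>(Z1, Z2)\<in>#cop L Z. \<Gamma> X (src L (\<Gamma> Y1 Z1) \<cdot>\<^bsub>L\<^esub> Y2 \<cdot>\<^bsub>L\<^esub> Z2))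
      = (\<Sum>(X1, X2)\<in>#cop L X. \<Sum>(Y1, Y2)\<in>#cop L Y. \<Gamma> (src L (\<Gamma> X1 Y1) \<cdot>\<^bsub>L\<^esub> X2 \<cdot>\<^bsub>L\<^esub> Y2) Z))
   \<and> (\<forall>X. \<Gamma> \<one>\<^bsub>L\<^esub> X = cou L X) \<and> (\<forall>X. \<Gamma> X \<one>\<^bsub>L\<^esub> = cou L X)"

definition cotwist_base ::
  "('k, 'b) algebra \<Rightarrow> ('k, 'b, 'h) bialgebroid \<Rightarrow> ('h \<Rightarrow> 'h \<Rightarrow> 'b) \<Rightarrow> ('k, 'b) algebra" where
  "cotwist_base B L \<Gamma> = B\<lparr>mult := \<lambda>a b. \<Gamma> (src L a) (src L b)\<rparr>"

record ('k, 'b, 'h, 'm) comod = "('k, 'm) vspace" +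
  lact :: "'b \<Rightarrow> 'm \<Rightarrow> 'm"
  ract :: "'b \<Rightarrow> 'm \<Rightarrow> 'm"  \<comment> \<open>\<open>ract M b m\<close> is \<open>m b\<close>\<close>
  coact :: "'m \<Rightarrow> ('h \<times> 'm) multiset"

definition coact_eq ::
  "('k, 'b, 'h::ab_group_add) bialgebroid \<Rightarrow> ('k, 'b, 'h, 'm::ab_group_add) comod
   \<Rightarrow> ('h \<times> 'm) multiset \<Rightarrow> ('h \<times> 'm) multiset \<Rightarrow> bool" where
  "coact_eq L M = tensor2_eq L M (\<lambda>b X. tgt L b \<cdot>\<^bsub>L\<^esub> X) (lact M)"

definition left_comodule ::
  "('k::field, 'b::ab_group_add) algebra \<Rightarrow> ('k, 'b, 'h::ab_group_add) bialgebroid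
   \<Rightarrow> ('k, 'b, 'h, 'm::ab_group_add) comod \<Rightarrow> bool" where
  "left_comodule B L M \<longleftrightarrow>
     left_module B (mod_of M (lact M)) \<and> left_module (opposite B) (mod_of M (ract M))
   \<and> (\<forall>a b. \<forall>m\<in>car M. lact M a (ract M b m) = ract M b (lact M a m))
   \<and> (\<forall>m\<in>car M. coact M m \<in> formal_sums L M)
   \<and> (\<forall>m\<in>car M. \<forall>n\<in>car M. coact_eq L M (coact M (m + n)) (coact M m + coact M n))
   \<and> (\<forall>k. \<forall>m\<in>car M. coact_eq L M (coact M (smul M k m))
        (\<Sum>(X, m0)\<in>#coact M m. {#(smul L k X, m0)#}))
   \<and> (\<forall>m\<in>car M. tensor3_eq L L M
        (\<lambda>b x. tgt L b \<cdot>\<^bsub>L\<^esub> x) (\<lambda>b y. src L b \<cdot>\<^bsub>L\<^esub> y) (\<lambda>b x. tgt L b \<cdot>\<^bsub>L\<^esub> x) (lact M)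
        (\<Sum>(X, m0)\<in>#coact M m. \<Sum>(X1, X2)\<in>#cop L X. {#(X1, X2, m0)#})
        (\<Sum>(X, m0)\<in>#coact M m. \<Sum>(Y, m00)\<in>#coact M m0. {#(X, Y, m00)#}))
   \<and> (\<forall>m\<in>car M. (\<Sum>(X, m0)\<in>#coact M m. lact M (cou L X) m0) = m)
   \<and> (\<forall>b. \<forall>m\<in>car M. coact_eq L M
        (\<Sum>(X, m0)\<in>#coact M m. {#(X \<cdot>\<^bsub>L\<^esub> tgt L b, m0)#})
        (\<Sum>(X, m0)\<in>#coact M m. {#(X, ract M b m0)#}))
   \<and> (\<forall>a b. \<forall>m\<in>car M. coact_eq L M (coact M (lact M a (ract M b m)))
        (\<Sum>(X, m0)\<in>#coact M m. {#(src L a \<cdot>\<^bsub>L\<^esub> X \<cdot>\<^bsub>L\<^esub> src L b, m0)#}))"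

definition lact_cotwist ::
  "('k, 'b, 'h) bialgebroid \<Rightarrow> ('h \<Rightarrow> 'h \<Rightarrow> 'b) \<Rightarrow> ('k, 'b, 'h, 'm::ab_group_add) comod
   \<Rightarrow> 'b \<Rightarrow> 'm \<Rightarrow> 'm" where
  "lact_cotwist L \<Gamma> M a m = (\<Sum>(X, m0)\<in>#coact M m. lact M (\<Gamma> (src L a) X) m0)"

definition ract_cotwist ::
  "('k, 'b, 'h) bialgebroid \<Rightarrow> ('h \<Rightarrow> 'h \<Rightarrow> 'b) \<Rightarrow> ('k, 'b, 'h, 'm::ab_group_add) comod
   \<Rightarrow> 'b \<Rightarrow> 'm \<Rightarrow> 'm" where
  "ract_cotwist L \<Gamma> M a m = (\<Sum>(X, m0)\<in>#coact M m. lact M (\<Gamma> X (src L a)) m0)"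

text \<open>As above, \<open>M\<close> and \<open>N\<close> range over all left comodules carried by subspaces of vector spaces on
  the type \<open>'u\<close>.\<close>

definition cocycle_on_invertible ::
  "'u::ab_group_add itself \<Rightarrow> ('k::field, 'b::ab_group_add) algebra
   \<Rightarrow> ('k, 'b, 'h::ab_group_add) bialgebroid \<Rightarrow> ('h \<Rightarrow> 'h \<Rightarrow> 'b) \<Rightarrow> bool" where
  "cocycle_on_invertible U B L \<Gamma> \<longleftrightarrow>
     (\<forall>(M :: ('k, 'b, 'h, 'u) comod) (N :: ('k, 'b, 'h, 'u) comod).
        left_comodule B L M \<and> left_comodule B L N \<longrightarrow>
        invertible_mod
          (formal_sums M N) (tensor2_eq M N (ract_cotwist L \<Gamma> M) (lact_cotwist L \<Gamma> N))
          (formal_sums M N) (tensor2_eq M N (ract M) (lact N))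
          (\<lambda>u. \<Sum>(m, n)\<in>#u. \<Sum>(X, m0)\<in>#coact M m. \<Sum>(Y, n0)\<in>#coact N n. {#(lact M (\<Gamma> X Y) m0, n0)#}))"

definition Gamma_sharp ::
  "('k, 'b, 'h::ab_group_add) bialgebroid \<Rightarrow> ('h \<Rightarrow> 'h \<Rightarrow> 'b)
   \<Rightarrow> ('h \<times> 'h) multiset \<Rightarrow> ('h \<times> 'h) multiset" where
  "Gamma_sharp L \<Gamma> u = (\<Sum>(X, Y)\<in>#u. \<Sum>(Xp, Xm)\<in>#translation L X. \<Sum>(Y1, Y2)\<in>#cop L Y.
      {#(Xp \<cdot>\<^bsub>L\<^esub> tgt L (\<Gamma> Xm Y1), Y2)#})"

definition cotwist ::
  "('k, 'b, 'h::ab_group_add) bialgebroid \<Rightarrow> ('h \<Rightarrow> 'h \<Rightarrow> 'b::ab_group_add)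
   \<Rightarrow> ('k, 'b, 'h) bialgebroid" where
  "cotwist L \<Gamma> = L\<lparr>
     mult := \<lambda>X Y.
       \<Sum>(X1, X2)\<in>#cop L X. \<Sum>(Y1, Y2)\<in>#cop L Y.
       \<Sum>(Xp, Xm)\<in>#translation L X2. \<Sum>(Yp, Ym)\<in>#translation L Y2.
         src L (\<Gamma> X1 Y1) \<cdot>\<^bsub>L\<^esub> Xp \<cdot>\<^bsub>L\<^esub> Yp \<cdot>\<^bsub>L\<^esub> tgt L (\<Gamma> Ym Xm),
     cop := \<lambda>X. SOME u. diamond_eq L (Gamma_sharp L \<Gamma> u) (cop L X),
     cou := \<lambda>X. \<Sum>(Xp, Xm)\<in>#translation L X. \<Gamma> Xp Xm\<rparr>"

end

theory Submission
  imports Defs "HOL-Library.Function_Algebras"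
begin

text \<open>
  Write \<open>F = F\<^sup>i \<diamond> F\<^sub>i\<close> for the cocycle in \<open>\<Lambda>\<close>. The pairing gives two left actions of \<open>\<Lambda>\<close>
  on the Hopf algebroid,
  \<open>\<alpha> \<rhd> X = \<langle>\<alpha>|X\<^sub>1\<rangle> X\<^sub>2\<close> and \<open>\<alpha> \<unrhd> X = X\<^sub>+ t(\<langle>\<alpha>|X\<^sub>-\<rangle>)\<close>, and the theorem holds because everything
  in its statement is obtained by letting \<open>F\<close> and its inverse act through them:
  \<^item> \<open>\<Gamma>(X, Y) = \<epsilon>((F\<^sup>i \<rhd> X)(F\<^sub>i \<rhd> Y))\<close> (lemma \<open>\<Gamma>_eq\<close>);
  \<^item> the twisted product is \<open>X \<star> Y = (F\<^sup>i \<rhd> F\<^sub>j \<unrhd> X)(F\<^sub>i \<rhd> F\<^sup>j \<unrhd> Y)\<close> (\<open>HG_mult\<close>);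
  \<^item> \<open>\<Gamma>\<^sup>#\<close> is \<open>X \<diamond> Y \<mapsto> F\<^sup>i \<unrhd> X \<diamond> F\<^sub>i \<rhd> Y\<close>, so that the twisted coproduct is
    \<open>G\<^sup>i \<unrhd> X\<^sub>1 \<diamond> G\<^sub>i \<rhd> X\<^sub>2\<close> for the inverse \<open>G\<close> of \<open>F\<close> (\<open>psum_Gamma_sharp\<close>, \<open>cop_HG_Gbal\<close>);
  \<^item> the twisted counit is \<open>\<epsilon>\<^sup>\<Gamma>(X) = \<epsilon>(F\<^sup>i \<rhd> F\<^sub>i \<unrhd> X)\<close> (\<open>cou_HG\<close>);
  \<^item> the new pairing is \<open>[\<alpha>|X] = \<epsilon>\<^sup>\<Gamma>(\<alpha> \<rhd> X)\<close> (\<open>tpair_eq\<close>);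
  \<^item> the multiplications by the old base elements are the actions of the twisted source and target
    of \<open>\<Lambda>\<^sup>F\<close> (\<open>star_src_left\<close> and its neighbours).

  The actions commute. The first makes the Hopf algebroid a module algebra over \<open>\<Lambda>\<close>, the second
  does so for the opposite product (\<open>lhit_prod\<close>, \<open>rhit_prod\<close>); a module algebra can be twisted by a
  cocycle (\<open>twisted_product_assoc\<close>), and doing this for both actions gives the product \<open>\<star>\<close>. The
  coproduct satisfies \<open>\<Delta>(\<alpha> \<rhd> X) = \<alpha> \<rhd> X\<^sub>1 \<diamond> X\<^sub>2\<close> and \<open>\<Delta>(\<alpha> \<unrhd> X) = X\<^sub>1 \<diamond> \<alpha> \<unrhd> X\<^sub>2\<close>, and the
  property of an antipode survives as the identity
  \<open>\<alpha>\<^sub>1 \<unrhd> X\<^sub>1 \<diamond> \<alpha>\<^sub>2 \<rhd> X\<^sub>2 = X\<^sub>1 t(\<epsilon>(\<alpha>)) \<diamond> X\<^sub>2\<close> (\<open>link\<close>). From these rules, the cocycle identity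
  and its consequence for four tensor factors (\<open>F_cocycle4\<close>), the axioms of a bialgebroid for the
  twisted Hopf algebroid follow by computation (\<open>HG_bialgebroid\<close>). The same computations in \<open>\<Lambda>\<close>,
  acting on itself by multiplication, give those for \<open>\<Lambda>\<^sup>F\<close> (\<open>LF_bialgebroid\<close>).

  The axioms of a pairing are then short. The one for \<open>[x|X \<star> Y]\<close> combines
  \<open>x \<rhd> (X \<star> Y) = (x\<^sub>1 \<rhd> X) \<star> (x\<^sub>2 \<rhd> Y)\<close>, for the twisted coproduct of \<open>x\<close>, with the fact that
  \<open>\<epsilon>\<^sup>\<Gamma>(X \<star> Y)\<close> depends on \<open>Y\<close> only through \<open>\<epsilon>\<^sup>\<Gamma>(Y)\<close> (\<open>cou_HG_star_cong\<close>); the one for \<open>[xy|X]\<close> is the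
  counit axiom for \<open>y \<rhd> X\<close>. The cocycle identity for \<open>\<Gamma>\<close> is the associativity of the product twisted
  by \<open>\<rhd>\<close> alone (\<open>\<Gamma>_cocycle\<close>). Finally a comodule over the Hopf algebroid is a \<open>\<Lambda>\<close>-module, and the
  map that has to be inverted for \<open>\<Gamma>\<close> is the action of \<open>F\<close>, with inverse the action of \<open>G\<close>
  (\<open>\<Gamma>_invertible\<close>).

  Identities in tensor products are proved by evaluating balanced forms: over a field, two formal sums
  represent the same element iff every balanced form with values in the field takes the same value on
  both (\<open>congruence_by_functionals\<close>, \<open>tensor2_eqI\<close>, \<open>tensor3_eqI\<close>). In this language the
  representatives chosen for coproducts and translation maps do not matter, and Sweedler calculus is the
  manipulation of iterated sums.
\<close>

section \<open>Sums over formal sums\<close>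

definition psum :: "('x \<times> 'y) multiset \<Rightarrow> ('x \<Rightarrow> 'y \<Rightarrow> 'c::comm_monoid_add) \<Rightarrow> 'c" where
  "psum u f = (\<Sum>(x, y)\<in>#u. f x y)"

text \<open>
  An iterated Sweedler expression is written as an iterated sum over representatives, such as
  \<open>\<Sum>x1 x2:cop L x. \<Sum>y1 y2:cop L x1. t\<close>.
\<close>

syntax "_psum" :: "idt \<Rightarrow> idt \<Rightarrow> ('x \<times> 'y) multiset \<Rightarrow> 'c \<Rightarrow> 'c::comm_monoid_add"
  ("(3\<Sum>_ _:_./ _)" [0, 0, 51, 10] 10)
translations "\<Sum>x y:u. t" \<rightleftharpoons> "CONST psum u (\<lambda>x y. t)"

lemma psum_empty [simp]: "psum {#} f = 0"
  by (simp add: psum_def)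

lemma psum_add_mset: "psum (add_mset (x, y) u) f = f x y + psum u f"
  by (simp add: psum_def)

lemma psum_single [simp]: "psum {#(x, y)#} f = f x y"
  by (simp add: psum_def)

lemma psum_union [simp]: "psum (u + v) f = psum u f + psum v f"
  by (simp add: psum_def)

lemma psum_cong:
  "u = v \<Longrightarrow> (\<And>x y. (x, y) \<in># v \<Longrightarrow> f x y = g x y) \<Longrightarrow> psum u f = psum v g"
  unfolding psum_def by (auto intro!: arg_cong[of _ _ sum_mset] image_mset_cong)

lemma psum_zero [simp]: "(\<Sum>x y:u. 0) = 0"
  by (induction u) (auto simp: psum_add_mset)

lemma psum_plus: "(\<Sum>x y:u. f x y + g x y) = psum u f + psum u g"
  by (induction u) (auto simp: psum_add_mset ac_simps)

lemma psum_swap: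
  "(\<Sum>x y:u. \<Sum>z w:v. f x y z w) = (\<Sum>z w:v. \<Sum>x y:u. f x y z w)"
  by (induction u) (auto simp: psum_add_mset psum_plus)

lemma hom_psum:
  assumes "h 0 = 0" "\<And>x y. h (x + y) = h x + h y"
  shows "h (psum u f) = (\<Sum>x y:u. h (f x y))"
  by (induction u) (auto simp: psum_add_mset assms)

lemma additive_psum:
  fixes h :: "'c::ab_group_add \<Rightarrow> 'd::ab_group_add"
  assumes "\<And>x y. h (x + y) = h x + h y"
  shows "h (psum u f) = (\<Sum>x y:u. h (f x y))"
  by (rule hom_psum) (use assms[of 0 0] assms in auto)

lemma sum_mset_psum:
  "(\<Sum>x\<in>#psum u g. f x) = (\<Sum>x y:u. \<Sum>z\<in>#g x y. f z)"
  by (rule hom_psum) auto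

lemma psum_psum: "psum (psum u g) f = (\<Sum>x y:u. psum (g x y) f)"
  by (rule hom_psum) auto

lemma set_mset_psum: "set_mset (psum u g) = (\<Union>(x, y)\<in>set_mset u. set_mset (g x y))"
  by (induction u) (auto simp: psum_add_mset)

section \<open>Linear functionals detect equality of formal sums\<close>

lemma congruence_functional:
  fixes f :: "'x \<Rightarrow> 'c::comm_monoid_add"
  assumes "congruence R u v" and "\<And>u v. R u v \<Longrightarrow> (\<Sum>x\<in>#u. f x) = (\<Sum>x\<in>#v. f x)"
  shows "(\<Sum>x\<in>#u. f x) = (\<Sum>x\<in>#v. f x)"
  using assms(1) by induction (auto simp: assms(2))

lemma congruence_sum:
  assumes "\<And>x. x \<in> A \<Longrightarrow> congruence R (f x) (g x)"
  shows "congruence R (sum f A) (sum g A)"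
proof (cases "finite A")
  case True
  then show ?thesis using assms
    by (induction A) (auto intro: congruence.intros)
qed (auto intro: congruence.refl)

text \<open>
  A basis of the span stays independent when \<open>x\<close> is added to it, so a linear functional may be
  prescribed to vanish on the basis and to be \<open>1\<close> at \<open>x\<close>.
\<close>

lemma separating_functional:
  assumes "vector_space (s1 :: 'k::field \<Rightarrow> 'v::ab_group_add \<Rightarrow> 'v)" "x \<notin> module.span s1 S"
  obtains g where "Vector_Spaces.linear s1 (*) g" "\<And>y. y \<in> module.span s1 S \<Longrightarrow> g y = 0" "g x = 1"
proof -
  interpret V: vector_space s1 by fact
  interpret K: vector_space "(*) :: 'k \<Rightarrow> 'k \<Rightarrow> 'k"
    by unfold_locales (auto simp: algebra_simps)
  interpret VK: vector_space_pair s1 "(*) :: 'k \<Rightarrow> 'k \<Rightarrow> 'k" ..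
  obtain C where C: "C \<subseteq> V.span S" "V.independent C" "V.span S \<subseteq> V.span C"
    using V.maximal_independent_subset by blast
  have sp: "V.span C = V.span S"
    using C V.span_minimal[OF C(1) V.subspace_span] by blast
  have "V.independent (insert x C)"
    using assms(2) C sp by (simp add: V.independent_insertI)
  then obtain g where g: "Vector_Spaces.linear s1 (*) g"
      "\<forall>y\<in>insert x C. g y = (if y = x then 1 else 0)"
    using VK.linear_independent_extend[of "insert x C" "\<lambda>y. if y = x then 1 else 0"] by blast
  have "x \<notin> C" using assms(2) C by blast
  then have "g y = 0" if "y \<in> V.span C" for y
    using VK.linear_eq_0_on_span[OF g(1), of C] that g(2) by (metis insert_iff)
  then show thesis using that[of g] g sp by auto
qed

text \<open>
  The assumptions say that the formal sums over \<open>D\<close>, modulo the congruence, form a vector space in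
  which the scalar \<open>a\<close> acts on a single term \<open>x\<close> by \<open>sc a x\<close>.
\<close>

locale scaled_congruence =
  fixes R :: "'x multiset \<Rightarrow> 'x multiset \<Rightarrow> bool" and D :: "'x set"
    and sc :: "'k::field \<Rightarrow> 'x \<Rightarrow> 'x"
  assumes closed: "x \<in> D \<Longrightarrow> sc a x \<in> D"
    and sc_add: "x \<in> D \<Longrightarrow> congruence R {#sc (a + b) x#} {#sc a x, sc b x#}"
    and sc_zero: "x \<in> D \<Longrightarrow> congruence R {#sc 0 x#} {#}"
    and sc_one: "x \<in> D \<Longrightarrow> sc 1 x = x"
    and sc_mult: "x \<in> D \<Longrightarrow> sc a (sc b x) = sc (a * b) x"
    and rel_closed: "R u v \<Longrightarrow> set_mset u \<union> set_mset v \<subseteq> D"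
    and rel_sc: "R u v \<Longrightarrow> congruence R (image_mset (sc a) u) (image_mset (sc a) v)"
begin

abbreviation cong (infix "\<sim>" 50) where "cong \<equiv> congruence R"

lemma cong_trans [trans]: "u \<sim> v \<Longrightarrow> v \<sim> w \<Longrightarrow> u \<sim> w"
  by (rule congruence.trans)

definition ind :: "'x \<Rightarrow> 'x \<Rightarrow> 'k" where "ind x = (\<lambda>y. if y = x then 1 else 0)"

text \<open>
  A finitely supported function \<open>w\<close> is turned into the formal sum of the \<open>w(x) x\<close>. Up to the
  congruence this undoes \<open>chi\<close>, which sends a formal sum to its multiplicities.
\<close>

definition rep :: "('x \<Rightarrow> 'k) \<Rightarrow> 'x multiset" where "rep w = (\<Sum>x | w x \<noteq> 0. {#sc (w x) x#})"

definition fin :: "('x \<Rightarrow> 'k) \<Rightarrow> bool" where "fin w \<longleftrightarrow> finite {x. w x \<noteq> 0} \<and> (\<forall>x. w x \<noteq> 0 \<longrightarrow> x \<in> D)"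

abbreviation scale :: "'k \<Rightarrow> ('x \<Rightarrow> 'k) \<Rightarrow> 'x \<Rightarrow> 'k" where "scale c w \<equiv> (\<lambda>x. c * w x)"

lemma cong_sc: "u \<sim> v \<Longrightarrow> image_mset (sc a) u \<sim> image_mset (sc a) v"
  by (induction rule: congruence.induct) (auto intro: congruence.intros rel_sc)

lemma rep_superset:
  assumes "finite A" "A \<subseteq> D" "{x. w x \<noteq> 0} \<subseteq> A"
  shows "(\<Sum>x\<in>A. {#sc (w x) x#}) \<sim> rep w"
proof -
  have "(\<Sum>x\<in>A. {#sc (w x) x#}) \<sim> (\<Sum>x\<in>A. if w x \<noteq> 0 then {#sc (w x) x#} else {#})"
    using assms sc_zero by (intro congruence_sum) (auto intro: congruence.refl)
  also have "(\<Sum>x\<in>A. if w x \<noteq> 0 then {#sc (w x) x#} else {#}) = rep w"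
    unfolding rep_def using assms by (intro sum.mono_neutral_cong_right) auto
  finally show ?thesis .
qed

lemma fin_ind: "x \<in> D \<Longrightarrow> fin (ind x)"
  by (simp add: fin_def ind_def)

lemma fin_add: "fin w \<Longrightarrow> fin w' \<Longrightarrow> fin (w + w')"
  unfolding fin_def
  by (auto intro: finite_subset[of _ "{x. w x \<noteq> 0} \<union> {x. w' x \<noteq> 0}"])
    (metis add.right_neutral)

lemma fin_scale: "fin w \<Longrightarrow> fin (scale c w)"
  unfolding fin_def by (auto intro: finite_subset[of _ "{x. w x \<noteq> 0}"])

lemma rep_add:
  assumes "fin w" "fin w'"
  shows "rep (w + w') \<sim> rep w + rep w'"
proof -
  define A where "A = {x. w x \<noteq> 0} \<union> {x. w' x \<noteq> 0}"
  have A: "finite A" "A \<subseteq> D" using assms by (auto simp: A_def fin_def)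
  have "rep (w + w') \<sim> (\<Sum>x\<in>A. {#sc ((w + w') x) x#})"
    by (intro congruence.sym[OF rep_superset] A) (auto simp: A_def)
  also have "\<dots> \<sim> (\<Sum>x\<in>A. {#sc (w x) x, sc (w' x) x#})"
    using A sc_add by (intro congruence_sum) auto
  also have "(\<Sum>x\<in>A. {#sc (w x) x, sc (w' x) x#}) = (\<Sum>x\<in>A. {#sc (w x) x#}) + (\<Sum>x\<in>A. {#sc (w' x) x#})"
    by (subst sum.distrib[symmetric]) (simp add: add_mset_commute)
  also have "\<dots> \<sim> rep w + rep w'"
    by (intro congruence.add rep_superset A) (auto simp: A_def)
  finally show ?thesis .
qed

lemma rep_scale:
  assumes "fin w"
  shows "rep (scale c w) \<sim> image_mset (sc c) (rep w)"
proof -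
  have A: "finite {x. w x \<noteq> 0}" "{x. w x \<noteq> 0} \<subseteq> D" using assms by (auto simp: fin_def)
  have "rep (scale c w) \<sim> (\<Sum>x | w x \<noteq> 0. {#sc (c * w x) x#})"
    using A by (intro congruence.sym[OF rep_superset]) auto
  also have "(\<Sum>x | w x \<noteq> 0. {#sc (c * w x) x#}) = (\<Sum>x | w x \<noteq> 0. image_mset (sc c) {#sc (w x) x#})"
    using A by (intro sum.cong) (auto simp: sc_mult)
  also have "\<dots> = image_mset (sc c) (rep w)"
    unfolding rep_def by (rule sum_comp_morphism[unfolded o_def]) auto
  finally show ?thesis .
qed

definition chi :: "'x multiset \<Rightarrow> 'x \<Rightarrow> 'k" where "chi u = (\<Sum>x\<in>#u. ind x)"

lemma chi_add_mset: "chi (add_mset x u) = ind x + chi u"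
  by (simp only: chi_def image_mset_add_mset sum_mset.add_mset)

lemma chi_empty: "chi {#} = 0"
  by (simp only: chi_def image_mset_empty sum_mset.empty)

lemma fin_chi: "set_mset u \<subseteq> D \<Longrightarrow> fin (chi u)"
proof (induction u)
  case empty
  then show ?case by (simp add: chi_empty fin_def)
next
  case (add x u)
  then show ?case unfolding chi_add_mset by (intro fin_add fin_ind) auto
qed

lemma rep_zero: "rep 0 = {#}"
  by (simp add: rep_def)

lemma rep_ind: "x \<in> D \<Longrightarrow> rep (ind x) = {#x#}"
  by (simp add: rep_def ind_def sc_one)

lemma rep_chi: "set_mset u \<subseteq> D \<Longrightarrow> rep (chi u) \<sim> u"
proof (induction u)
  case empty
  then show ?case unfolding chi_empty rep_zero by (simp add: congruence.refl)
next
  case (add x u)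
  have "rep (chi (add_mset x u)) \<sim> rep (ind x) + rep (chi u)"
    using add unfolding chi_add_mset by (intro rep_add fin_ind fin_chi) auto
  also have "\<dots> \<sim> {#x#} + u"
    using add by (intro congruence.add) (auto simp: rep_ind intro: congruence.refl)
  finally show ?case by (simp only: add_mset_add_single[of x u] add.commute)
qed

lemma cong_cancel: "set_mset u \<subseteq> D \<Longrightarrow> u + image_mset (sc (-1)) u \<sim> {#}"
proof (induction u)
  case (add x u)
  have "{#x, sc (-1) x#} \<sim> {#sc (1 + -1) x#}"
    using congruence.sym[OF sc_add[of x 1 "-1"]] add by (simp add: sc_one)
  also have "\<dots> \<sim> {#}" using add sc_zero by simp
  finally have "{#x, sc (-1) x#} + (u + image_mset (sc (-1)) u) \<sim> {#} + {#}"
    using add by (intro congruence.add) auto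
  then show ?case by (simp add: add_mset_commute)
qed (simp add: congruence.refl)

text \<open>
  The functions on \<open>'x\<close> with finite support are the free vector space on \<open>'x\<close>. If the difference
  of two formal sums is not in the span of the relations, then some linear functional kills all
  relations but not this difference. Conversely \<open>rep\<close> is additive up to the congruence and kills
  the relations, hence it kills their span.
\<close>

theorem congruence_by_functionals:
  assumes D: "set_mset u \<subseteq> D" "set_mset v \<subseteq> D"
    and eq: "\<And>f :: 'x \<Rightarrow> 'k. (\<And>a x. x \<in> D \<Longrightarrow> f (sc a x) = a * f x)
        \<Longrightarrow> (\<And>u v. R u v \<Longrightarrow> (\<Sum>x\<in>#u. f x) = (\<Sum>x\<in>#v. f x))
        \<Longrightarrow> (\<Sum>x\<in>#u. f x) = (\<Sum>x\<in>#v. f x)"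
  shows "u \<sim> v"
proof -
  interpret V: vector_space scale
    by unfold_locales (auto simp: algebra_simps fun_eq_iff)
  define S where "S = {chi u + scale (-1) (chi v) | u v. R u v}
                    \<union> {ind (sc a x) + scale (-1) (scale a (ind x)) | a x. x \<in> D}"
  define w where "w = chi u + scale (-1) (chi v)"
  have rep_diff: "rep (chi u + scale (-1) (chi v)) \<sim> u + image_mset (sc (-1)) v"
    if "set_mset u \<subseteq> D" "set_mset v \<subseteq> D" for u v
  proof -
    have "rep (chi u + scale (-1) (chi v)) \<sim> rep (chi u) + rep (scale (-1) (chi v))"
      by (intro rep_add fin_chi fin_scale that)
    also have "\<dots> \<sim> u + image_mset (sc (-1)) (rep (chi v))"
      by (intro congruence.add rep_chi rep_scale fin_chi that)
    also have "\<dots> \<sim> u + image_mset (sc (-1)) v"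
      by (intro congruence.add congruence.refl cong_sc rep_chi that)
    finally show ?thesis .
  qed
  have "w \<in> V.span S"
  proof (rule ccontr)
    assume "w \<notin> V.span S"
    then obtain g where g: "Vector_Spaces.linear scale (*) g" "\<And>y. y \<in> V.span S \<Longrightarrow> g y = 0" "g w = 1"
      using separating_functional[OF V.vector_space_axioms] by blast
    have lin: "g (x + y) = g x + g y" "g (scale c x) = c * g x" for c x y
      using g(1) unfolding Vector_Spaces.linear_iff by blast+
    have g0: "g 0 = 0" using lin(2)[of 0 0] by (simp add: zero_fun_def)
    define f where "f x = g (ind x)" for x
    have g_chi: "g (chi m) = (\<Sum>x\<in>#m. f x)" for m
      by (induction m) (simp_all only: chi_empty chi_add_mset g0 lin f_def image_mset_empty
          sum_mset.empty image_mset_add_mset sum_mset.add_mset)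
    have "f (sc a x) = a * f x" if "x \<in> D" for a x
    proof -
      have "ind (sc a x) + scale (-1) (scale a (ind x)) \<in> V.span S"
        using that by (intro V.span_base) (auto simp: S_def)
      from g(2)[OF this] show ?thesis
        by (simp only: lin f_def) simp
    qed
    moreover have "(\<Sum>x\<in>#u. f x) = (\<Sum>x\<in>#v. f x)" if "R u v" for u v
    proof -
      have "chi u + scale (-1) (chi v) \<in> V.span S"
        using that by (intro V.span_base) (auto simp: S_def)
      from g(2)[OF this] show ?thesis
        by (simp only: lin g_chi) simp
    qed
    ultimately have "(\<Sum>x\<in>#u. f x) = (\<Sum>x\<in>#v. f x)" by (rule eq)
    then have "g w = 0" by (simp only: w_def lin g_chi) simp
    with g(3) show False by simp
  qed
  then have "fin w \<and> rep w \<sim> {#}"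
  proof (induction w rule: V.span_induct_alt)
    case base
    then show ?case using rep_zero by (simp add: fin_def congruence.refl zero_fun_def)
  next
    case (step c x y)
    have x: "fin x \<and> rep x \<sim> {#}"
      using step(1) unfolding S_def
    proof (elim UnE CollectE exE conjE)
      fix u v assume x: "x = chi u + scale (-1) (chi v)" and R: "R u v"
      have D: "set_mset u \<subseteq> D" "set_mset v \<subseteq> D" using rel_closed[OF R] by auto
      have "rep x \<sim> u + image_mset (sc (-1)) v" unfolding x by (intro rep_diff D)
      also have "\<dots> \<sim> v + image_mset (sc (-1)) v"
        by (intro congruence.add congruence.refl congruence.base R)
      also have "\<dots> \<sim> {#}" by (intro cong_cancel D)
      finally have "rep x \<sim> {#}" .
      moreover have "fin x" unfolding x by (intro fin_add fin_scale fin_chi D)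
      ultimately show ?thesis by simp
    next
      fix a z assume x: "x = ind (sc a z) + scale (-1) (scale a (ind z))" and z: "z \<in> D"
      have x': "x = ind (sc a z) + scale (- a) (ind z)" unfolding x by (simp add: fun_eq_iff)
      have "rep x \<sim> rep (ind (sc a z)) + rep (scale (- a) (ind z))"
        unfolding x' by (intro rep_add fin_ind fin_scale closed z)
      also have "\<dots> \<sim> {#sc a z#} + image_mset (sc (- a)) (rep (ind z))"
        using z by (intro congruence.add rep_scale fin_ind) (auto simp: rep_ind closed congruence.refl)
      also have "{#sc a z#} + image_mset (sc (- a)) (rep (ind z)) = {#sc a z, sc (- a) z#}"
        using z by (simp add: rep_ind)
      also have "\<dots> \<sim> {#sc (a + - a) z#}" by (intro congruence.sym[OF sc_add] z)
      also have "\<dots> \<sim> {#}" using sc_zero z by simp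
      finally have "rep x \<sim> {#}" .
      moreover have "fin x" unfolding x' by (intro fin_add fin_scale fin_ind closed z)
      ultimately show ?thesis by simp
    qed
    have "rep (scale c x + y) \<sim> rep (scale c x) + rep y"
      using x step by (intro rep_add fin_scale) auto
    also have "\<dots> \<sim> image_mset (sc c) (rep x) + {#}"
      using x step by (intro congruence.add rep_scale) auto
    also have "\<dots> \<sim> image_mset (sc c) {#} + {#}"
      using x by (intro congruence.add congruence.refl cong_sc) auto
    finally have "rep (scale c x + y) \<sim> {#}" by simp
    moreover have "fin (scale c x + y)" using x step by (intro fin_add fin_scale) auto
    ultimately show ?case by blast
  qed
  then have "rep w \<sim> {#}" by blast
  have "u + {#} \<sim> u + (v + image_mset (sc (-1)) v)"
    by (intro congruence.add congruence.refl congruence.sym[OF cong_cancel] D)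
  also have "u + (v + image_mset (sc (-1)) v) = v + (u + image_mset (sc (-1)) v)"
    by (simp add: ac_simps)
  also have "\<dots> \<sim> v + rep w"
    unfolding w_def by (intro congruence.add congruence.refl congruence.sym[OF rep_diff] D)
  also have "\<dots> \<sim> v + {#}" by (intro congruence.add congruence.refl) fact
  finally show ?thesis by simp
qed

end

section \<open>Forms on tensor products\<close>

text \<open>
  The forms on \<open>P\<close> and \<open>Q\<close> are the maps out of their tensor product; outside the carriers their values
  are arbitrary.
\<close>

definition form_on where
  "form_on P Q r l \<phi> \<longleftrightarrow>
     (\<forall>x\<in>car P. \<forall>x'\<in>car P. \<forall>y\<in>car Q. \<phi> (x + x') y = \<phi> x y + \<phi> x' y)
   \<and> (\<forall>x\<in>car P. \<forall>y\<in>car Q. \<forall>y'\<in>car Q. \<phi> x (y + y') = \<phi> x y + \<phi> x y')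
   \<and> (\<forall>k. \<forall>x\<in>car P. \<forall>y\<in>car Q. \<phi> (smul P k x) y = \<phi> x (smul Q k y))
   \<and> (\<forall>b. \<forall>x\<in>car P. \<forall>y\<in>car Q. \<phi> (r b x) y = \<phi> x (l b y))"

lemma tensor2_eq_psum:
  fixes \<phi> :: "'p::ab_group_add \<Rightarrow> 'q::ab_group_add \<Rightarrow> 'c::ab_group_add"
  assumes "tensor2_eq P Q r l u v" "form_on P Q r l \<phi>" "0 \<in> car P"
  shows "psum u \<phi> = psum v \<phi>"
proof -
  have "\<phi> (0 + 0) y = \<phi> 0 y + \<phi> 0 y" if "y \<in> car Q" for y
    using assms(2,3) that unfolding form_on_def by blast
  then have 0: "\<phi> 0 y = 0" if "y \<in> car Q" for y using that by simp
  have "(\<Sum>z\<in>#u. case_prod \<phi> z) = (\<Sum>z\<in>#v. case_prod \<phi> z)"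
    using assms(1) unfolding tensor2_eq_def
  proof (rule congruence_functional)
    fix u v assume "rel2 P Q r l u v"
    then show "(\<Sum>z\<in>#u. case_prod \<phi> z) = (\<Sum>z\<in>#v. case_prod \<phi> z)"
      using assms(2) by cases (auto simp: form_on_def 0)
  qed
  then show ?thesis by (simp add: psum_def)
qed

text \<open>
  The tensor product is a vector space by scaling the first factor; this needs \<open>r\<close> to commute with
  scalars. So its elements are separated by linear functionals, and those are forms.
\<close>

theorem tensor2_eqI:
  fixes P :: "('k::field, 'p::ab_group_add, 'y) vspace_scheme"
    and Q :: "('k, 'q::ab_group_add, 'z) vspace_scheme"
  assumes P: "is_vspace P" and Q: "is_vspace Q"
    and r: "\<And>b x. x \<in> car P \<Longrightarrow> r b x \<in> car P"
      "\<And>b k x. x \<in> car P \<Longrightarrow> r b (smul P k x) = smul P k (r b x)"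
    and l: "\<And>b y. y \<in> car Q \<Longrightarrow> l b y \<in> car Q"
    and uv: "u \<in> formal_sums P Q" "v \<in> formal_sums P Q"
    and eq: "\<And>\<phi> :: 'p \<Rightarrow> 'q \<Rightarrow> 'k. form_on P Q r l \<phi> \<Longrightarrow> psum u \<phi> = psum v \<phi>"
  shows "tensor2_eq P Q r l u v"
proof -
  interpret P: vector_space "smul P" using P by (simp add: is_vspace_def)
  interpret Q: vector_space "smul Q" using Q by (simp add: is_vspace_def)
  have Pc: "0 \<in> car P" "\<And>k x. x \<in> car P \<Longrightarrow> smul P k x \<in> car P"
      "\<And>x x'. x \<in> car P \<Longrightarrow> x' \<in> car P \<Longrightarrow> x + x' \<in> car P"
    using P unfolding is_vspace_def P.subspace_def by auto
  have Qc: "\<And>k x. x \<in> car Q \<Longrightarrow> smul Q k x \<in> car Q"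
      "\<And>x x'. x \<in> car Q \<Longrightarrow> x' \<in> car Q \<Longrightarrow> x + x' \<in> car Q"
    using Q unfolding is_vspace_def Q.subspace_def by auto
  define sc where "sc a z = (case z of (x, y) \<Rightarrow> (smul P a x, y))" for a and z :: "'p \<times> 'q"
  have sc [simp]: "sc a (x, y) = (smul P a x, y)" for a x y by (simp add: sc_def)
  interpret scaled_congruence "rel2 P Q r l" "car P \<times> car Q" sc
  proof
    fix z a b assume z: "z \<in> car P \<times> car Q"
    show "sc a z \<in> car P \<times> car Q" "sc 1 z = z" "sc a (sc b z) = sc (a * b) z"
      using z Pc by auto
    show "congruence (rel2 P Q r l) {#sc (a + b) z#} {#sc a z, sc b z#}"
      using z Pc by (auto simp: P.scale_left_distrib intro!: congruence.base rel2.intros)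
    show "congruence (rel2 P Q r l) {#sc 0 z#} {#}"
      using z by (auto intro!: congruence.base rel2.intros)
  next
    fix u v a assume "rel2 P Q r l u v"
    then show "set_mset u \<union> set_mset v \<subseteq> car P \<times> car Q"
      by cases (auto simp: Pc Qc r l)
    from \<open>rel2 P Q r l u v\<close>
    show "congruence (rel2 P Q r l) (image_mset (sc a) u) (image_mset (sc a) v)"
    proof cases
      case (1 p p' q)
      then show ?thesis
        by (auto simp: P.scale_right_distrib Pc intro!: congruence.base rel2.intros)
    next
      case (4 p q k)
      then have "rel2 P Q r l {#(smul P k (smul P a p), q)#} {#(smul P a p, smul Q k q)#}"
        by (intro rel2.intros Pc) auto
      then show ?thesis using 4 by (auto simp: mult.commute intro!: congruence.base)
    next
      case (5 p q b)
      then have "rel2 P Q r l {#(r b (smul P a p), q)#} {#(smul P a p, l b q)#}"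
        by (intro rel2.intros Pc) auto
      then show ?thesis using 5 by (auto simp: r intro!: congruence.base)
    qed (auto simp: Pc intro!: congruence.base rel2.intros)
  qed
  show ?thesis unfolding tensor2_eq_def
  proof (rule congruence_by_functionals)
    show "set_mset u \<subseteq> car P \<times> car Q" "set_mset v \<subseteq> car P \<times> car Q"
      using uv by (auto simp: formal_sums_def)
    fix f :: "'p \<times> 'q \<Rightarrow> 'k"
    assume R: "\<And>u v. rel2 P Q r l u v \<Longrightarrow> (\<Sum>x\<in>#u. f x) = (\<Sum>x\<in>#v. f x)"
    have "form_on P Q r l (\<lambda>x y. f (x, y))"
      unfolding form_on_def
      using R[OF rel2.intros(1)] R[OF rel2.intros(2)] R[OF rel2.intros(4)] R[OF rel2.intros(5)]
      by auto
    from eq[OF this] show "(\<Sum>x\<in>#u. f x) = (\<Sum>x\<in>#v. f x)"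
      by (simp add: psum_def)
  qed
qed

definition tsum :: "('x \<times> 'y \<times> 'z) multiset \<Rightarrow> ('x \<Rightarrow> 'y \<Rightarrow> 'z \<Rightarrow> 'c::comm_monoid_add) \<Rightarrow> 'c" where
  "tsum u f = (\<Sum>(x, y, z)\<in>#u. f x y z)"

lemma tsum_single [simp]: "tsum {#(x, y, z)#} f = f x y z"
  by (simp add: tsum_def)

lemma tsum_psum: "tsum (psum u g) f = (\<Sum>x y:u. tsum (g x y) f)"
  unfolding tsum_def by (rule sum_mset_psum)

definition form3_on where
  "form3_on P Q S r l r' l' \<psi> \<longleftrightarrow>
     (\<forall>x\<in>car P. \<forall>x'\<in>car P. \<forall>y\<in>car Q. \<forall>z\<in>car S. \<psi> (x + x') y z = \<psi> x y z + \<psi> x' y z)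
   \<and> (\<forall>x\<in>car P. \<forall>y\<in>car Q. \<forall>y'\<in>car Q. \<forall>z\<in>car S. \<psi> x (y + y') z = \<psi> x y z + \<psi> x y' z)
   \<and> (\<forall>x\<in>car P. \<forall>y\<in>car Q. \<forall>z\<in>car S. \<forall>z'\<in>car S. \<psi> x y (z + z') = \<psi> x y z + \<psi> x y z')
   \<and> (\<forall>k. \<forall>x\<in>car P. \<forall>y\<in>car Q. \<forall>z\<in>car S. \<psi> (smul P k x) y z = \<psi> x (smul Q k y) z)
   \<and> (\<forall>k. \<forall>x\<in>car P. \<forall>y\<in>car Q. \<forall>z\<in>car S. \<psi> x (smul Q k y) z = \<psi> x y (smul S k z))
   \<and> (\<forall>b. \<forall>x\<in>car P. \<forall>y\<in>car Q. \<forall>z\<in>car S. \<psi> (r b x) y z = \<psi> x (l b y) z)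
   \<and> (\<forall>b. \<forall>x\<in>car P. \<forall>y\<in>car Q. \<forall>z\<in>car S. \<psi> x (r' b y) z = \<psi> x y (l' b z))"

lemma tensor3_eq_tsum:
  fixes \<psi> :: "'p::ab_group_add \<Rightarrow> 'q::ab_group_add \<Rightarrow> 's::ab_group_add \<Rightarrow> 'c::ab_group_add"
  assumes "tensor3_eq P Q S r l r' l' u v" "form3_on P Q S r l r' l' \<psi>" "0 \<in> car P"
  shows "tsum u \<psi> = tsum v \<psi>"
proof -
  have "\<psi> (0 + 0) y z = \<psi> 0 y z + \<psi> 0 y z" if "y \<in> car Q" "z \<in> car S" for y z
    using assms(2)[unfolded form3_on_def, THEN conjunct1] assms(3) that by blast
  then have 0: "\<psi> 0 y z = 0" if "y \<in> car Q" "z \<in> car S" for y z using that by simp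
  have "(\<Sum>(x, y, z)\<in>#u. \<psi> x y z) = (\<Sum>(x, y, z)\<in>#v. \<psi> x y z)"
    using assms(1) unfolding tensor3_eq_def
  proof (rule congruence_functional)
    fix u v assume "rel3 P Q S r l r' l' u v"
    then show "(\<Sum>(x, y, z)\<in>#u. \<psi> x y z) = (\<Sum>(x, y, z)\<in>#v. \<psi> x y z)"
      using assms(2) by cases (auto simp: form3_on_def 0)
  qed
  then show ?thesis by (simp add: tsum_def)
qed

theorem tensor3_eqI:
  fixes P :: "('k::field, 'p::ab_group_add, 'x) vspace_scheme"
    and Q :: "('k, 'q::ab_group_add, 'y) vspace_scheme"
    and S :: "('k, 's::ab_group_add, 'z) vspace_scheme"
  assumes P: "is_vspace P" "car P = UNIV" and Q: "car Q = UNIV" and S: "car S = UNIV"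
    and r: "\<And>b k x. r b (smul P k x) = smul P k (r b x)"
    and eq: "\<And>\<psi> :: 'p \<Rightarrow> 'q \<Rightarrow> 's \<Rightarrow> 'k. form3_on P Q S r l r' l' \<psi> \<Longrightarrow> tsum u \<psi> = tsum v \<psi>"
  shows "tensor3_eq P Q S r l r' l' u v"
proof -
  interpret P: vector_space "smul P" using P by (simp add: is_vspace_def)
  define sc where "sc a z = (case z of (x, y) \<Rightarrow> (smul P a x, y))" for a and z :: "'p \<times> 'q \<times> 's"
  have sc [simp]: "sc a (x, y) = (smul P a x, y)" for a x y by (simp add: sc_def)
  interpret scaled_congruence "rel3 P Q S r l r' l'" UNIV sc
  proof
    fix z a b
    show "sc a z \<in> UNIV" "sc 1 z = z" "sc a (sc b z) = sc (a * b) z"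
      by (cases z; simp)+
    show "congruence (rel3 P Q S r l r' l') {#sc (a + b) z#} {#sc a z, sc b z#}"
      by (cases z) (auto simp: P.scale_left_distrib P Q S intro!: congruence.base rel3.intros)
    show "congruence (rel3 P Q S r l r' l') {#sc 0 z#} {#}"
      by (cases z) (auto simp: P Q S intro!: congruence.base rel3.intros)
  next
    fix u v a assume "rel3 P Q S r l r' l' u v"
    then show "congruence (rel3 P Q S r l r' l') (image_mset (sc a) u) (image_mset (sc a) v)"
    proof cases
      case (1 p p' q s)
      then show ?thesis
        by (auto simp: P.scale_right_distrib P intro!: congruence.base rel3.intros)
    next
      case (5 p q s k)
      then have "rel3 P Q S r l r' l' {#(smul P k (smul P a p), q, s)#} {#(smul P a p, smul Q k q, s)#}"
        by (intro rel3.intros) (auto simp: P)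
      then show ?thesis using 5 by (auto simp: mult.commute intro!: congruence.base)
    next
      case (7 p q s b)
      then have "rel3 P Q S r l r' l' {#(r b (smul P a p), q, s)#} {#(smul P a p, l b q, s)#}"
        by (intro rel3.intros) (auto simp: P)
      then show ?thesis using 7 by (auto simp: r intro!: congruence.base)
    qed (auto simp: P intro!: congruence.base rel3.intros)
  qed auto
  show ?thesis unfolding tensor3_eq_def
  proof (rule congruence_by_functionals)
    fix f :: "'p \<times> 'q \<times> 's \<Rightarrow> 'k"
    assume R: "\<And>u v. rel3 P Q S r l r' l' u v \<Longrightarrow> (\<Sum>x\<in>#u. f x) = (\<Sum>x\<in>#v. f x)"
    have "form3_on P Q S r l r' l' (\<lambda>x y z. f (x, y, z))"
      unfolding form3_on_def
      using R[OF rel3.intros(1)] R[OF rel3.intros(2)] R[OF rel3.intros(3)] R[OF rel3.intros(5)]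
        R[OF rel3.intros(6)] R[OF rel3.intros(7)] R[OF rel3.intros(8)]
      by auto
    from eq[OF this] show "(\<Sum>x\<in>#u. f x) = (\<Sum>x\<in>#v. f x)"
      by (simp add: tsum_def)
  qed auto
qed

section \<open>Forms on bialgebroids\<close>

text \<open>
  Forms on modules whose carriers are whole types. Compatibility with scalars is left out because in
  all cases below the scalars act through the base, so that it follows from balance over the base.
\<close>

definition form :: "('e \<Rightarrow> 'p \<Rightarrow> 'p) \<Rightarrow> ('e \<Rightarrow> 'q \<Rightarrow> 'q)
    \<Rightarrow> ('p::ab_group_add \<Rightarrow> 'q::ab_group_add \<Rightarrow> 'c::ab_group_add) \<Rightarrow> bool" where
  "form r l \<phi> \<longleftrightarrow> (\<forall>x x' y. \<phi> (x + x') y = \<phi> x y + \<phi> x' y)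
     \<and> (\<forall>x y y'. \<phi> x (y + y') = \<phi> x y + \<phi> x y') \<and> (\<forall>b x y. \<phi> (r b x) y = \<phi> x (l b y))"

lemma formI:
  assumes "\<And>x x' y. \<phi> (x + x') y = \<phi> x y + \<phi> x' y" "\<And>x y y'. \<phi> x (y + y') = \<phi> x y + \<phi> x y'"
    "\<And>b x y. \<phi> (r b x) y = \<phi> x (l b y)"
  shows "form r l \<phi>"
  using assms by (simp add: form_def)

lemma form_simps:
  assumes "form r l \<phi>"
  shows "\<phi> (x + x') y = \<phi> x y + \<phi> x' y" "\<phi> x (y + y') = \<phi> x y + \<phi> x y'"
    "\<phi> (r b x) y = \<phi> x (l b y)" "\<phi> 0 y = 0" "\<phi> x 0 = 0"
    "\<phi> (psum u f) y = (\<Sum>p q:u. \<phi> (f p q) y)" "\<phi> x (psum u g) = (\<Sum>p q:u. \<phi> x (g p q))"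
proof -
  note 1 = assms[unfolded form_def]
  show "\<phi> (x + x') y = \<phi> x y + \<phi> x' y" "\<phi> x (y + y') = \<phi> x y + \<phi> x y'"
    "\<phi> (r b x) y = \<phi> x (l b y)" using 1 by blast+
  show "\<phi> 0 y = 0" "\<phi> x 0 = 0" using 1 by (metis add_cancel_right_right)+
  show "\<phi> (psum u f) y = (\<Sum>p q:u. \<phi> (f p q) y)" "\<phi> x (psum u g) = (\<Sum>p q:u. \<phi> x (g p q))"
    by (rule additive_psum; use 1 in blast)+
qed

definition form3 :: "('e \<Rightarrow> 'p \<Rightarrow> 'p) \<Rightarrow> ('e \<Rightarrow> 'q \<Rightarrow> 'q) \<Rightarrow> ('f \<Rightarrow> 'q \<Rightarrow> 'q) \<Rightarrow> ('f \<Rightarrow> 's \<Rightarrow> 's)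
    \<Rightarrow> ('p::ab_group_add \<Rightarrow> 'q::ab_group_add \<Rightarrow> 's::ab_group_add \<Rightarrow> 'c::ab_group_add) \<Rightarrow> bool" where
  "form3 r l r' l' \<psi> \<longleftrightarrow> (\<forall>x x' y z. \<psi> (x + x') y z = \<psi> x y z + \<psi> x' y z)
     \<and> (\<forall>x y y' z. \<psi> x (y + y') z = \<psi> x y z + \<psi> x y' z)
     \<and> (\<forall>x y z z'. \<psi> x y (z + z') = \<psi> x y z + \<psi> x y z')
     \<and> (\<forall>b x y z. \<psi> (r b x) y z = \<psi> x (l b y) z) \<and> (\<forall>b x y z. \<psi> x (r' b y) z = \<psi> x y (l' b z))"

lemma form3I:
  assumes "\<And>x x' y z. \<psi> (x + x') y z = \<psi> x y z + \<psi> x' y z"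
    "\<And>x y y' z. \<psi> x (y + y') z = \<psi> x y z + \<psi> x y' z"
    "\<And>x y z z'. \<psi> x y (z + z') = \<psi> x y z + \<psi> x y z'"
    "\<And>b x y z. \<psi> (r b x) y z = \<psi> x (l b y) z" "\<And>b x y z. \<psi> x (r' b y) z = \<psi> x y (l' b z)"
  shows "form3 r l r' l' \<psi>"
  using assms by (simp add: form3_def)

lemma form3_simps:
  assumes "form3 r l r' l' \<psi>"
  shows "\<psi> (x + x') y z = \<psi> x y z + \<psi> x' y z" "\<psi> x (y + y') z = \<psi> x y z + \<psi> x y' z"
    "\<psi> x y (z + z') = \<psi> x y z + \<psi> x y z'"
    "\<psi> (r b x) y z = \<psi> x (l b y) z" "\<psi> x (r' b y) z = \<psi> x y (l' b z)"
    "\<psi> (psum u f) y z = (\<Sum>p q:u. \<psi> (f p q) y z)"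
    "\<psi> x (psum u g) z = (\<Sum>p q:u. \<psi> x (g p q) z)"
    "\<psi> x y (psum u h) = (\<Sum>p q:u. \<psi> x y (h p q))"
proof -
  note 1 = assms[unfolded form3_def]
  show "\<psi> (x + x') y z = \<psi> x y z + \<psi> x' y z" "\<psi> x (y + y') z = \<psi> x y z + \<psi> x y' z"
    "\<psi> x y (z + z') = \<psi> x y z + \<psi> x y z'"
    "\<psi> (r b x) y z = \<psi> x (l b y) z" "\<psi> x (r' b y) z = \<psi> x y (l' b z)"
    using 1 by blast+
  show "\<psi> (psum u f) y z = (\<Sum>p q:u. \<psi> (f p q) y z)"
    by (rule additive_psum[where h = "\<lambda>w. \<psi> w y z"]) (use 1 in blast)
  show "\<psi> x (psum u g) z = (\<Sum>p q:u. \<psi> x (g p q) z)"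
    by (rule additive_psum[where h = "\<lambda>w. \<psi> x w z"]) (use 1 in blast)
  show "\<psi> x y (psum u h) = (\<Sum>p q:u. \<psi> x y (h p q))"
    by (rule additive_psum) (use 1 in blast)
qed

lemma form3_form:
  assumes "form3 r l r' l' \<psi>"
  shows "form r l (\<lambda>x y. \<psi> x y z)" "form r' l' (\<lambda>y z. \<psi> x y z)"
  using assms by (simp_all add: form3_def form_def)

text \<open>
  Here \<open>e\<close> embeds the field in the base.
\<close>

lemma tensor2_eq_form:
  assumes "tensor2_eq P Q r l u v" "form r l \<phi>" "car P = UNIV"
    and "\<And>k x. smul P k x = r (e k) x" "\<And>k y. smul Q k y = l (e k) y"
  shows "psum u \<phi> = psum v \<phi>"
proof (rule tensor2_eq_psum[OF assms(1)])
  show "form_on P Q r l \<phi>" unfolding form_on_def assms(4,5) by (auto simp: form_simps[OF assms(2)])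
qed (simp add: assms)

lemma tensor2_eq_formI:
  fixes P :: "('k::field, 'p::ab_group_add, 'y) vspace_scheme"
    and Q :: "('k, 'q::ab_group_add, 'z) vspace_scheme"
  assumes "vector_space (smul P)" "vector_space (smul Q)" and c: "car P = UNIV" "car Q = UNIV"
    and "\<And>b k x. r b (smul P k x) = smul P k (r b x)"
    and eq: "\<And>\<phi> :: 'p \<Rightarrow> 'q \<Rightarrow> 'k. form r l \<phi> \<Longrightarrow> psum u \<phi> = psum v \<phi>"
  shows "tensor2_eq P Q r l u v"
proof (rule tensor2_eqI)
  show "is_vspace P" "is_vspace Q"
    using assms by (auto simp: is_vspace_def module.subspace_UNIV module_iff_vector_space)
  show "form_on P Q r l \<phi> \<Longrightarrow> psum u \<phi> = psum v \<phi>" for \<phi> :: "'p \<Rightarrow> 'q \<Rightarrow> 'k"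
    using eq[of \<phi>] c by (simp add: form_on_def form_def)
qed (use assms in \<open>auto simp: formal_sums_def\<close>)

context unital_algebra
begin

lemma mult_add_left [simp]: "(x + y) \<cdot>\<^bsub>A\<^esub> z = x \<cdot>\<^bsub>A\<^esub> z + y \<cdot>\<^bsub>A\<^esub> z"
  and mult_add_right [simp]: "z \<cdot>\<^bsub>A\<^esub> (x + y) = z \<cdot>\<^bsub>A\<^esub> x + z \<cdot>\<^bsub>A\<^esub> y"
  and mult_smul_left [simp]: "smul A k x \<cdot>\<^bsub>A\<^esub> z = smul A k (x \<cdot>\<^bsub>A\<^esub> z)"
  and mult_smul_right [simp]: "z \<cdot>\<^bsub>A\<^esub> smul A k x = smul A k (z \<cdot>\<^bsub>A\<^esub> x)"
  using linear_left[of z] linear_right[of z] by (auto simp: Vector_Spaces.linear_iff)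

lemma mult_zero [simp]: "0 \<cdot>\<^bsub>A\<^esub> z = 0" "z \<cdot>\<^bsub>A\<^esub> 0 = 0"
  using mult_add_left[of 0 0 z] mult_add_right[of z 0 0] by simp_all

lemma mult_psum [simp]: "psum u f \<cdot>\<^bsub>A\<^esub> z = (\<Sum>x y:u. f x y \<cdot>\<^bsub>A\<^esub> z)"
  "z \<cdot>\<^bsub>A\<^esub> psum u f = (\<Sum>x y:u. z \<cdot>\<^bsub>A\<^esub> f x y)"
  by (rule additive_psum[where h = "\<lambda>w. w \<cdot>\<^bsub>A\<^esub> z"], simp)
     (rule additive_psum[where h = "\<lambda>w. z \<cdot>\<^bsub>A\<^esub> w"], simp)

declare assoc [simp] one_left [simp] one_right [simp] carrier [simp]

lemma smul_add [simp]: "smul A k (x + y) = smul A k x + smul A k y"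
  using vspace by (simp add: vector_space_def)

lemma smul_psum: "smul A k (psum u f) = (\<Sum>x y:u. smul A k (f x y))"
  by (rule additive_psum) simp

end

context left_bialgebroid
begin

abbreviation mul (infixl "\<odot>" 70) where "x \<odot> y \<equiv> x \<cdot>\<^bsub>L\<^esub> y"

lemma src_add [simp]: "src L (a + b) = src L a + src L b"
  and src_smul [simp]: "src L (smul B k a) = smul L k (src L a)"
  and tgt_add [simp]: "tgt L (a + b) = tgt L a + tgt L b"
  and tgt_smul [simp]: "tgt L (smul B k a) = smul L k (tgt L a)"
  and cou_add [simp]: "cou L (x + y) = cou L x + cou L y"
  and cou_smul [simp]: "cou L (smul L k x) = smul B k (cou L x)"
  using src_linear tgt_linear cou_linear by (auto simp: Vector_Spaces.linear_iff)

lemma src_psum [simp]: "src L (psum u f) = (\<Sum>x y:u. src L (f x y))"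
  and tgt_psum [simp]: "tgt L (psum u f) = (\<Sum>x y:u. tgt L (f x y))"
  and cou_psum [simp]: "cou L (psum u g) = (\<Sum>x y:u. cou L (g x y))"
  by (rule additive_psum; simp)+

lemma src_zero [simp]: "src L 0 = 0" and tgt_zero [simp]: "tgt L 0 = 0" and cou_zero [simp]: "cou L 0 = 0"
  using src_add[of 0 0] tgt_add[of 0 0] cou_add[of 0 0] by simp_all

declare src_one [simp] tgt_one [simp] src_mult [simp] tgt_mult [simp] cou_one [simp]

lemma tgt_src: "tgt L b \<odot> src L a = src L a \<odot> tgt L b"
  by (simp add: src_tgt_commute)

lemma tgt_src_left: "tgt L b \<odot> (src L a \<odot> x) = src L a \<odot> (tgt L b \<odot> x)"
  using tgt_src[of b a] by (metis L.assoc)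

lemma cou_src_left [simp]: "cou L (src L a \<odot> x) = a \<cdot>\<^bsub>B\<^esub> cou L x"
  using cou_bimodule[of a "\<one>\<^bsub>B\<^esub>" x] by simp

lemma cou_tgt_left [simp]: "cou L (tgt L b \<odot> x) = cou L x \<cdot>\<^bsub>B\<^esub> b"
  using cou_bimodule[of "\<one>\<^bsub>B\<^esub>" b x] by simp

lemma cou_of_src [simp]: "cou L (src L a) = a"
  using cou_src_left[of a "\<one>\<^bsub>L\<^esub>"] by (simp del: cou_src_left)

lemma cou_of_tgt [simp]: "cou L (tgt L a) = a"
  using cou_tgt_left[of a "\<one>\<^bsub>L\<^esub>"] by (simp del: cou_tgt_left)

lemma cou_tgt_right: "cou L (x \<odot> tgt L a) = cou L (x \<odot> src L a)"
  using cou_src[of x "tgt L a"] by simp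

text \<open>
  The forms on \<open>L \<diamond> L\<close>, on \<open>L \<diamond> L \<diamond> L\<close> and on the tensor product of \<open>L\<close> with itself over the
  opposite of \<open>B\<close>.
\<close>

abbreviation "bal \<equiv> form (\<lambda>b x. tgt L b \<odot> x) (\<lambda>b y. src L b \<odot> y)"

abbreviation "bal3 \<equiv> form3 (\<lambda>b x. tgt L b \<odot> x) (\<lambda>b y. src L b \<odot> y)
  (\<lambda>b x. tgt L b \<odot> x) (\<lambda>b y. src L b \<odot> y)"

abbreviation "obal \<equiv> form (\<lambda>b x. x \<odot> tgt L b) (\<lambda>b y. tgt L b \<odot> y)"

lemma diamond_eq_form:
  "diamond_eq L u v \<Longrightarrow> bal \<phi> \<Longrightarrow> psum u \<phi> = psum v \<phi>"
  unfolding diamond_eq_def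
  by (rule tensor2_eq_form[where e = "\<lambda>k. smul B k \<one>\<^bsub>B\<^esub>"]) (assumption | simp)+

lemma diamond_eqI:
  "(\<And>\<phi> :: 'a \<Rightarrow> 'a \<Rightarrow> 'k. bal \<phi> \<Longrightarrow> psum u \<phi> = psum v \<phi>) \<Longrightarrow> diamond_eq L u v"
  unfolding diamond_eq_def by (rule tensor2_eq_formI) (use L.vspace in auto)

lemma over_op_eq_form:
  "over_op_eq L u v \<Longrightarrow> obal \<phi> \<Longrightarrow> psum u \<phi> = psum v \<phi>"
  unfolding over_op_eq_def
  by (rule tensor2_eq_form[where e = "\<lambda>k. smul B k \<one>\<^bsub>B\<^esub>"]) (assumption | simp)+

lemma diamond3_eq_form:
  assumes "diamond3_eq L u v" "bal3 \<psi>"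
  shows "tsum u \<psi> = tsum v \<psi>"
proof (rule tensor3_eq_tsum[OF assms(1)[unfolded diamond3_eq_def]])
  show "form3_on L L L (\<lambda>b x. tgt L b \<odot> x) (\<lambda>b y. src L b \<odot> y)
     (\<lambda>b x. tgt L b \<odot> x) (\<lambda>b y. src L b \<odot> y) \<psi>"
    using form3_simps(1-5)[OF assms(2)] form3_simps(4,5)[OF assms(2), where b = "smul B k \<one>\<^bsub>B\<^esub>" for k]
    unfolding form3_on_def by simp
qed simp

lemma cop_add_form:
  "bal \<phi> \<Longrightarrow> psum (cop L (X + Y)) \<phi> = psum (cop L X) \<phi> + psum (cop L Y) \<phi>"
  using diamond_eq_form[OF cop_add[of X Y]] by simp

lemma cop_psum:
  "bal \<phi> \<Longrightarrow> psum (cop L (psum u f)) \<phi> = (\<Sum>x y:u. psum (cop L (f x y)) \<phi>)"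
  by (rule additive_psum) (rule cop_add_form)

lemma cop_bimodule_form:
  assumes "bal \<phi>"
  shows "psum (cop L (src L a \<odot> (tgt L b \<odot> X))) \<phi>
    = (\<Sum>X1 X2:cop L X. \<phi> (src L a \<odot> X1) (tgt L b \<odot> X2))"
  using diamond_eq_form[OF cop_bimodule[where a = a and b = b and X = X, folded psum_def] assms] by (simp add: psum_psum)

lemma cop_src_left:
  "bal \<phi> \<Longrightarrow> psum (cop L (src L a \<odot> X)) \<phi> = (\<Sum>X1 X2:cop L X. \<phi> (src L a \<odot> X1) X2)"
  using cop_bimodule_form[of \<phi> a "\<one>\<^bsub>B\<^esub>" X] by simp

lemma cop_tgt_left:
  "bal \<phi> \<Longrightarrow> psum (cop L (tgt L b \<odot> X)) \<phi> = (\<Sum>X1 X2:cop L X. \<phi> X1 (tgt L b \<odot> X2))"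
  using cop_bimodule_form[of \<phi> "\<one>\<^bsub>B\<^esub>" b X] by simp

lemma cop_one_form:
  "bal \<phi> \<Longrightarrow> psum (cop L \<one>\<^bsub>L\<^esub>) \<phi> = \<phi> \<one>\<^bsub>L\<^esub> \<one>\<^bsub>L\<^esub>"
  using diamond_eq_form[OF cop_one] by simp

lemma cop_takeuchi_form:
  assumes "bal \<phi>"
  shows "(\<Sum>X1 X2:cop L X. \<phi> (X1 \<odot> tgt L b) X2) = (\<Sum>X1 X2:cop L X. \<phi> X1 (X2 \<odot> src L b))"
  using diamond_eq_form[OF cop_takeuchi[where X = X and b = b, folded psum_def] assms] by (simp add: psum_psum)

lemma cop_mult_form:
  assumes "bal \<phi>"
  shows "psum (cop L (X \<odot> Y)) \<phi>
    = (\<Sum>X1 X2:cop L X. \<Sum>Y1 Y2:cop L Y. \<phi> (X1 \<odot> Y1) (X2 \<odot> Y2))"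
  using diamond_eq_form[OF cop_mult[of X Y, folded psum_def] assms] by (simp add: psum_psum)

lemma coassoc_form:
  assumes "bal3 \<psi>"
  shows "(\<Sum>X1 X2:cop L X. \<Sum>X11 X12:cop L X1. \<psi> X11 X12 X2)
       = (\<Sum>X1 X2:cop L X. \<Sum>X21 X22:cop L X2. \<psi> X1 X21 X22)"
  using diamond3_eq_form[OF coassoc[of X, folded psum_def] assms] by (simp add: tsum_psum)

lemma counit_left' [simp]: "(\<Sum>X1 X2:cop L X. src L (cou L X1) \<odot> X2) = X"
  and counit_right' [simp]: "(\<Sum>X1 X2:cop L X. tgt L (cou L X2) \<odot> X1) = X"
  using counit_left counit_right by (auto simp: psum_def)

text \<open>A form composed with the action of \<open>\<Delta> X\<close> from the left is again balanced, since \<open>\<Delta> X\<close> lies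
  in the Takeuchi product.\<close>

lemma bal_mult_cop:
  assumes "bal \<phi>"
  shows "bal (\<lambda>y z. \<Sum>X1 X2:cop L X. \<phi> (X1 \<odot> y) (X2 \<odot> z))"
proof (rule formI)
  fix b y z
  have "bal (\<lambda>p q. \<phi> (p \<odot> y) (q \<odot> z))"
    by (rule formI) (simp_all add: form_simps[OF assms])
  from cop_takeuchi_form[OF this, of X b]
  show "(\<Sum>X1 X2:cop L X. \<phi> (X1 \<odot> (tgt L b \<odot> y)) (X2 \<odot> z)) =
        (\<Sum>X1 X2:cop L X. \<phi> (X1 \<odot> y) (X2 \<odot> (src L b \<odot> z)))"
    by simp
qed (simp_all add: form_simps[OF assms] psum_plus)

lemma bal_mult_right:
  assumes "bal \<phi>"
  shows "bal (\<lambda>y z. \<phi> (y \<odot> v) (z \<odot> w))"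
  by (rule formI) (simp_all add: form_simps[OF assms])

lemma cop_mult_right_form:
  assumes "bal \<phi>"
  shows "psum (cop L (X \<odot> Y)) \<phi>
    = (\<Sum>Y1 Y2:cop L Y. \<Sum>X1 X2:cop L X. \<phi> (X1 \<odot> Y1) (X2 \<odot> Y2))"
  by (subst psum_swap) (rule cop_mult_form[OF assms])

lemma cop_of_src:
  assumes "bal \<phi>"
  shows "psum (cop L (src L a)) \<phi> = \<phi> (src L a) \<one>\<^bsub>L\<^esub>"
proof -
  have "bal (\<lambda>x y. \<phi> (src L a \<odot> x) y)"
    by (rule formI) (simp_all add: form_simps[OF assms] tgt_src_left[symmetric])
  from cop_one_form[OF this] cop_src_left[OF assms, of a "\<one>\<^bsub>L\<^esub>"] show ?thesis by simp
qed

lemma cop_of_tgt: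
  assumes "bal \<phi>"
  shows "psum (cop L (tgt L b)) \<phi> = \<phi> \<one>\<^bsub>L\<^esub> (tgt L b)"
proof -
  have "bal (\<lambda>x y. \<phi> x (tgt L b \<odot> y))"
    by (rule formI) (simp_all add: form_simps[OF assms] tgt_src_left)
  from cop_one_form[OF this] cop_tgt_left[OF assms, of b "\<one>\<^bsub>L\<^esub>"] show ?thesis by simp
qed

lemma cop_src_right:
  assumes "bal \<phi>"
  shows "psum (cop L (X \<odot> src L a)) \<phi> = (\<Sum>X1 X2:cop L X. \<phi> (X1 \<odot> src L a) X2)"
  using cop_of_src[OF bal_mult_cop[OF assms]] by (simp add: cop_mult_right_form[OF assms])

lemma cop_tgt_right:
  assumes "bal \<phi>"
  shows "psum (cop L (X \<odot> tgt L b)) \<phi> = (\<Sum>X1 X2:cop L X. \<phi> X1 (X2 \<odot> tgt L b))"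
  using cop_of_tgt[OF bal_mult_cop[OF assms]] by (simp add: cop_mult_right_form[OF assms])

lemma bal_counit: "bal (\<lambda>x y. src L (cou L x) \<odot> y)" "bal (\<lambda>x y. tgt L (cou L y) \<odot> x)"
  by (rule formI; simp)+

text \<open>
  Since \<open>\<epsilon>(X\<^sub>1 Y) = \<epsilon>(X\<^sub>1 t(\<epsilon>(Y)))\<close>, the factor \<open>t(\<epsilon>(Y))\<close> can be moved to the other tensor factor, as
  \<open>\<Delta> X\<close> lies in the Takeuchi product, and then the counit axiom applies.
\<close>

lemma counit_left_mult: "(\<Sum>X1 X2:cop L X. src L (cou L (X1 \<odot> Y)) \<odot> X2) = X \<odot> src L (cou L Y)"
proof -
  have "(\<Sum>X1 X2:cop L X. src L (cou L (X1 \<odot> Y)) \<odot> X2)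
      = (\<Sum>X1 X2:cop L X. src L (cou L (X1 \<odot> tgt L (cou L Y))) \<odot> X2)"
    by (simp add: cou_tgt)
  also have "\<dots> = (\<Sum>X1 X2:cop L X. src L (cou L X1) \<odot> X2) \<odot> src L (cou L Y)"
    by (subst cop_takeuchi_form[OF bal_counit(1)]) (simp del: counit_left')
  finally show ?thesis by simp
qed

lemma counit_right_mult: "(\<Sum>X1 X2:cop L X. tgt L (cou L (X2 \<odot> Y)) \<odot> X1) = X \<odot> tgt L (cou L Y)"
proof -
  have "(\<Sum>X1 X2:cop L X. tgt L (cou L (X2 \<odot> Y)) \<odot> X1)
      = (\<Sum>X1 X2:cop L X. tgt L (cou L (X2 \<odot> src L (cou L Y))) \<odot> X1)"
    by (simp add: cou_src)
  also have "\<dots> = (\<Sum>X1 X2:cop L X. tgt L (cou L X2) \<odot> X1) \<odot> tgt L (cou L Y)"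
    by (subst cop_takeuchi_form[OF bal_counit(2), symmetric]) (simp del: counit_right')
  finally show ?thesis by simp
qed

end

section \<open>Twisting a bialgebroid by a cocycle\<close>

lemma rel2_cong:
  assumes "car P = car P'" "smul P = smul P'" "car Q = car Q'" "smul Q = smul Q'"
  shows "rel2 P Q r l = rel2 P' Q' r l"
  by (intro ext) (simp add: rel2.simps assms)

lemma tensor2_eq_cong:
  assumes "car P = car P'" "smul P = smul P'" "car Q = car Q'" "smul Q = smul Q'"
  shows "tensor2_eq P Q r l = tensor2_eq P' Q' r l"
  using rel2_cong[OF assms, of r l] by (simp add: tensor2_eq_def)

text \<open>
  The letters \<open>F\<close> in the names below refer to the twist: \<open>sF\<close>, \<open>tF\<close>, \<open>BF\<close>, \<open>LF\<close> are the twisted source,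
  target, base and bialgebroid, and \<open>Fbal\<close> is balance over the twisted base.
\<close>

locale cocycle_twist = left_bialgebroid B L
  for B :: "('k::field, 'b::ab_group_add) algebra"
    and L :: "('k, 'b, 'a::ab_group_add) bialgebroid" +
  fixes F :: "('a \<times> 'a) multiset"
  assumes cocycle: "left_2_cocycle_in L F"
    and invertible: "cocycle_in_invertible TYPE('a) L F"
begin

abbreviation "sF \<equiv> twist_src L F"
abbreviation "tF \<equiv> twist_tgt L F"
abbreviation "LF \<equiv> twist L F"
abbreviation "BF \<equiv> twist_base B L F"

abbreviation "Fbal \<equiv> form (\<lambda>b x. tF b \<odot> x) (\<lambda>b y. sF b \<odot> y)"

abbreviation "Fbal3 \<equiv> form3 (\<lambda>b x. tF b \<odot> x) (\<lambda>b y. sF b \<odot> y) (\<lambda>b x. tF b \<odot> x) (\<lambda>b y. sF b \<odot> y)"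

abbreviation "with_F \<phi> \<equiv> (\<lambda>x y. \<Sum>p q:F. \<phi> (p \<odot> x) (q \<odot> y))"
abbreviation "times_F \<phi> \<equiv> (\<lambda>x y. \<Sum>p q:F. \<phi> (x \<odot> p) (y \<odot> q))"

lemma F_normal_left: "(\<Sum>p q:F. src L (cou L p) \<odot> q) = \<one>\<^bsub>L\<^esub>"
  and F_normal_right: "(\<Sum>p q:F. tgt L (cou L q) \<odot> p) = \<one>\<^bsub>L\<^esub>"
  using cocycle by (simp_all add: left_2_cocycle_in_def psum_def)

lemma F_cocycle:
  assumes "bal3 \<psi>"
  shows "(\<Sum>p q:F. \<Sum>p1 p2:cop L p. \<Sum>p' q':F. \<psi> (p1 \<odot> p') (p2 \<odot> q') q)
       = (\<Sum>p q:F. \<Sum>q1 q2:cop L q. \<Sum>p' q':F. \<psi> p (q1 \<odot> p') (q2 \<odot> q'))"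
  using diamond3_eq_form[OF conjunct2[OF conjunct2[OF
        cocycle[unfolded left_2_cocycle_in_def psum_def[symmetric]]]] assms]
  by (simp add: tsum_psum)

lemma sF_eq: "sF b = (\<Sum>p q:F. src L (cou L (p \<odot> src L b)) \<odot> q)"
  and tF_eq: "tF b = (\<Sum>p q:F. tgt L (cou L (q \<odot> src L b)) \<odot> p)"
  by (simp_all add: twist_src_def twist_tgt_def psum_def)

lemma BF_mult: "a \<cdot>\<^bsub>BF\<^esub> b = (\<Sum>p q:F. cou L (p \<odot> src L a) \<cdot>\<^bsub>B\<^esub> cou L (q \<odot> src L b))"
  by (simp add: twist_base_def psum_def)

lemma mult_sF: "x \<odot> sF b
    = (\<Sum>x1 x2:cop L x. \<Sum>p q:F. src L (cou L (x1 \<odot> (p \<odot> src L b))) \<odot> (x2 \<odot> q))"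
proof -
  have "x \<odot> sF b = (\<Sum>p q:F. (\<Sum>x1 x2:cop L x. src L (cou L (x1 \<odot> (p \<odot> src L b))) \<odot> x2) \<odot> q)"
    unfolding counit_left_mult sF_eq by simp
  then show ?thesis by (simp add: psum_swap[of F])
qed

lemma mult_tF: "x \<odot> tF b
    = (\<Sum>x1 x2:cop L x. \<Sum>p q:F. tgt L (cou L (x2 \<odot> (q \<odot> src L b))) \<odot> (x1 \<odot> p))"
proof -
  have "x \<odot> tF b = (\<Sum>p q:F. (\<Sum>x1 x2:cop L x. tgt L (cou L (x2 \<odot> (q \<odot> src L b))) \<odot> x1) \<odot> p)"
    unfolding counit_right_mult tF_eq by simp
  then show ?thesis by (simp add: psum_swap[of F])
qed

text \<open>
  This says \<open>F\<^sup>i t\<^sup>F(b) \<diamond> F\<^sub>i = F\<^sup>i \<diamond> F\<^sub>i s\<^sup>F(b)\<close>; it is the cocycle identity with \<open>\<epsilon>(\<hyphen> b)\<close> applied to the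
  middle factor. The next two lemmas use the first and the third factor instead.
\<close>

lemma F_balance:
  assumes "bal \<phi>"
  shows "(\<Sum>p q:F. \<phi> (p \<odot> tF b) q) = (\<Sum>p q:F. \<phi> p (q \<odot> sF b))"
proof -
  note \<phi> = form_simps[OF assms]
  have "bal3 (\<lambda>x y z. \<phi> (tgt L (cou L (y \<odot> src L b)) \<odot> x) z)"
    by (rule form3I) (simp_all add: \<phi>)
  from F_cocycle[OF this] show ?thesis
    unfolding mult_sF mult_tF by (simp add: \<phi>)
qed

text \<open>
  \<open>\<Delta>(s\<^sup>F(b)) F = F (s\<^sup>F(b) \<otimes> 1)\<close>.
\<close>

lemma cop_sF:
  assumes "bal \<phi>"
  shows "psum (cop L (sF b)) (times_F \<phi>)
    = (\<Sum>p q:F. \<phi> (p \<odot> sF b) q)"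
proof -
  note \<phi> = form_simps[OF assms]
  have 1: "bal (times_F \<phi>)"
    by (rule formI) (simp_all add: \<phi> psum_plus)
  have "bal3 (\<lambda>x y z. \<phi> (src L (cou L (x \<odot> src L b)) \<odot> y) z)"
    by (rule form3I) (simp_all add: \<phi> tgt_src_left[symmetric])
  from F_cocycle[OF this] show ?thesis
    unfolding mult_sF by (simp add: sF_eq cop_psum[OF 1] cop_src_left[OF 1] \<phi>)
qed

text \<open>
  \<open>\<Delta>(t\<^sup>F(b)) F = F (1 \<otimes> t\<^sup>F(b))\<close>.
\<close>

lemma cop_tF:
  assumes "bal \<phi>"
  shows "psum (cop L (tF b)) (times_F \<phi>)
    = (\<Sum>p q:F. \<phi> p (q \<odot> tF b))"
proof -
  note \<phi> = form_simps[OF assms]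
  have 1: "bal (times_F \<phi>)"
    by (rule formI) (simp_all add: \<phi> psum_plus)
  have "bal3 (\<lambda>x y z. \<phi> x (tgt L (cou L (z \<odot> src L b)) \<odot> y))"
    by (rule form3I) (simp_all add: \<phi> tgt_src_left)
  from F_cocycle[OF this] show ?thesis
    unfolding mult_tF by (simp add: tF_eq cop_psum[OF 1] cop_tgt_left[OF 1] \<phi>)
qed

lemma sF_add [simp]: "sF (a + b) = sF a + sF b" and tF_add [simp]: "tF (a + b) = tF a + tF b"
  by (simp_all add: sF_eq tF_eq psum_plus)

lemma sF_smul [simp]: "sF (smul B k a) = smul L k (sF a)"
  and tF_smul [simp]: "tF (smul B k a) = smul L k (tF a)"
  by (simp_all add: sF_eq tF_eq L.smul_psum)

lemma sF_one [simp]: "sF \<one>\<^bsub>B\<^esub> = \<one>\<^bsub>L\<^esub>" and tF_one [simp]: "tF \<one>\<^bsub>B\<^esub> = \<one>\<^bsub>L\<^esub>"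
  by (simp_all add: sF_eq tF_eq F_normal_left F_normal_right)

lemma cou_sF_mult: "cou L (sF a \<odot> x) = a \<cdot>\<^bsub>BF\<^esub> cou L x"
proof -
  have "cou L (sF a \<odot> src L (cou L x)) = a \<cdot>\<^bsub>BF\<^esub> cou L x"
    by (simp add: sF_eq BF_mult)
  then show ?thesis by (simp add: cou_src)
qed

lemma cou_tF_mult: "cou L (tF b \<odot> x) = cou L x \<cdot>\<^bsub>BF\<^esub> b"
proof -
  have "cou L (tF b \<odot> src L (cou L x)) = cou L x \<cdot>\<^bsub>BF\<^esub> b"
    by (simp add: tF_eq BF_mult)
  then show ?thesis by (simp add: cou_src)
qed

lemma cou_sF [simp]: "cou L (sF b) = b"
proof -
  have "cou L ((\<Sum>p q:F. tgt L (cou L q) \<odot> p) \<odot> src L b) = b"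
    unfolding F_normal_right by simp
  then show ?thesis by (simp add: sF_eq)
qed

lemma cou_tF [simp]: "cou L (tF b) = b"
proof -
  have "cou L ((\<Sum>p q:F. src L (cou L p) \<odot> q) \<odot> src L b) = b"
    unfolding F_normal_left by simp
  then show ?thesis by (simp add: tF_eq)
qed

text \<open>
  Multiplicativity of \<open>s\<^sup>F\<close> and \<open>t\<^sup>F\<close>, and that they commute, come from applying \<open>\<epsilon>(\<hyphen> c)\<close> to one factor
  of \<open>cop_sF\<close> or \<open>cop_tF\<close>.
\<close>

lemma sF_mult: "sF (a \<cdot>\<^bsub>BF\<^esub> c) = sF a \<odot> sF c"
proof -
  have "bal (\<lambda>x y. src L (cou L (x \<odot> src L c)) \<odot> y)"
    by (rule formI) simp_all
  from cop_sF[OF this, of a]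
  have "(\<Sum>p q:F. (\<Sum>x1 x2:cop L (sF a). src L (cou L (x1 \<odot> (p \<odot> src L c))) \<odot> x2) \<odot> q)
      = (\<Sum>p q:F. src L (cou L (p \<odot> (sF a \<odot> src L c))) \<odot> q)"
    by (simp add: psum_swap[of F "cop L (sF a)"])
  moreover have "cou L (p \<odot> (sF a \<odot> src L c)) = cou L (p \<odot> src L (a \<cdot>\<^bsub>BF\<^esub> c))" for p
    using cou_src[of p "sF a \<odot> src L c"] by (simp add: cou_sF_mult)
  ultimately have "(\<Sum>p q:F. sF a \<odot> src L (cou L (p \<odot> src L c)) \<odot> q)
      = (\<Sum>p q:F. src L (cou L (p \<odot> src L (a \<cdot>\<^bsub>BF\<^esub> c))) \<odot> q)"
    unfolding counit_left_mult by simp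
  then show ?thesis unfolding sF_eq[of c] sF_eq[of "a \<cdot>\<^bsub>BF\<^esub> c"] by simp
qed

lemma tF_mult: "tF (a \<cdot>\<^bsub>BF\<^esub> c) = tF c \<odot> tF a"
proof -
  have "bal (\<lambda>x y. tgt L (cou L (y \<odot> src L a)) \<odot> x)"
    by (rule formI) simp_all
  from cop_tF[OF this, of c]
  have "(\<Sum>p q:F. (\<Sum>x1 x2:cop L (tF c). tgt L (cou L (x2 \<odot> (q \<odot> src L a))) \<odot> x1) \<odot> p)
      = (\<Sum>p q:F. tgt L (cou L (q \<odot> (tF c \<odot> src L a))) \<odot> p)"
    by (simp add: psum_swap[of F "cop L (tF c)"])
  moreover have "cou L (q \<odot> (tF c \<odot> src L a)) = cou L (q \<odot> src L (a \<cdot>\<^bsub>BF\<^esub> c))" for q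
    using cou_src[of q "tF c \<odot> src L a"] by (simp add: cou_tF_mult)
  ultimately have "(\<Sum>p q:F. tF c \<odot> tgt L (cou L (q \<odot> src L a)) \<odot> p)
      = (\<Sum>p q:F. tgt L (cou L (q \<odot> src L (a \<cdot>\<^bsub>BF\<^esub> c))) \<odot> p)"
    unfolding counit_right_mult by simp
  then show ?thesis unfolding tF_eq[of a] tF_eq[of "a \<cdot>\<^bsub>BF\<^esub> c"] by simp
qed

lemma tF_sF: "tF b \<odot> sF a = sF a \<odot> tF b"
proof -
  have "bal (\<lambda>x y. src L (cou L (x \<odot> src L a)) \<odot> y)"
    by (rule formI) simp_all
  from cop_tF[OF this, of b]
  have "(\<Sum>p q:F. (\<Sum>x1 x2:cop L (tF b). src L (cou L (x1 \<odot> (p \<odot> src L a))) \<odot> x2) \<odot> q)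
      = (\<Sum>p q:F. src L (cou L (p \<odot> src L a)) \<odot> (q \<odot> tF b))"
    by (simp add: psum_swap[of F "cop L (tF b)"])
  then show ?thesis unfolding counit_left_mult by (simp add: sF_eq)
qed

lemma BF_simps [simp]: "smul BF = smul B" "car BF = UNIV" "\<one>\<^bsub>BF\<^esub> = \<one>\<^bsub>B\<^esub>"
  by (simp_all add: twist_base_def)

lemma LF_simps [simp]: "smul LF = smul L" "car LF = UNIV" "\<one>\<^bsub>LF\<^esub> = \<one>\<^bsub>L\<^esub>" "mult LF = mult L"
  "src LF = sF" "tgt LF = tF" "cou LF = cou L"
  by (simp_all add: twist_def)

text \<open>
  As \<open>a \<cdot>\<^sub>F \<epsilon>(x) = \<epsilon>(s\<^sup>F(a) x)\<close> and \<open>\<epsilon>(x) \<cdot>\<^sub>F b = \<epsilon>(t\<^sup>F(b) x)\<close>, the twisted product is associative because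
  \<open>s\<^sup>F\<close> and \<open>t\<^sup>F\<close> commute.
\<close>

lemma BF_algebra: "unital_algebra BF"
proof (rule unital_algebra.intro)
  show "vector_space (smul BF)" "car BF = UNIV" using B.vspace by simp_all
  show "Vector_Spaces.linear (smul BF) (smul BF) (\<lambda>x. x \<cdot>\<^bsub>BF\<^esub> y)"
       "Vector_Spaces.linear (smul BF) (smul BF) (\<lambda>x. y \<cdot>\<^bsub>BF\<^esub> x)" for y
    using B.vspace by (simp_all add: Vector_Spaces.linear_iff BF_mult psum_plus B.smul_psum)
  show "\<one>\<^bsub>BF\<^esub> \<cdot>\<^bsub>BF\<^esub> x = x" "x \<cdot>\<^bsub>BF\<^esub> \<one>\<^bsub>BF\<^esub> = x" for x
    unfolding BF_simps using cou_sF_mult[of "\<one>\<^bsub>B\<^esub>" "src L x"] cou_tF_mult[of "\<one>\<^bsub>B\<^esub>" "src L x"] by simp_all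
  show "(x \<cdot>\<^bsub>BF\<^esub> y) \<cdot>\<^bsub>BF\<^esub> z = x \<cdot>\<^bsub>BF\<^esub> (y \<cdot>\<^bsub>BF\<^esub> z)" for x y z
  proof -
    have "(x \<cdot>\<^bsub>BF\<^esub> y) \<cdot>\<^bsub>BF\<^esub> z = cou L ((tF z \<odot> sF x) \<odot> src L y)"
      by (simp add: cou_sF_mult cou_tF_mult)
    also have "\<dots> = x \<cdot>\<^bsub>BF\<^esub> (y \<cdot>\<^bsub>BF\<^esub> z)"
      unfolding tF_sF by (simp add: cou_sF_mult cou_tF_mult)
    finally show ?thesis .
  qed
qed

subsection \<open>The inverse of the cocycle\<close>

abbreviation "regular \<equiv> mod_of L (mult L)"

lemma regular: "left_module L regular"
  using L.vspace unfolding left_module_def mod_of_def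
  by (auto simp: is_vspace_def module.subspace_UNIV module_iff_vector_space)

lemma F_sharp_regular: "F_sharp F regular regular u = (\<Sum>x y:u. \<Sum>p q:F. {#(p \<odot> x, q \<odot> y)#})"
  by (simp add: F_sharp_def psum_def mod_of_def)

lemma twist_invertible: "invertible_mod UNIV (diamond_eq LF) UNIV (diamond_eq L) (F_sharp F regular regular)"
proof -
  have "diamond_eq LF = tensor2_eq regular regular
      (\<lambda>b. act regular (twist_tgt L F b)) (\<lambda>b. act regular (twist_src L F b))"
    unfolding diamond_eq_def LF_simps by (subst tensor2_eq_cong) (auto simp: mod_of_def)
  moreover have "diamond_eq L = tensor2_eq regular regular
      (\<lambda>b. act regular (tgt L b)) (\<lambda>b. act regular (src L b))"
    unfolding diamond_eq_def by (subst tensor2_eq_cong) (auto simp: mod_of_def)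
  moreover have "formal_sums regular regular = UNIV"
    by (auto simp: formal_sums_def mod_of_def)
  ultimately show ?thesis
    using invertible regular unfolding cocycle_in_invertible_def by metis
qed

lemma psum_F_sharp: "psum (F_sharp F regular regular u) \<phi> = psum u (with_F \<phi>)"
  by (simp add: F_sharp_regular psum_psum)

text \<open>
  Acting with \<open>F\<close> is injective, so equality over the twisted base may be tested after it, with forms
  over the old base.
\<close>

lemma twist_eqI:
  assumes "\<And>\<phi> :: 'a \<Rightarrow> 'a \<Rightarrow> 'k. bal \<phi> \<Longrightarrow> psum u (with_F \<phi>)
      = psum v (with_F \<phi>)"
  shows "diamond_eq LF u v"
proof -
  have "diamond_eq L (F_sharp F regular regular u) (F_sharp F regular regular v)"
    by (rule diamond_eqI) (simp add: psum_F_sharp assms)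
  then show ?thesis using twist_invertible by (auto simp: invertible_mod_def)
qed

lemma twist_eq_form:
  "diamond_eq LF u v \<Longrightarrow> Fbal \<phi> \<Longrightarrow> psum u \<phi> = psum v \<phi>"
  unfolding diamond_eq_def LF_simps
  by (rule tensor2_eq_form[where e = "\<lambda>k. smul B k \<one>\<^bsub>B\<^esub>"]) (assumption | simp)+

text \<open>
  The preimage of \<open>1 \<diamond> 1\<close> on the regular module. It is the inverse of \<open>F\<close>: acting with \<open>G\<close> undoes acting
  with \<open>F\<close> on all modules, by \<open>FG_act\<close> and \<open>GF_act\<close>.
\<close>

definition G :: "('a \<times> 'a) multiset" where
  "G = (SOME u. diamond_eq L (F_sharp F regular regular u) {#(\<one>\<^bsub>L\<^esub>, \<one>\<^bsub>L\<^esub>)#})"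

lemma FG:
  assumes "bal \<phi>"
  shows "(\<Sum>g h:G. \<Sum>p q:F. \<phi> (p \<odot> g) (q \<odot> h)) = \<phi> \<one>\<^bsub>L\<^esub> \<one>\<^bsub>L\<^esub>"
proof -
  have "diamond_eq L (F_sharp F regular regular G) {#(\<one>\<^bsub>L\<^esub>, \<one>\<^bsub>L\<^esub>)#}"
    unfolding G_def by (rule someI_ex) (use twist_invertible in \<open>unfold invertible_mod_def, blast\<close>)
  from diamond_eq_form[OF this assms] show ?thesis by (simp add: psum_F_sharp)
qed

lemma FG_act:
  assumes "bal \<phi>"
  shows "(\<Sum>g h:G. \<Sum>p q:F. \<phi> (p \<odot> (g \<odot> x)) (q \<odot> (h \<odot> y))) = \<phi> x y"
  using FG[OF bal_mult_right[OF assms, of x y]] by simp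

lemma GF_act:
  assumes "Fbal \<phi>"
  shows "(\<Sum>p q:F. \<Sum>g h:G. \<phi> (g \<odot> (p \<odot> x)) (h \<odot> (q \<odot> y))) = \<phi> x y"
proof -
  have "diamond_eq LF (\<Sum>p q:F. \<Sum>g h:G. {#(g \<odot> (p \<odot> x), h \<odot> (q \<odot> y))#}) {#(x, y)#}"
  proof (rule twist_eqI)
    fix \<phi> :: "'a \<Rightarrow> 'a \<Rightarrow> 'k" assume \<phi>: "bal \<phi>"
    show "psum (\<Sum>p q:F. \<Sum>g h:G. {#(g \<odot> (p \<odot> x), h \<odot> (q \<odot> y))#})
          (with_F \<phi>)
        = psum {#(x, y)#} (with_F \<phi>)"
      unfolding psum_psum psum_single FG_act[OF \<phi>] ..
  qed
  from twist_eq_form[OF this assms] show ?thesis by (simp add: psum_psum)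
qed

lemma G_balance:
  assumes "Fbal \<phi>"
  shows "(\<Sum>g h:G. \<phi> (g \<odot> (tgt L b \<odot> x)) (h \<odot> y)) = (\<Sum>g h:G. \<phi> (g \<odot> x) (h \<odot> (src L b \<odot> y)))"
proof -
  have "diamond_eq LF (\<Sum>g h:G. {#(g \<odot> (tgt L b \<odot> x), h \<odot> y)#})
                      (\<Sum>g h:G. {#(g \<odot> x, h \<odot> (src L b \<odot> y))#})"
  proof (rule twist_eqI)
    fix \<phi> :: "'a \<Rightarrow> 'a \<Rightarrow> 'k" assume \<phi>: "bal \<phi>"
    show "psum (\<Sum>g h:G. {#(g \<odot> (tgt L b \<odot> x), h \<odot> y)#}) (with_F \<phi>)
        = psum (\<Sum>g h:G. {#(g \<odot> x, h \<odot> (src L b \<odot> y))#}) (with_F \<phi>)"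
      unfolding psum_psum psum_single FG_act[OF \<phi>] by (rule form_simps[OF \<phi>])
  qed
  from twist_eq_form[OF this assms] show ?thesis by (simp add: psum_psum)
qed

lemma bal_G:
  assumes "Fbal \<phi>"
  shows "bal (\<lambda>x y. \<Sum>g h:G. \<phi> (g \<odot> x) (h \<odot> y))"
  by (rule formI) (simp_all add: form_simps[OF assms] psum_plus G_balance[OF assms])

lemma cop_LF:
  assumes "bal \<phi>"
  shows "psum (cop LF x) (with_F \<phi>)
       = psum (cop L x) (times_F \<phi>)"
proof -
  let ?w = "(\<Sum>x1 x2:cop L x. \<Sum>p q:F. {#(x1 \<odot> p, x2 \<odot> q)#})"
  have "cop LF x = (SOME u. diamond_eq L (F_sharp F regular regular u) ?w)"
    by (simp add: twist_def psum_def)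
  moreover have "\<exists>u. diamond_eq L (F_sharp F regular regular u) ?w"
    using twist_invertible unfolding invertible_mod_def by blast
  ultimately have "diamond_eq L (F_sharp F regular regular (cop LF x)) ?w"
    using someI_ex[of "\<lambda>u. diamond_eq L (F_sharp F regular regular u) ?w"] by presburger
  from diamond_eq_form[OF this assms] show ?thesis by (simp add: psum_F_sharp psum_psum)
qed

subsection \<open>The twisted bialgebroid\<close>

lemma bal_mult_F:
  assumes "bal \<phi>"
  shows "bal (times_F \<phi>)"
  by (rule formI) (simp_all add: form_simps[OF assms] psum_plus)

lemma cop_sF_act:
  assumes "bal \<phi>"
  shows "(\<Sum>x1 x2:cop L (sF b). \<Sum>p q:F. \<phi> (x1 \<odot> (p \<odot> u)) (x2 \<odot> (q \<odot> v)))
    = (\<Sum>p q:F. \<phi> (p \<odot> (sF b \<odot> u)) (q \<odot> v))"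
  using cop_sF[OF bal_mult_right[OF assms, of u v], of b] by simp

lemma cop_tF_act:
  assumes "bal \<phi>"
  shows "(\<Sum>x1 x2:cop L (tF b). \<Sum>p q:F. \<phi> (x1 \<odot> (p \<odot> u)) (x2 \<odot> (q \<odot> v)))
    = (\<Sum>p q:F. \<phi> (p \<odot> u) (q \<odot> (tF b \<odot> v)))"
  using cop_tF[OF bal_mult_right[OF assms, of u v], of b] by simp

lemma cop_LF_act:
  assumes "bal \<phi>"
  shows "(\<Sum>x1 x2:cop LF x. \<Sum>p q:F. \<phi> (p \<odot> (x1 \<odot> u)) (q \<odot> (x2 \<odot> v)))
       = (\<Sum>x1 x2:cop L x. \<Sum>p q:F. \<phi> (x1 \<odot> (p \<odot> u)) (x2 \<odot> (q \<odot> v)))"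
  using cop_LF[OF bal_mult_right[OF assms, of u v], of x] by simp

lemma cop_sF_tF:
  assumes "bal \<phi>"
  shows "psum (cop L (sF a \<odot> tF b)) (times_F \<phi>)
    = (\<Sum>p q:F. \<phi> (p \<odot> sF a) (q \<odot> tF b))"
proof -
  have "psum (cop L (sF a \<odot> tF b)) (times_F \<phi>)
     = (\<Sum>z1 z2:cop L (tF b). \<Sum>p q:F. \<Sum>y1 y2:cop L (sF a). \<phi> (y1 \<odot> (z1 \<odot> p)) (y2 \<odot> (z2 \<odot> q)))"
    by (simp add: cop_mult_right_form[OF bal_mult_F[OF assms]] psum_swap[of "cop L (sF a)" F])
  also have "\<dots> = (\<Sum>p q:F. \<phi> (p \<odot> sF a) (q \<odot> tF b))"
    unfolding cop_tF[OF bal_mult_cop[OF assms]] unfolding psum_swap[of F "cop L (sF a)"]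
    using cop_sF_act[OF assms, of a "\<one>\<^bsub>L\<^esub>" "tF b"] by simp
  finally show ?thesis .
qed

lemma LF_algebra: "unital_algebra LF"
  by (rule unital_algebra.intro) (use L.vspace L.linear_left L.linear_right in simp_all)

text \<open>
  By \<open>cop_LF\<close> and \<open>twist_eqI\<close>, an identity for the twisted coproduct of \<open>x\<close> becomes one for
  \<open>x\<^sub>1 F\<^sup>i \<diamond> x\<^sub>2 F\<^sub>i\<close>. So the axioms for the coproduct are rules for moving \<open>F\<close> past other factors.
\<close>

lemma LF_cop_add: "diamond_eq LF (cop LF (x + y)) (cop LF x + cop LF y)"
proof (rule twist_eqI)
  fix \<phi> :: "'a \<Rightarrow> 'a \<Rightarrow> 'k" assume \<phi>: "bal \<phi>"
  show "psum (cop LF (x + y)) (with_F \<phi>)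
    = psum (cop LF x + cop LF y) (with_F \<phi>)"
    by (simp add: cop_LF[OF \<phi>] cop_add_form[OF bal_mult_F[OF \<phi>]])
qed

lemma LF_cop_smul: "diamond_eq LF (cop LF (smul L k x)) (\<Sum>x1 x2:cop LF x. {#(smul L k x1, x2)#})"
proof (rule twist_eqI)
  fix \<phi> :: "'a \<Rightarrow> 'a \<Rightarrow> 'k" assume \<phi>: "bal \<phi>"
  have 1: "bal (\<lambda>x y. \<phi> (smul L k x) y)"
    by (rule formI) (simp_all add: form_simps[OF \<phi>] flip: L.mult_smul_right)
  show "psum (cop LF (smul L k x)) (with_F \<phi>)
    = psum (\<Sum>x1 x2:cop LF x. {#(smul L k x1, x2)#}) (with_F \<phi>)"
    using diamond_eq_form[OF cop_smul[where k = k and X = x, folded psum_def] bal_mult_F[OF \<phi>]]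
    by (simp add: cop_LF[OF \<phi>] cop_LF[OF 1] psum_psum)
qed

lemma LF_cop_bimodule:
  "diamond_eq LF (cop LF (sF a \<odot> tF b \<odot> x)) (\<Sum>x1 x2:cop LF x. {#(sF a \<odot> x1, tF b \<odot> x2)#})"
proof (rule twist_eqI)
  fix \<phi> :: "'a \<Rightarrow> 'a \<Rightarrow> 'k" assume \<phi>: "bal \<phi>"
  have "psum (cop LF (sF a \<odot> tF b \<odot> x)) (with_F \<phi>)
     = (\<Sum>x1 x2:cop L x. \<Sum>p q:F. \<Sum>y1 y2:cop L (sF a \<odot> tF b). \<phi> (y1 \<odot> (x1 \<odot> p)) (y2 \<odot> (x2 \<odot> q)))"
    unfolding cop_LF[OF \<phi>] using cop_mult_right_form[OF bal_mult_F[OF \<phi>], of "sF a \<odot> tF b" x]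
    by (simp add: psum_swap[of F])
  also have "\<dots> = (\<Sum>x1 x2:cop LF x. \<Sum>p q:F. \<Sum>y1 y2:cop L (sF a \<odot> tF b). \<phi> (y1 \<odot> (p \<odot> x1)) (y2 \<odot> (q \<odot> x2)))"
    by (simp only: cop_LF[OF bal_mult_cop[OF \<phi>]])
  also have "\<dots> = (\<Sum>x1 x2:cop LF x. \<Sum>p q:F. \<phi> (p \<odot> (sF a \<odot> x1)) (q \<odot> (tF b \<odot> x2)))"
    using cop_sF_tF[OF bal_mult_right[OF \<phi>]] by (simp add: psum_swap[of F])
  finally show "psum (cop LF (sF a \<odot> tF b \<odot> x)) (with_F \<phi>)
    = psum (\<Sum>x1 x2:cop LF x. {#(sF a \<odot> x1, tF b \<odot> x2)#}) (with_F \<phi>)"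
    by (simp add: psum_psum)
qed

lemma LF_cop_takeuchi: "diamond_eq LF (\<Sum>x1 x2:cop LF x. {#(x1 \<odot> tF b, x2)#})
   (\<Sum>x1 x2:cop LF x. {#(x1, x2 \<odot> sF b)#})"
proof (rule twist_eqI)
  fix \<phi> :: "'a \<Rightarrow> 'a \<Rightarrow> 'k" assume \<phi>: "bal \<phi>"
  have "(\<Sum>x1 x2:cop L x. \<Sum>p q:F. \<phi> (x1 \<odot> (p \<odot> tF b)) (x2 \<odot> q))
      = (\<Sum>x1 x2:cop L x. \<Sum>p q:F. \<phi> (x1 \<odot> p) (x2 \<odot> (q \<odot> sF b)))"
    unfolding psum_swap[of "cop L x" F] by (rule F_balance[OF bal_mult_cop[OF \<phi>]])
  then show "psum (\<Sum>x1 x2:cop LF x. {#(x1 \<odot> tF b, x2)#}) (with_F \<phi>)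
    = psum (\<Sum>x1 x2:cop LF x. {#(x1, x2 \<odot> sF b)#}) (with_F \<phi>)"
    using cop_LF_act[OF \<phi>, of x "tF b" "\<one>\<^bsub>L\<^esub>"] cop_LF_act[OF \<phi>, of x "\<one>\<^bsub>L\<^esub>" "sF b"]
    by (simp add: psum_psum)
qed

lemma LF_cop_one: "diamond_eq LF (cop LF \<one>\<^bsub>L\<^esub>) {#(\<one>\<^bsub>L\<^esub>, \<one>\<^bsub>L\<^esub>)#}"
proof (rule twist_eqI)
  fix \<phi> :: "'a \<Rightarrow> 'a \<Rightarrow> 'k" assume \<phi>: "bal \<phi>"
  show "psum (cop LF \<one>\<^bsub>L\<^esub>) (with_F \<phi>)
    = psum {#(\<one>\<^bsub>L\<^esub>, \<one>\<^bsub>L\<^esub>)#} (with_F \<phi>)"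
    by (simp add: cop_LF[OF \<phi>] cop_one_form[OF bal_mult_F[OF \<phi>]])
qed

lemma LF_cop_mult: "diamond_eq LF (cop LF (x \<odot> y))
   (\<Sum>x1 x2:cop LF x. \<Sum>y1 y2:cop LF y. {#(x1 \<odot> y1, x2 \<odot> y2)#})"
proof (rule twist_eqI)
  fix \<phi> :: "'a \<Rightarrow> 'a \<Rightarrow> 'k" assume \<phi>: "bal \<phi>"
  have "psum (cop LF (x \<odot> y)) (with_F \<phi>)
    = (\<Sum>y1 y2:cop L y. \<Sum>x1 x2:cop L x. \<Sum>p q:F. \<phi> (x1 \<odot> (y1 \<odot> p)) (x2 \<odot> (y2 \<odot> q)))"
    by (simp add: cop_LF[OF \<phi>] cop_mult_right_form[OF bal_mult_F[OF \<phi>]])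
  also have "\<dots> = (\<Sum>y1 y2:cop L y. \<Sum>p q:F. \<Sum>x1 x2:cop L x. \<phi> (x1 \<odot> (y1 \<odot> p)) (x2 \<odot> (y2 \<odot> q)))"
    by (simp only: psum_swap[of F])
  also have "\<dots> = (\<Sum>y1 y2:cop LF y. \<Sum>p q:F. \<Sum>x1 x2:cop L x. \<phi> (x1 \<odot> (p \<odot> y1)) (x2 \<odot> (q \<odot> y2)))"
    by (simp only: cop_LF[OF bal_mult_cop[OF \<phi>]])
  also have "\<dots> = (\<Sum>y1 y2:cop LF y. \<Sum>x1 x2:cop LF x. \<Sum>p q:F. \<phi> (p \<odot> (x1 \<odot> y1)) (q \<odot> (x2 \<odot> y2)))"
    by (simp only: psum_swap[of F] cop_LF_act[OF \<phi>])
  also have "\<dots> = (\<Sum>x1 x2:cop LF x. \<Sum>y1 y2:cop LF y. \<Sum>p q:F. \<phi> (p \<odot> (x1 \<odot> y1)) (q \<odot> (x2 \<odot> y2)))"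
    by (rule psum_swap)
  finally show "psum (cop LF (x \<odot> y)) (with_F \<phi>)
    = psum (\<Sum>x1 x2:cop LF x. \<Sum>y1 y2:cop LF y. {#(x1 \<odot> y1, x2 \<odot> y2)#})
        (with_F \<phi>)"
    by (simp add: psum_psum)
qed

lemma LF_counit_left: "(\<Sum>x1 x2:cop LF x. sF (cou L x1) \<odot> x2) = x"
proof -
  have "(\<Sum>x1 x2:cop LF x. sF (cou L x1) \<odot> x2)
      = (\<Sum>x1 x2:cop LF x. \<Sum>p q:F. src L (cou L (p \<odot> x1)) \<odot> (q \<odot> x2))"
    by (simp add: sF_eq cou_src)
  also have "\<dots> = (\<Sum>p q:F. (\<Sum>x1 x2:cop L x. src L (cou L (x1 \<odot> p)) \<odot> x2) \<odot> q)"
    unfolding cop_LF[OF bal_counit(1)] by (simp add: psum_swap[of _ F])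
  also have "\<dots> = x \<odot> (\<Sum>p q:F. src L (cou L p) \<odot> q)"
    unfolding counit_left_mult by simp
  finally show ?thesis by (simp add: F_normal_left del: L.mult_psum)
qed

lemma LF_counit_right: "(\<Sum>x1 x2:cop LF x. tF (cou L x2) \<odot> x1) = x"
proof -
  have "(\<Sum>x1 x2:cop LF x. tF (cou L x2) \<odot> x1)
      = (\<Sum>x1 x2:cop LF x. \<Sum>p q:F. tgt L (cou L (q \<odot> x2)) \<odot> (p \<odot> x1))"
    by (simp add: tF_eq cou_src)
  also have "\<dots> = (\<Sum>p q:F. (\<Sum>x1 x2:cop L x. tgt L (cou L (x2 \<odot> q)) \<odot> x1) \<odot> p)"
    unfolding cop_LF[OF bal_counit(2)] by (simp add: psum_swap[of _ F])
  also have "\<dots> = x \<odot> (\<Sum>p q:F. tgt L (cou L q) \<odot> p)"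
    unfolding counit_right_mult by simp
  finally show ?thesis by (simp add: F_normal_right del: L.mult_psum)
qed

text \<open>
  Every form on three factors over the twisted base arises from one over the old base by acting with
  \<open>(\<Delta> \<diamond> id)(F) F\<^sup>1\<^sup>2\<close>. The other form is obtained by acting with the inverse \<open>G\<^sup>1\<^sup>2 (\<Delta> \<diamond> id)(G)\<close>.
\<close>

lemma Fbal3_conv_bal3:
  fixes \<psi> :: "'a \<Rightarrow> 'a \<Rightarrow> 'a \<Rightarrow> 'c::ab_group_add"
  assumes "Fbal3 \<psi>"
  obtains \<phi> :: "'a \<Rightarrow> 'a \<Rightarrow> 'a \<Rightarrow> 'c" where "bal3 \<phi>"
    "\<And>x y z. \<psi> x y z = (\<Sum>p q:F. \<Sum>p1 p2:cop L p. \<Sum>p' q':F.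
        \<phi> (p1 \<odot> (p' \<odot> x)) (p2 \<odot> (q' \<odot> y)) (q \<odot> z))"
proof -
  note \<psi> = form3_simps[OF assms]
  \<comment> \<open>\<open>\<theta> r\<close> is \<open>\<psi>(\<hyphen>, \<hyphen>, r)\<close> precomposed with \<open>G\<close>, and \<open>\<phi>\<close> below uses \<open>(\<Delta> \<diamond> id)(G)\<close> in addition.\<close>
  define \<theta> where "\<theta> r x y = (\<Sum>g h:G. \<psi> (g \<odot> x) (h \<odot> y) r)" for r x y
  have \<theta>: "bal (\<theta> r)" for r
    unfolding \<theta>_def by (rule bal_G[OF form3_form(1)[OF assms]])
  note \<theta>_simps = form_simps[OF \<theta>]
  have \<theta>_add: "\<theta> (r + r') x y = \<theta> r x y + \<theta> r' x y" for r r' x y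
    by (simp add: \<theta>_def \<psi> psum_plus)
  have \<theta>_F: "(\<Sum>p q:F. \<theta> r (p \<odot> x) (q \<odot> y)) = \<psi> x y r" for r x y
    unfolding \<theta>_def by (rule GF_act[OF form3_form(1)[OF assms]])
  \<comment> \<open>\<open>G \<Delta>(t\<^sup>F(c)) = (1 \<otimes> t\<^sup>F(c)) G\<close>, by inserting \<open>F G = 1\<close>.\<close>
  have \<theta>_tF: "(\<Sum>u1 u2:cop L (tF c). \<theta> r (u1 \<odot> x) (u2 \<odot> y)) = \<theta> (sF c \<odot> r) x y" for c r x y
  proof -
    have "(\<Sum>u1 u2:cop L (tF c). \<theta> r (u1 \<odot> x) (u2 \<odot> y))
        = (\<Sum>g h:G. \<Sum>p q:F. \<Sum>u1 u2:cop L (tF c). \<theta> r (u1 \<odot> (p \<odot> (g \<odot> x))) (u2 \<odot> (q \<odot> (h \<odot> y))))"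
      by (rule FG_act[OF bal_mult_cop[OF \<theta>], symmetric])
    also have "\<dots> = (\<Sum>g h:G. \<Sum>p q:F. \<theta> r (p \<odot> (g \<odot> x)) (q \<odot> (tF c \<odot> (h \<odot> y))))"
      by (simp only: psum_swap[of F] cop_tF_act[OF \<theta>])
    also have "\<dots> = \<theta> (sF c \<odot> r) x y"
      unfolding \<theta>_F unfolding \<theta>_def by (simp add: \<psi>)
    finally show ?thesis .
  qed
  define \<chi> where "\<chi> u v r x y = (\<Sum>x1 x2:cop L x. \<theta> (y \<odot> r) (x1 \<odot> u) (x2 \<odot> v))" for u v r x y
  have \<chi>: "Fbal (\<chi> u v r)" for u v r
  proof (rule formI)
    fix x x' y y' b
    show "\<chi> u v r (x + x') y = \<chi> u v r x y + \<chi> u v r x' y"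
      unfolding \<chi>_def by (rule cop_add_form[OF bal_mult_right[OF \<theta>]])
    show "\<chi> u v r x (y + y') = \<chi> u v r x y + \<chi> u v r x y'"
      unfolding \<chi>_def by (simp add: \<theta>_add psum_plus)
    show "\<chi> u v r (tF b \<odot> x) y = \<chi> u v r x (sF b \<odot> y)"
      unfolding \<chi>_def by (simp add: cop_mult_right_form[OF bal_mult_right[OF \<theta>]] \<theta>_tF)
  qed
  define \<phi> where "\<phi> x y z = (\<Sum>a b:G. \<chi> x y z a b)" for x y z
  have "bal3 \<phi>"
  proof (rule form3I)
    fix x x' y y' z z' b
    show "\<phi> (x + x') y z = \<phi> x y z + \<phi> x' y z" "\<phi> x (y + y') z = \<phi> x y z + \<phi> x y' z"
      "\<phi> x y (z + z') = \<phi> x y z + \<phi> x y z'"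
      by (simp_all add: \<phi>_def \<chi>_def \<theta>_simps \<theta>_add psum_plus)
    show "\<phi> (tgt L b \<odot> x) y z = \<phi> x (src L b \<odot> y) z"
      unfolding \<phi>_def \<chi>_def using form_simps(3)[OF bal_mult_cop[OF \<theta>]] by simp
    have "\<phi> x (tgt L b \<odot> y) z = (\<Sum>g h:G. \<chi> x y z (g \<odot> tgt L b) h)"
      unfolding \<phi>_def \<chi>_def by (simp add: cop_tgt_right[OF bal_mult_right[OF \<theta>]])
    also have "\<dots> = (\<Sum>g h:G. \<chi> x y z g (h \<odot> src L b))"
      using G_balance[OF \<chi>, of x y z b "\<one>\<^bsub>L\<^esub>" "\<one>\<^bsub>L\<^esub>"] by simp
    also have "\<dots> = \<phi> x y (src L b \<odot> z)"
      unfolding \<phi>_def \<chi>_def by simp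
    finally show "\<phi> x (tgt L b \<odot> y) z = \<phi> x y (src L b \<odot> z)" .
  qed
  moreover have "\<psi> x y z = (\<Sum>p q:F. \<Sum>p1 p2:cop L p. \<Sum>p' q':F.
        \<phi> (p1 \<odot> (p' \<odot> x)) (p2 \<odot> (q' \<odot> y)) (q \<odot> z))" for x y z
  proof -
    have 1: "\<chi> u v (q \<odot> z) a b = \<chi> u v z a (b \<odot> q)" for u v a b q
      unfolding \<chi>_def by simp
    have "(\<Sum>p1 p2:cop L p. \<Sum>p' q':F. \<phi> (p1 \<odot> (p' \<odot> x)) (p2 \<odot> (q' \<odot> y)) (q \<odot> z))
       = (\<Sum>p' q':F. \<Sum>a b:G. \<chi> (p' \<odot> x) (q' \<odot> y) z (a \<odot> p) (b \<odot> q))" for p q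
      unfolding \<phi>_def 1
      by (simp add: \<chi>_def cop_mult_right_form[OF bal_mult_right[OF \<theta>]] psum_swap[of "cop L p" F]
          psum_swap[of "cop L p" G])
    then have "(\<Sum>p q:F. \<Sum>p1 p2:cop L p. \<Sum>p' q':F.
        \<phi> (p1 \<odot> (p' \<odot> x)) (p2 \<odot> (q' \<odot> y)) (q \<odot> z))
       = (\<Sum>p' q':F. \<Sum>p q:F. \<Sum>a b:G. \<chi> (p' \<odot> x) (q' \<odot> y) z (a \<odot> p) (b \<odot> q))"
      by (simp only:) (rule psum_swap)
    also have "\<dots> = (\<Sum>p' q':F. \<chi> (p' \<odot> x) (q' \<odot> y) z \<one>\<^bsub>L\<^esub> \<one>\<^bsub>L\<^esub>)"
      using GF_act[OF \<chi>, of _ _ _ "\<one>\<^bsub>L\<^esub>" "\<one>\<^bsub>L\<^esub>"] by simp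
    also have "\<dots> = \<psi> x y z"
      unfolding \<chi>_def by (simp add: cop_one_form[OF bal_mult_right[OF \<theta>]] \<theta>_F)
    finally show ?thesis by simp
  qed
  ultimately show thesis by (rule that)
qed

lemma bal3_mult_cop:
  assumes "bal3 \<phi>"
  shows "bal3 (\<lambda>u v w. \<Sum>x1 x2:cop L x. \<Sum>x21 x22:cop L x2. \<phi> (x1 \<odot> u) (x21 \<odot> v) (x22 \<odot> w))"
proof (rule form3I)
  note \<phi> = form3_simps[OF assms]
  fix u v w b
  have 1: "bal (\<lambda>y z. \<phi> x (y \<odot> v) (z \<odot> w))" for x v w
    by (rule bal_mult_right[OF form3_form(2)[OF assms]])
  have "bal (\<lambda>x1 x2. \<Sum>x21 x22:cop L x2. \<phi> (x1 \<odot> u) (x21 \<odot> v) (x22 \<odot> w))"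
    by (rule formI) (simp_all add: \<phi> psum_plus cop_add_form[OF 1] cop_src_left[OF 1])
  from cop_takeuchi_form[OF this, of x b]
  show "(\<Sum>x1 x2:cop L x. \<Sum>x21 x22:cop L x2. \<phi> (x1 \<odot> (tgt L b \<odot> u)) (x21 \<odot> v) (x22 \<odot> w))
    = (\<Sum>x1 x2:cop L x. \<Sum>x21 x22:cop L x2. \<phi> (x1 \<odot> u) (x21 \<odot> (src L b \<odot> v)) (x22 \<odot> w))"
    by (simp add: cop_src_right[OF 1])
  show "(\<Sum>x1 x2:cop L x. \<Sum>x21 x22:cop L x2. \<phi> (x1 \<odot> u) (x21 \<odot> (tgt L b \<odot> v)) (x22 \<odot> w))
    = (\<Sum>x1 x2:cop L x. \<Sum>x21 x22:cop L x2. \<phi> (x1 \<odot> u) (x21 \<odot> v) (x22 \<odot> (src L b \<odot> w)))"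
    by (rule psum_cong[OF HOL.refl], rule form_simps(3)[OF bal_mult_cop[OF form3_form(2)[OF assms]]])
qed (simp_all add: form3_simps[OF assms] psum_plus)

lemma F_cocycle_act:
  assumes "bal3 \<psi>"
  shows "(\<Sum>p q:F. \<Sum>p1 p2:cop L p. \<Sum>p' q':F. \<psi> (p1 \<odot> (p' \<odot> x)) (p2 \<odot> (q' \<odot> y)) (q \<odot> z))
       = (\<Sum>p q:F. \<Sum>q1 q2:cop L q. \<Sum>p' q':F. \<psi> (p \<odot> x) (q1 \<odot> (p' \<odot> y)) (q2 \<odot> (q' \<odot> z)))"
proof -
  have "bal3 (\<lambda>u v w. \<psi> (u \<odot> x) (v \<odot> y) (w \<odot> z))"
    by (rule form3I) (simp_all add: form3_simps[OF assms])
  from F_cocycle[OF this] show ?thesis by simp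
qed

lemmas cop_F_swap = psum_swap[of "cop L x" F for x]

text \<open>
  Only interchanges of finite sums, needed because the range \<open>k p q\<close> of an inner sum may depend on the
  index of an outer one.
\<close>

lemma cop2_swap:
  fixes f :: "'a \<Rightarrow> 'a \<Rightarrow> 'a \<Rightarrow> 'a \<Rightarrow> 'a \<Rightarrow> 'd \<Rightarrow> 'e \<Rightarrow> 'a \<Rightarrow> 'a \<Rightarrow> 'f::comm_monoid_add"
  shows "(\<Sum>x1 x2:cop L x. \<Sum>x21 x22:cop L x2. \<Sum>p q:F. \<Sum>a b:k p q. \<Sum>p' q':F.
      f x1 x21 x22 p q a b p' q')
   = (\<Sum>p q:F. \<Sum>a b:k p q. \<Sum>p' q':F. \<Sum>x1 x2:cop L x. \<Sum>x21 x22:cop L x2.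
      f x1 x21 x22 p q a b p' q')"
proof -
  have "(\<Sum>x21 x22:cop L y. \<Sum>p q:F. \<Sum>a b:k p q. \<Sum>p' q':F. g x21 x22 p q a b p' q')
    = (\<Sum>p q:F. \<Sum>a b:k p q. \<Sum>p' q':F. \<Sum>x21 x22:cop L y. g x21 x22 p q a b p' q')"
    for y and g :: "'a \<Rightarrow> 'a \<Rightarrow> 'a \<Rightarrow> 'a \<Rightarrow> 'd \<Rightarrow> 'e \<Rightarrow> 'a \<Rightarrow> 'a \<Rightarrow> 'f::comm_monoid_add"
    by (subst psum_swap, rule psum_cong[OF HOL.refl], subst psum_swap, rule psum_cong[OF HOL.refl], rule psum_swap)
  then show ?thesis
    by (simp only: psum_swap[of "cop L x" F] psum_swap[of "cop L x" "k p q" for p q])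
qed

text \<open>
  If \<open>\<psi>\<close> arises from \<open>\<phi>\<close> as above, then both sides evaluate \<open>\<phi>\<close> at the iterated coproduct of \<open>x\<close> in
  \<open>L\<close>, multiplied from the right by the two sides of the cocycle identity.
\<close>

lemma LF_coassoc_form:
  fixes \<psi> :: "'a \<Rightarrow> 'a \<Rightarrow> 'a \<Rightarrow> 'c::ab_group_add"
  assumes "Fbal3 \<psi>"
  shows "(\<Sum>x1 x2:cop LF x. \<Sum>x11 x12:cop LF x1. \<psi> x11 x12 x2)
       = (\<Sum>x1 x2:cop LF x. \<Sum>x21 x22:cop LF x2. \<psi> x1 x21 x22)"
proof -
  obtain \<phi> :: "'a \<Rightarrow> 'a \<Rightarrow> 'a \<Rightarrow> 'c" where "bal3 \<phi>" and \<psi>_left: "\<And>x y z. \<psi> x y z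
      = (\<Sum>p q:F. \<Sum>p1 p2:cop L p. \<Sum>p' q':F.
        \<phi> (p1 \<odot> (p' \<odot> x)) (p2 \<odot> (q' \<odot> y)) (q \<odot> z))"
    using Fbal3_conv_bal3[OF assms] by blast
  have \<psi>_right: "\<psi> x y z = (\<Sum>p q:F. \<Sum>q1 q2:cop L q. \<Sum>p' q':F.
        \<phi> (p \<odot> x) (q1 \<odot> (p' \<odot> y)) (q2 \<odot> (q' \<odot> z)))" for x y z
    unfolding \<psi>_left by (rule F_cocycle_act[OF \<open>bal3 \<phi>\<close>])
  note \<phi> = form3_simps[OF \<open>bal3 \<phi>\<close>]
  have \<phi>1: "bal (\<lambda>x y. \<phi> x y z)" for z by (rule form3_form(1)[OF \<open>bal3 \<phi>\<close>])
  have \<phi>2: "bal (\<lambda>y z. \<phi> x y z)" for x by (rule form3_form(2)[OF \<open>bal3 \<phi>\<close>])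
  have 1: "bal (\<lambda>y1 y2. \<Sum>p' q':F. \<phi> (y1 \<odot> p') (y2 \<odot> q') z)" for z
    by (rule bal_mult_F[OF \<phi>1])
  have 2: "bal (\<lambda>y1 y2. \<Sum>p' q':F. \<phi> x (y1 \<odot> p') (y2 \<odot> q'))" for x
    by (rule bal_mult_F[OF \<phi>2])
  define \<Omega> where "\<Omega> y z = (\<Sum>y1 y2:cop L y. \<Sum>p' q':F. \<phi> (y1 \<odot> p') (y2 \<odot> q') z)" for y z
  have \<Omega>: "bal \<Omega>"
    by (rule formI) (simp_all add: \<Omega>_def cop_add_form[OF 1] cop_tgt_left[OF 1] \<phi> psum_plus)
  define \<Omega>' where "\<Omega>' x y = (\<Sum>y1 y2:cop L y. \<Sum>p' q':F. \<phi> x (y1 \<odot> p') (y2 \<odot> q'))" for x y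
  have \<Omega>': "bal \<Omega>'"
    by (rule formI) (simp_all add: \<Omega>'_def cop_add_form[OF 2] cop_src_left[OF 2] \<phi> psum_plus)
  have right: "(\<Sum>p q:F. \<Omega>' (p \<odot> x1) (q \<odot> x2)) = (\<Sum>x21 x22:cop LF x2. \<psi> x1 x21 x22)" for x1 x2
  proof -
    have "(\<Sum>x21 x22:cop LF x2. \<psi> x1 x21 x22)
      = (\<Sum>p q:F. \<Sum>x21 x22:cop LF x2. \<Sum>p' q':F. \<Sum>q1 q2:cop L q.
        \<phi> (p \<odot> x1) (q1 \<odot> (p' \<odot> x21)) (q2 \<odot> (q' \<odot> x22)))"
      unfolding \<psi>_right by (simp only: psum_swap[of "cop LF x2" F] cop_F_swap)
    also have "\<dots> = (\<Sum>p q:F. \<Sum>x21 x22:cop L x2. \<Sum>p' q':F. \<Sum>q1 q2:cop L q.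
        \<phi> (p \<odot> x1) (q1 \<odot> (x21 \<odot> p')) (q2 \<odot> (x22 \<odot> q')))"
      by (simp only: cop_LF[OF bal_mult_cop[OF \<phi>2]])
    also have "\<dots> = (\<Sum>p q:F. \<Omega>' (p \<odot> x1) (q \<odot> x2))"
      unfolding \<Omega>'_def cop_mult_right_form[OF 2] L.assoc by (simp only: cop_F_swap)
    finally show ?thesis by simp
  qed
  have "(\<Sum>x11 x12:cop LF x1. \<psi> x11 x12 x2) = (\<Sum>p q:F. \<Omega> (p \<odot> x1) (q \<odot> x2))" for x1 x2
  proof -
    have "(\<Sum>x11 x12:cop LF x1. \<psi> x11 x12 x2)
      = (\<Sum>p q:F. \<Sum>x11 x12:cop LF x1. \<Sum>p' q':F. \<Sum>p1 p2:cop L p.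
        \<phi> (p1 \<odot> (p' \<odot> x11)) (p2 \<odot> (q' \<odot> x12)) (q \<odot> x2))"
      unfolding \<psi>_left by (simp only: psum_swap[of "cop LF x1" F] cop_F_swap)
    also have "\<dots> = (\<Sum>p q:F. \<Sum>x11 x12:cop L x1. \<Sum>p' q':F. \<Sum>p1 p2:cop L p.
        \<phi> (p1 \<odot> (x11 \<odot> p')) (p2 \<odot> (x12 \<odot> q')) (q \<odot> x2))"
      by (simp only: cop_LF[OF bal_mult_cop[OF \<phi>1]])
    also have "\<dots> = (\<Sum>p q:F. \<Omega> (p \<odot> x1) (q \<odot> x2))"
      unfolding \<Omega>_def cop_mult_right_form[OF 1] L.assoc by (simp only: cop_F_swap)
    finally show ?thesis .
  qed
  then have "(\<Sum>x1 x2:cop LF x. \<Sum>x11 x12:cop LF x1. \<psi> x11 x12 x2)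
      = (\<Sum>x1 x2:cop L x. \<Sum>p q:F. \<Omega> (x1 \<odot> p) (x2 \<odot> q))"
    by (simp add: cop_LF[OF \<Omega>])
  also have "\<dots> = (\<Sum>x1 x2:cop L x. \<Sum>x11 x12:cop L x1. \<Sum>p q:F. \<Sum>p1 p2:cop L p. \<Sum>p' q':F.
        \<phi> (x11 \<odot> (p1 \<odot> p')) (x12 \<odot> (p2 \<odot> q')) (x2 \<odot> q))"
    unfolding \<Omega>_def cop_mult_form[OF 1] L.assoc by (simp only: cop_F_swap)
  also have "\<dots> = (\<Sum>x1 x2:cop L x. \<Sum>x21 x22:cop L x2. \<Sum>p q:F. \<Sum>p1 p2:cop L p. \<Sum>p' q':F.
        \<phi> (x1 \<odot> (p1 \<odot> p')) (x21 \<odot> (p2 \<odot> q')) (x22 \<odot> q))"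
  proof (rule coassoc_form)
    show "bal3 (\<lambda>x1 x21 x22. \<Sum>p q:F. \<Sum>p1 p2:cop L p. \<Sum>p' q':F.
        \<phi> (x1 \<odot> (p1 \<odot> p')) (x21 \<odot> (p2 \<odot> q')) (x22 \<odot> q))"
      by (rule form3I) (simp_all add: \<phi> psum_plus)
  qed
  also have "\<dots> = (\<Sum>p q:F. \<Sum>p1 p2:cop L p. \<Sum>p' q':F. \<Sum>x1 x2:cop L x. \<Sum>x21 x22:cop L x2.
        \<phi> (x1 \<odot> (p1 \<odot> p')) (x21 \<odot> (p2 \<odot> q')) (x22 \<odot> q))"
    by (rule cop2_swap)
  also have "\<dots> = (\<Sum>p q:F. \<Sum>q1 q2:cop L q. \<Sum>p' q':F. \<Sum>x1 x2:cop L x. \<Sum>x21 x22:cop L x2.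
        \<phi> (x1 \<odot> p) (x21 \<odot> (q1 \<odot> p')) (x22 \<odot> (q2 \<odot> q')))"
    by (rule F_cocycle[OF bal3_mult_cop[OF \<open>bal3 \<phi>\<close>]])
  also have "\<dots> = (\<Sum>x1 x2:cop L x. \<Sum>x21 x22:cop L x2. \<Sum>p q:F. \<Sum>q1 q2:cop L q. \<Sum>p' q':F.
        \<phi> (x1 \<odot> p) (x21 \<odot> (q1 \<odot> p')) (x22 \<odot> (q2 \<odot> q')))"
    by (rule cop2_swap[symmetric])
  also have "\<dots> = (\<Sum>x1 x2:cop L x. \<Sum>p q:F. \<Omega>' (x1 \<odot> p) (x2 \<odot> q))"
    unfolding \<Omega>'_def cop_mult_form[OF 2] L.assoc by (simp only: cop_F_swap)
  also have "\<dots> = (\<Sum>x1 x2:cop LF x. \<Sum>p q:F. \<Omega>' (p \<odot> x1) (q \<odot> x2))"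
    by (simp add: cop_LF[OF \<Omega>'])
  also have "\<dots> = (\<Sum>x1 x2:cop LF x. \<Sum>x21 x22:cop LF x2. \<psi> x1 x21 x22)"
    by (simp only: right)
  finally show ?thesis .
qed

lemma LF_coassoc: "diamond3_eq LF
   (\<Sum>x1 x2:cop LF x. \<Sum>x11 x12:cop LF x1. {#(x11, x12, x2)#})
   (\<Sum>x1 x2:cop LF x. \<Sum>x21 x22:cop LF x2. {#(x1, x21, x22)#})"
  unfolding diamond3_eq_def LF_simps
proof (rule tensor3_eqI)
  fix \<psi> :: "'a \<Rightarrow> 'a \<Rightarrow> 'a \<Rightarrow> 'k"
  assume "form3_on LF LF LF (\<lambda>b x. tF b \<odot> x) (\<lambda>b y. sF b \<odot> y) (\<lambda>b x. tF b \<odot> x) (\<lambda>b y. sF b \<odot> y) \<psi>"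
  then have "Fbal3 \<psi>" by (simp add: form3_on_def form3_def)
  from LF_coassoc_form[OF this]
  show "tsum (\<Sum>x1 x2:cop LF x. \<Sum>x11 x12:cop LF x1. {#(x11, x12, x2)#}) \<psi>
      = tsum (\<Sum>x1 x2:cop LF x. \<Sum>x21 x22:cop LF x2. {#(x1, x21, x22)#}) \<psi>"
    by (simp add: tsum_psum)
qed (use L.vspace in \<open>auto simp: is_vspace_def module.subspace_UNIV module_iff_vector_space\<close>)

theorem LF_bialgebroid: "left_bialgebroid BF LF"
proof (intro left_bialgebroid.intro BF_algebra LF_algebra left_bialgebroid_axioms.intro,
    unfold psum_def[symmetric] LF_simps BF_simps)
  interpret BF: unital_algebra BF by (rule BF_algebra)
  show "Vector_Spaces.linear (smul B) (smul L) sF" "Vector_Spaces.linear (smul B) (smul L) tF"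
    using B.vspace L.vspace by (simp_all add: Vector_Spaces.linear_iff)
  show "Vector_Spaces.linear (smul L) (smul B) (cou L)" by (rule cou_linear)
  show "cou L (sF a \<odot> tF b \<odot> x) = a \<cdot>\<^bsub>BF\<^esub> cou L x \<cdot>\<^bsub>BF\<^esub> b" for a b x
    by (simp add: cou_sF_mult cou_tF_mult)
  show "cou L (x \<odot> sF (cou L y)) = cou L (x \<odot> y)" "cou L (x \<odot> tF (cou L y)) = cou L (x \<odot> y)" for x y
    using cou_src[of x "sF (cou L y)"] cou_src[of x "tF (cou L y)"] by (simp_all add: cou_src)
qed (simp_all add: sF_mult tF_mult tF_sF LF_cop_add LF_cop_smul LF_cop_bimodule[simplified] LF_coassoc
   LF_counit_left LF_counit_right LF_cop_takeuchi LF_cop_one LF_cop_mult)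

subsection \<open>The cocycle identity in four tensor factors\<close>

text \<open>
  Both sides are elements of a fourfold tensor product: the left one is \<open>(\<Delta> \<diamond> \<Delta>)(F) (F \<otimes> F)\<close>, and on
  the right a single coproduct, followed by \<open>F\<close>, fills the second and the third factor. This makes the
  middle factors accessible to \<open>link\<close> and to \<open>cou_HG_act\<close>. The proof applies the cocycle identity to the
  factors \<open>1, 2, 34\<close> and then, backwards, to the factors \<open>2, 3, 4\<close>.
\<close>

lemma F_cocycle4:
  assumes 12: "\<And>y z. bal (\<lambda>w x. \<Psi> w x y z)" and 23: "\<And>w z. bal (\<lambda>x y. \<Psi> w x y z)"
    and 34: "\<And>w x. bal (\<lambda>y z. \<Psi> w x y z)"
  shows "(\<Sum>p q:F. \<Sum>p1 p2:cop L p. \<Sum>p' q':F. \<Sum>q1 q2:cop L q. \<Sum>p'' q'':F.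
        \<Psi> (p1 \<odot> p') (p2 \<odot> q') (q1 \<odot> p'') (q2 \<odot> q''))
    = (\<Sum>p q:F. \<Sum>q1 q2:cop L q. \<Sum>p' q':F. \<Sum>y1 y2:cop L (q1 \<odot> p'). \<Sum>p'' q'':F.
        \<Psi> p (y1 \<odot> p'') (y2 \<odot> q'') (q2 \<odot> q'))"
proof -
  have b34: "bal (\<lambda>r1 r2. \<Sum>p'' q'':F. \<Psi> u v (r1 \<odot> p'') (r2 \<odot> q''))" for u v
    by (rule bal_mult_F[OF 34])
  have b23: "bal (\<lambda>r1 r2. \<Sum>p'' q'':F. \<Psi> u (r1 \<odot> p'') (r2 \<odot> q'') z)" for u z
    by (rule bal_mult_F[OF 23])
  have 1: "bal3 (\<lambda>u v r. \<Sum>r1 r2:cop L r. \<Sum>p'' q'':F. \<Psi> u v (r1 \<odot> p'') (r2 \<odot> q''))"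
    by (rule form3I) (simp_all add: cop_add_form[OF b34] cop_src_left[OF b34]
        form_simps[OF 12] form_simps[OF 23] psum_plus)
  have 2: "bal3 (\<Psi> p)" for p
    by (rule form3I) (simp_all add: form_simps[OF 23] form_simps[OF 34])
  have 3: "bal3 (\<lambda>x y z. \<Sum>p' q':F. \<Sum>p1 p2:cop L p'. \<Sum>p'' q'':F.
      \<Psi> p (x \<odot> (p1 \<odot> p'')) (y \<odot> (p2 \<odot> q'')) (z \<odot> q'))" for p
    by (rule form3I) (simp_all add: form_simps[OF 23] form_simps[OF 34] psum_plus)
  have "(\<Sum>p q:F. \<Sum>p1 p2:cop L p. \<Sum>p' q':F. \<Sum>q1 q2:cop L q. \<Sum>p'' q'':F.
        \<Psi> (p1 \<odot> p') (p2 \<odot> q') (q1 \<odot> p'') (q2 \<odot> q''))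
    = (\<Sum>p q:F. \<Sum>q1 q2:cop L q. \<Sum>p' q':F. \<Sum>r1 r2:cop L (q2 \<odot> q'). \<Sum>p'' q'':F.
        \<Psi> p (q1 \<odot> p') (r1 \<odot> p'') (r2 \<odot> q''))"
    by (rule F_cocycle[OF 1])
  also have "\<dots> = (\<Sum>p q:F. \<Sum>q1 q2:cop L q. \<Sum>q21 q22:cop L q2. \<Sum>p' q':F. \<Sum>q'1 q'2:cop L q'. \<Sum>p'' q'':F.
        \<Psi> p (q1 \<odot> p') (q21 \<odot> (q'1 \<odot> p'')) (q22 \<odot> (q'2 \<odot> q'')))"
    by (simp add: cop_mult_form[OF b34] psum_swap[of F "cop L q2" for q2])
  also have "\<dots> = (\<Sum>p q:F. \<Sum>q1 q2:cop L q. \<Sum>p' q':F. \<Sum>y1 y2:cop L (q1 \<odot> p'). \<Sum>p'' q'':F.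
        \<Psi> p (y1 \<odot> p'') (y2 \<odot> q'') (q2 \<odot> q'))"
  proof (rule psum_cong[OF HOL.refl])
    fix p q
    have "(\<Sum>q1 q2:cop L q. \<Sum>q21 q22:cop L q2. \<Sum>p' q':F. \<Sum>q'1 q'2:cop L q'. \<Sum>p'' q'':F.
        \<Psi> p (q1 \<odot> p') (q21 \<odot> (q'1 \<odot> p'')) (q22 \<odot> (q'2 \<odot> q'')))
      = (\<Sum>p' q':F. \<Sum>q'1 q'2:cop L q'. \<Sum>p'' q'':F. \<Sum>q1 q2:cop L q. \<Sum>q21 q22:cop L q2.
        \<Psi> p (q1 \<odot> p') (q21 \<odot> (q'1 \<odot> p'')) (q22 \<odot> (q'2 \<odot> q'')))"
      by (rule cop2_swap)
    also have "\<dots> = (\<Sum>p' q':F. \<Sum>p'1 p'2:cop L p'. \<Sum>p'' q'':F. \<Sum>q1 q2:cop L q. \<Sum>q21 q22:cop L q2.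
        \<Psi> p (q1 \<odot> (p'1 \<odot> p'')) (q21 \<odot> (p'2 \<odot> q'')) (q22 \<odot> q'))"
      by (rule F_cocycle[OF bal3_mult_cop[OF 2], symmetric])
    also have "\<dots> = (\<Sum>q1 q2:cop L q. \<Sum>q21 q22:cop L q2. \<Sum>p' q':F. \<Sum>p'1 p'2:cop L p'. \<Sum>p'' q'':F.
        \<Psi> p (q1 \<odot> (p'1 \<odot> p'')) (q21 \<odot> (p'2 \<odot> q'')) (q22 \<odot> q'))"
      by (rule cop2_swap[symmetric])
    also have "\<dots> = (\<Sum>q1 q2:cop L q. \<Sum>q11 q12:cop L q1. \<Sum>p' q':F. \<Sum>p'1 p'2:cop L p'. \<Sum>p'' q'':F.
        \<Psi> p (q11 \<odot> (p'1 \<odot> p'')) (q12 \<odot> (p'2 \<odot> q'')) (q2 \<odot> q'))"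
      by (rule coassoc_form[OF 3, symmetric])
    also have "\<dots> = (\<Sum>q1 q2:cop L q. \<Sum>p' q':F. \<Sum>y1 y2:cop L (q1 \<odot> p'). \<Sum>p'' q'':F.
        \<Psi> p (y1 \<odot> p'') (y2 \<odot> q'') (q2 \<odot> q'))"
      unfolding cop_mult_form[OF b23] L.assoc by (rule psum_cong[OF HOL.refl]) (rule psum_swap)
    finally show "(\<Sum>q1 q2:cop L q. \<Sum>q21 q22:cop L q2. \<Sum>p' q':F. \<Sum>q'1 q'2:cop L q'. \<Sum>p'' q'':F.
        \<Psi> p (q1 \<odot> p') (q21 \<odot> (q'1 \<odot> p'')) (q22 \<odot> (q'2 \<odot> q'')))
      = (\<Sum>q1 q2:cop L q. \<Sum>p' q':F. \<Sum>y1 y2:cop L (q1 \<odot> p'). \<Sum>p'' q'':F.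
        \<Psi> p (y1 \<odot> p'') (y2 \<odot> q'') (q2 \<odot> q'))" .
  qed
  finally show ?thesis .
qed

end

section \<open>The translation map of a left Hopf algebroid\<close>

context left_hopf_algebroid
begin

abbreviation "tr \<equiv> translation L"

lemma psum_galois_map: "psum (galois_map L u) \<phi> = (\<Sum>x y:u. \<Sum>x1 x2:cop L x. \<phi> x1 (x2 \<odot> y))"
  unfolding galois_map_def psum_def[symmetric] by (simp add: psum_psum)

lemma tr_galois:
  assumes "bal \<phi>"
  shows "(\<Sum>p m:tr X. \<Sum>p1 p2:cop L p. \<phi> p1 (p2 \<odot> m)) = \<phi> X \<one>\<^bsub>L\<^esub>"
proof -
  have "\<exists>u. diamond_eq L (galois_map L u) {#(X, \<one>\<^bsub>L\<^esub>)#}"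
    using galois_invertible unfolding invertible_mod_def by blast
  from someI_ex[OF this] have "diamond_eq L (galois_map L (tr X)) {#(X, \<one>\<^bsub>L\<^esub>)#}"
    by (simp add: translation_def)
  from diamond_eq_form[OF this assms] show ?thesis by (simp add: psum_galois_map)
qed

text \<open>
  The Galois map \<open>X \<otimes> Y \<mapsto> X\<^sub>1 \<diamond> X\<^sub>2 Y\<close> is injective, so equality over the opposite of \<open>B\<close> may be tested
  after it.
\<close>

lemma over_op_formI:
  assumes "obal \<psi>"
    and eq: "\<And>\<phi> :: 'a \<Rightarrow> 'a \<Rightarrow> 'k. bal \<phi> \<Longrightarrow> (\<Sum>x y:u. \<Sum>x1 x2:cop L x. \<phi> x1 (x2 \<odot> y))
         = (\<Sum>x y:v. \<Sum>x1 x2:cop L x. \<phi> x1 (x2 \<odot> y))"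
  shows "psum u \<psi> = psum v \<psi>"
proof -
  have "diamond_eq L (galois_map L u) (galois_map L v)"
    by (rule diamond_eqI) (simp add: psum_galois_map eq)
  then have "over_op_eq L u v"
    using galois_invertible by (auto simp: invertible_mod_def)
  from over_op_eq_form[OF this assms(1)] show ?thesis .
qed

lemma tr_add:
  assumes "obal \<psi>"
  shows "psum (tr (X + Y)) \<psi> = psum (tr X) \<psi> + psum (tr Y) \<psi>"
proof -
  have "psum (tr (X + Y)) \<psi> = psum (tr X + tr Y) \<psi>"
    by (rule over_op_formI[OF assms]) (simp add: tr_galois form_simps)
  then show ?thesis by simp
qed

lemma tr_psum:
  "obal \<psi> \<Longrightarrow> psum (tr (psum u f)) \<psi> = (\<Sum>x y:u. psum (tr (f x y)) \<psi>)"
  by (rule additive_psum) (rule tr_add)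

text \<open>
  \<open>t(b) X\<^sub>+ \<otimes> X\<^sub>- = X\<^sub>+ \<otimes> X\<^sub>- t(b)\<close>.
\<close>

lemma tr_tgt:
  assumes "obal \<psi>"
  shows "(\<Sum>p m:tr X. \<psi> (tgt L b \<odot> p) m) = (\<Sum>p m:tr X. \<psi> p (m \<odot> tgt L b))"
proof -
  have "psum (\<Sum>p m:tr X. {#(tgt L b \<odot> p, m)#}) \<psi> = psum (\<Sum>p m:tr X. {#(p, m \<odot> tgt L b)#}) \<psi>"
  proof (rule over_op_formI[OF assms])
    fix \<phi> :: "'a \<Rightarrow> 'a \<Rightarrow> 'k" assume \<phi>: "bal \<phi>"
    have 1: "bal (\<lambda>x y. \<phi> x (y \<odot> m))" for m by (rule formI) (simp_all add: form_simps[OF \<phi>])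
    have 2: "bal (\<lambda>x y. \<phi> x (tgt L b \<odot> y))"
      by (rule formI) (simp_all add: form_simps[OF \<phi>] tgt_src_left)
    show "(\<Sum>x y:(\<Sum>p m:tr X. {#(tgt L b \<odot> p, m)#}). \<Sum>x1 x2:cop L x. \<phi> x1 (x2 \<odot> y))
        = (\<Sum>x y:(\<Sum>p m:tr X. {#(p, m \<odot> tgt L b)#}). \<Sum>x1 x2:cop L x. \<phi> x1 (x2 \<odot> y))"
      using tr_galois[OF 1, of X "tgt L b"] tr_galois[OF 2, of X]
      by (simp add: psum_psum cop_tgt_left[OF 1])
  qed
  then show ?thesis by (simp add: psum_psum)
qed

lemma tr_mult:
  assumes "obal \<psi>"
  shows "psum (tr (X \<odot> Y)) \<psi> = (\<Sum>p m:tr X. \<Sum>p' m':tr Y. \<psi> (p \<odot> p') (m' \<odot> m))"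
proof -
  have "psum (tr (X \<odot> Y)) \<psi> = psum (\<Sum>p m:tr X. \<Sum>p' m':tr Y. {#(p \<odot> p', m' \<odot> m)#}) \<psi>"
  proof (rule over_op_formI[OF assms])
    fix \<phi> :: "'a \<Rightarrow> 'a \<Rightarrow> 'k" assume \<phi>: "bal \<phi>"
    have 1: "bal (\<lambda>x y. \<phi> x (y \<odot> m))" for m by (rule formI) (simp_all add: form_simps[OF \<phi>])
    have 2: "bal (\<lambda>x y. \<phi> (x \<odot> Y) y)" by (rule formI) (simp_all add: form_simps[OF \<phi>])
    have "(\<Sum>p' m':tr Y. \<Sum>x1 x2:cop L (p \<odot> p'). \<phi> x1 (x2 \<odot> (m' \<odot> m)))
        = (\<Sum>p1 p2:cop L p. \<phi> (p1 \<odot> Y) (p2 \<odot> m))" for p m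
      using tr_galois[OF bal_mult_cop[OF 1], of Y p m]
      by (simp add: cop_mult_right_form[OF 1])
    then show "(\<Sum>x y:tr (X \<odot> Y). \<Sum>x1 x2:cop L x. \<phi> x1 (x2 \<odot> y))
        = (\<Sum>x y:(\<Sum>p m:tr X. \<Sum>p' m':tr Y. {#(p \<odot> p', m' \<odot> m)#}). \<Sum>x1 x2:cop L x. \<phi> x1 (x2 \<odot> y))"
      using tr_galois[OF 2, of X] by (simp add: psum_psum tr_galois[OF \<phi>])
  qed
  then show ?thesis by (simp add: psum_psum)
qed

lemma obal_mult_tr:
  assumes "obal \<psi>"
  shows "obal (\<lambda>p m. \<Sum>p' m':tr Y. \<psi> (p \<odot> p') (m' \<odot> m))"
proof (rule formI)
  fix p m b
  have "obal (\<lambda>x y. \<psi> (p \<odot> x) (y \<odot> m))" by (rule formI) (simp_all add: form_simps[OF assms]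
      form_simps(3)[OF assms, where x = "p \<odot> x" for x, simplified])
  from tr_tgt[OF this, of Y b]
  show "(\<Sum>p' m':tr Y. \<psi> (p \<odot> tgt L b \<odot> p') (m' \<odot> m)) = (\<Sum>p' m':tr Y. \<psi> (p \<odot> p') (m' \<odot> (tgt L b \<odot> m)))"
    by simp
qed (simp_all add: form_simps[OF assms] psum_plus)

lemma tr_of_src:
  assumes "obal \<psi>"
  shows "psum (tr (src L a)) \<psi> = \<psi> (src L a) \<one>\<^bsub>L\<^esub>"
proof -
  have "psum (tr (src L a)) \<psi> = psum {#(src L a, \<one>\<^bsub>L\<^esub>)#} \<psi>"
    by (rule over_op_formI[OF assms]) (simp add: tr_galois cop_of_src)
  then show ?thesis by simp
qed

lemma tr_of_tgt:
  assumes "obal \<psi>"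
  shows "psum (tr (tgt L b)) \<psi> = \<psi> \<one>\<^bsub>L\<^esub> (src L b)"
proof -
  have "psum (tr (tgt L b)) \<psi> = psum {#(\<one>\<^bsub>L\<^esub>, src L b)#} \<psi>"
  proof (rule over_op_formI[OF assms])
    fix \<phi> :: "'a \<Rightarrow> 'a \<Rightarrow> 'k" assume \<phi>: "bal \<phi>"
    have 1: "bal (\<lambda>x y. \<phi> x (y \<odot> m))" for m by (rule formI) (simp_all add: form_simps[OF \<phi>])
    show "(\<Sum>x y:tr (tgt L b). \<Sum>x1 x2:cop L x. \<phi> x1 (x2 \<odot> y))
        = psum {#(\<one>\<^bsub>L\<^esub>, src L b)#} (\<lambda>x y. \<Sum>x1 x2:cop L x. \<phi> x1 (x2 \<odot> y))"
      using form_simps(3)[OF \<phi>, of b "\<one>\<^bsub>L\<^esub>" "\<one>\<^bsub>L\<^esub>"]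
      by (simp add: tr_galois[OF \<phi>] cop_one_form[OF 1])
  qed
  then show ?thesis by simp
qed

lemma tr_of_one:
  "obal \<psi> \<Longrightarrow> psum (tr \<one>\<^bsub>L\<^esub>) \<psi> = \<psi> \<one>\<^bsub>L\<^esub> \<one>\<^bsub>L\<^esub>"
  using tr_of_src[of \<psi> "\<one>\<^bsub>B\<^esub>"] by simp

lemma tr_src_left:
  assumes "obal \<psi>"
  shows "psum (tr (src L a \<odot> X)) \<psi> = (\<Sum>p m:tr X. \<psi> (src L a \<odot> p) m)"
  by (simp add: tr_mult[OF assms] tr_of_src[OF obal_mult_tr[OF assms]])

lemma tr_tgt_left:
  assumes "obal \<psi>"
  shows "psum (tr (tgt L b \<odot> X)) \<psi> = (\<Sum>p m:tr X. \<psi> p (m \<odot> src L b))"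
  by (simp add: tr_mult[OF assms] tr_of_tgt[OF obal_mult_tr[OF assms]])

lemma tr_tgt_right:
  assumes "obal \<psi>"
  shows "psum (tr (X \<odot> tgt L b)) \<psi> = (\<Sum>p m:tr X. \<psi> p (src L b \<odot> m))"
proof -
  have "obal (\<lambda>x y. \<psi> (p \<odot> x) (y \<odot> m))" for p m
    by (rule formI) (simp_all add: form_simps[OF assms] form_simps(3)[OF assms, where x = "p \<odot> x" for x, simplified])
  from tr_of_tgt[OF this] show ?thesis by (simp add: tr_mult[OF assms])
qed

text \<open>
  \<open>X\<^sub>1\<^sub>+ \<otimes> X\<^sub>1\<^sub>- X\<^sub>2 Y = X \<otimes> Y\<close>: the translation map inverts the Galois map.
\<close>

lemma tr_inverse:
  assumes "obal \<psi>"
  shows "(\<Sum>x1 x2:cop L X. \<Sum>p m:tr x1. \<psi> p (m \<odot> (x2 \<odot> Y))) = \<psi> X Y"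
proof -
  have "psum (\<Sum>x1 x2:cop L X. \<Sum>p m:tr x1. {#(p, m \<odot> (x2 \<odot> Y))#}) \<psi> = psum {#(X, Y)#} \<psi>"
  proof (rule over_op_formI[OF assms])
    fix \<phi> :: "'a \<Rightarrow> 'a \<Rightarrow> 'k" assume \<phi>: "bal \<phi>"
    have "bal (\<lambda>x y. \<phi> x (y \<odot> m))" for m by (rule formI) (simp_all add: form_simps[OF \<phi>])
    from tr_galois[OF this]
    show "(\<Sum>x y:(\<Sum>x1 x2:cop L X. \<Sum>p m:tr x1. {#(p, m \<odot> (x2 \<odot> Y))#}). \<Sum>x1 x2:cop L x. \<phi> x1 (x2 \<odot> y))
        = psum {#(X, Y)#} (\<lambda>x y. \<Sum>x1 x2:cop L x. \<phi> x1 (x2 \<odot> y))"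
      by (simp add: psum_psum)
  qed
  then show ?thesis by (simp add: psum_psum)
qed

lemma tr_mult_self: "(\<Sum>p m:tr X. p \<odot> m) = src L (cou L X)"
  using tr_galois[OF bal_counit(1), of X] by (simp flip: L.assoc L.mult_psum(1))

lemma tr_counit: "(\<Sum>p m:tr X. p \<odot> tgt L (cou L m)) = X"
  using tr_galois[OF bal_counit(2), of X] by (simp add: counit_right_mult)

text \<open>
  \<open>\<Delta>(X\<^sub>+) \<otimes> X\<^sub>- = X\<^sub>1 \<otimes> X\<^sub>2\<^sub>+ \<otimes> X\<^sub>2\<^sub>-\<close>: both sides have the image \<open>X\<^sub>1 \<diamond> X\<^sub>2 \<diamond> 1\<close> under the Galois map of
  the last two factors. The form \<open>\<Xi>\<close> is \<open>\<Psi>\<close> transported along this map.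
\<close>

lemma cop_tr:
  assumes 1: "\<And>z. bal (\<lambda>x y. \<Psi> x y z)" and 2: "\<And>x. obal (\<lambda>y z. \<Psi> x y z)"
  shows "(\<Sum>p m:tr X. \<Sum>p1 p2:cop L p. \<Psi> p1 p2 m)
       = (\<Sum>x1 x2:cop L X. \<Sum>p m:tr x2. \<Psi> x1 p m)"
proof -
  define \<Xi> where "\<Xi> x y z = (\<Sum>p m:tr y. \<Psi> x p (m \<odot> z))" for x y z
  have 3: "obal (\<lambda>y m. \<Psi> x y (m \<odot> z))" for x z
    by (rule formI) (simp_all add: form_simps[OF 2])
  have \<Xi>: "bal3 \<Xi>"
    by (rule form3I) (simp_all add: \<Xi>_def tr_add[OF 3] tr_src_left[OF 3] tr_tgt_left[OF 3]
        form_simps[OF 1] form_simps(1,2)[OF 2] psum_plus)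
  have \<Xi>': "bal3 (\<lambda>x y z. \<Xi> x y (z \<odot> m))" for m
    by (rule form3I) (simp_all add: form3_simps[OF \<Xi>])
  have b: "bal (\<lambda>x y. \<Xi> x y z)" for z by (rule form3_form(1)[OF \<Xi>])
  have b': "bal (\<lambda>y z. \<Sum>y1 y2:cop L y. \<Xi> y1 y2 z)"
    by (rule formI) (simp_all add: form3_simps[OF \<Xi>] cop_add_form[OF b] cop_tgt_left[OF b] psum_plus)
  have "(\<Sum>p m:tr X. \<Sum>p1 p2:cop L p. \<Psi> p1 p2 m)
      = (\<Sum>p m:tr X. \<Sum>p1 p2:cop L p. \<Sum>p21 p22:cop L p2. \<Xi> p1 p21 (p22 \<odot> m))"
    by (simp add: \<Xi>_def tr_inverse[OF 2])
  also have "\<dots> = (\<Sum>p m:tr X. \<Sum>p1 p2:cop L p. \<Sum>p11 p12:cop L p1. \<Xi> p11 p12 (p2 \<odot> m))"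
    by (simp add: coassoc_form[OF \<Xi>'])
  also have "\<dots> = (\<Sum>x1 x2:cop L X. \<Sum>p m:tr x2. \<Psi> x1 p m)"
    unfolding tr_galois[OF b'] by (simp add: \<Xi>_def)
  finally show ?thesis .
qed

text \<open>
  \<open>X\<^sub>+ \<otimes> \<Delta>(X\<^sub>-) = X\<^sub>+\<^sub>+ \<otimes> X\<^sub>- \<otimes> X\<^sub>+\<^sub>-\<close>: the Galois map of factors one and three followed by that of factors
  one and two sends both sides to \<open>X \<otimes> 1 \<otimes> 1\<close>. The forms \<open>\<Xi>\<close> and \<open>\<Theta>\<close> are \<open>\<Psi>\<close> transported along the
  first and along both of them.
\<close>

lemma tr_cop:
  assumes 1: "\<And>x. bal (\<lambda>y z. \<Psi> x y z)" and 2: "\<And>y. obal (\<lambda>x z. \<Psi> x y z)"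
  shows "(\<Sum>p m:tr X. \<Sum>m1 m2:cop L m. \<Psi> p m1 m2)
       = (\<Sum>p m:tr X. \<Sum>pp pm:tr p. \<Psi> pp m pm)"
proof -
  define \<Xi> where "\<Xi> x y z = (\<Sum>p m:tr x. \<Psi> p y (m \<odot> z))" for x y z
  have 3: "obal (\<lambda>x m. \<Psi> x y (m \<odot> z))" for y z
    by (rule formI) (simp_all add: form_simps[OF 2])
  have \<Xi>_add: "\<Xi> (x + x') y z = \<Xi> x y z + \<Xi> x' y z" "\<Xi> x (y + y') z = \<Xi> x y z + \<Xi> x y' z"
    "\<Xi> x y (z + z') = \<Xi> x y z + \<Xi> x y z'" for x x' y y' z z'
    by (simp_all add: \<Xi>_def tr_add[OF 3] form_simps(1,2)[OF 1] psum_plus)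
  have \<Xi>_tgt: "\<Xi> (tgt L b \<odot> x) y z = \<Xi> x y (src L b \<odot> z)" for b x y z
    by (simp add: \<Xi>_def tr_tgt_left[OF 3])
  have \<Xi>_mid: "\<Xi> (x \<odot> tgt L b) y z = \<Xi> x (tgt L b \<odot> y) z" for b x y z
    by (simp add: \<Xi>_def tr_tgt_right[OF 3] form_simps(3)[OF 1])
  have 4: "obal (\<lambda>x m. \<Xi> x (m \<odot> y) z)" for y z
    by (rule formI) (simp_all add: \<Xi>_add \<Xi>_mid)
  have 5: "obal (\<lambda>x y. \<Xi> x y z)" for z
    by (rule formI) (simp_all add: \<Xi>_add \<Xi>_mid)
  define \<Theta> where "\<Theta> x y z = (\<Sum>p m:tr x. \<Xi> p (m \<odot> y) z)" for x y z
  have \<Theta>: "bal3 \<Theta>"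
    by (rule form3I) (simp_all add: \<Theta>_def tr_add[OF 4] tr_tgt_left[OF 4] \<Xi>_add psum_plus \<Xi>_tgt
       flip: tr_tgt[OF 4, simplified])
  note \<Theta>_simps = form3_simps[OF \<Theta>]
  have \<Theta>_23: "bal (\<lambda>y z. \<Theta> x y z)" for x by (rule form3_form(2)[OF \<Theta>])
  have \<Theta>_m: "bal3 (\<lambda>x y z. \<Sum>m1 m2:cop L m. \<Theta> x (y \<odot> m1) (z \<odot> m2))" for m
    by (rule form3I) (simp_all add: \<Theta>_simps psum_plus)
  have b: "bal (\<lambda>u v. \<Sum>v1 v2:cop L v. \<Theta> u v1 v2)"
    by (rule formI) (simp_all add: \<Theta>_simps cop_add_form[OF \<Theta>_23] cop_src_left[OF \<Theta>_23] psum_plus)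
  have "(\<Sum>p m:tr X. \<Sum>m1 m2:cop L m. \<Psi> p m1 m2)
      = (\<Sum>p m:tr X. \<Sum>m1 m2:cop L m. \<Sum>p1 p2:cop L p. \<Sum>p11 p12:cop L p1.
          \<Theta> p11 (p12 \<odot> m1) (p2 \<odot> m2))"
    by (simp add: \<Theta>_def tr_inverse[OF 5]) (simp add: \<Xi>_def tr_inverse[OF 2])
  also have "\<dots> = (\<Sum>p m:tr X. \<Sum>p1 p2:cop L p. \<Sum>p11 p12:cop L p1. \<Sum>m1 m2:cop L m.
          \<Theta> p11 (p12 \<odot> m1) (p2 \<odot> m2))"
    by (rule psum_cong[OF HOL.refl], subst psum_swap, rule psum_cong[OF HOL.refl], rule psum_swap)
  also have "\<dots> = (\<Sum>p m:tr X. \<Sum>p1 p2:cop L p. \<Sum>v1 v2:cop L (p2 \<odot> m). \<Theta> p1 v1 v2)"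
    unfolding coassoc_form[OF \<Theta>_m] by (simp add: cop_mult_form[OF \<Theta>_23])
  also have "\<dots> = \<Theta> X \<one>\<^bsub>L\<^esub> \<one>\<^bsub>L\<^esub>"
    unfolding tr_galois[OF b] by (rule cop_one_form[OF \<Theta>_23])
  also have "\<dots> = (\<Sum>p m:tr X. \<Sum>pp pm:tr p. \<Psi> pp m pm)"
    by (simp add: \<Theta>_def \<Xi>_def)
  finally show ?thesis .
qed

end

section \<open>The two actions of the dual on a Hopf algebroid\<close>

locale hopf_pairing = dual_pairing B Lam H br + H: left_hopf_algebroid B H
  for B :: "('k::field, 'b::ab_group_add) algebra"
    and Lam :: "('k, 'b, 'l::ab_group_add) bialgebroid"
    and H :: "('k, 'b, 'h::ab_group_add) bialgebroid"
    and br :: "'l \<Rightarrow> 'h \<Rightarrow> 'b"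
begin

no_notation Lam.mul (infixl "\<odot>" 70)
notation Lam.mul (infixl "\<bullet>" 70)
notation H.mul (infixl "\<odot>" 70)

lemma br_add [simp]: "br (x + y) g = br x g + br y g" "br x (g + h) = br x g + br x h"
  and br_smul [simp]: "br (smul Lam k x) g = smul B k (br x g)" "br x (smul H k g) = smul B k (br x g)"
  using linear_left linear_right by (auto simp: Vector_Spaces.linear_iff)

lemma br_psum [simp]: "br (psum u f) g = (\<Sum>x y:u. br (f x y) g)" "br x (psum u f') = (\<Sum>z w:u. br x (f' z w))"
  by (rule additive_psum[where h = "\<lambda>w. br w g"], simp) (rule additive_psum, simp)

lemma br_src_left [simp]: "br (src Lam a \<bullet> x) g = a \<cdot>\<^bsub>B\<^esub> br x g"
  using pair_bimodule[of a "\<one>\<^bsub>B\<^esub>" x "\<one>\<^bsub>B\<^esub>" "\<one>\<^bsub>B\<^esub>" g "\<one>\<^bsub>B\<^esub>"] by simp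

lemma br_tgt_left [simp]: "br (tgt Lam b \<bullet> x) g = br x (g \<odot> tgt H b)"
  using pair_bimodule[of "\<one>\<^bsub>B\<^esub>" b x "\<one>\<^bsub>B\<^esub>" "\<one>\<^bsub>B\<^esub>" g "\<one>\<^bsub>B\<^esub>"] by simp

lemma br_src_right: "br (x \<bullet> src Lam c) g = br x (src H c \<odot> g)"
  using pair_bimodule[of "\<one>\<^bsub>B\<^esub>" "\<one>\<^bsub>B\<^esub>" x c "\<one>\<^bsub>B\<^esub>" g "\<one>\<^bsub>B\<^esub>"] by simp

lemma br_tgt_H [simp]: "br x (tgt H f \<odot> g) = br x g \<cdot>\<^bsub>B\<^esub> f"
  using pair_bimodule[of "\<one>\<^bsub>B\<^esub>" "\<one>\<^bsub>B\<^esub>" x "\<one>\<^bsub>B\<^esub>" "\<one>\<^bsub>B\<^esub>" g f] by simp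

lemma br_src_tgt_H [simp]: "br x (src H a \<odot> (tgt H f \<odot> g)) = br x (src H a \<odot> g) \<cdot>\<^bsub>B\<^esub> f"
  by (simp flip: H.tgt_src_left)

lemma br_mult_right: "br x (g \<odot> h) = (\<Sum>x1 x2:cop Lam x. br x1 (g \<odot> tgt H (br x2 h)))"
  unfolding psum_def by (rule pair_mult_right)

lemma br_mult_left: "br (x \<bullet> y) g = (\<Sum>g1 g2:cop H g. br x (src H (br y g1) \<odot> g2))"
  unfolding psum_def by (rule pair_mult_left')

declare pair_one_left [simp] pair_one_right [simp]

lemma br_src [simp]: "br (src Lam a) g = a \<cdot>\<^bsub>B\<^esub> cou H g"
  using br_src_left[of a "\<one>\<^bsub>Lam\<^esub>" g] by (simp del: br_src_left)

lemma br_tgt [simp]: "br (tgt Lam b) g = cou H (g \<odot> tgt H b)"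
  using br_tgt_left[of b "\<one>\<^bsub>Lam\<^esub>" g] by (simp del: br_tgt_left)

text \<open>
  The second action replaces the antipode by the translation map: for a Hopf algebra with antipode \<open>S\<close> it
  is \<open>X \<mapsto> X\<^sub>1 \<langle>\<alpha>|S X\<^sub>2\<rangle>\<close>.
\<close>

definition lhit (infixr "\<rhd>" 75) where
  "\<alpha> \<rhd> X = (\<Sum>X1 X2:cop H X. src H (br \<alpha> X1) \<odot> X2)"

definition rhit (infixr "\<unrhd>" 75) where
  "\<alpha> \<unrhd> X = (\<Sum>p m:H.tr X. p \<odot> tgt H (br \<alpha> m))"

lemma bal_lhit: "H.bal (\<lambda>x y. src H (br \<alpha> x) \<odot> y)"
  by (rule formI) simp_all

lemma obal_rhit: "H.obal (\<lambda>x y. x \<odot> tgt H (br \<alpha> y))"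
  by (rule formI) simp_all

lemma lhit_add [simp]: "(\<alpha> + \<beta>) \<rhd> X = \<alpha> \<rhd> X + \<beta> \<rhd> X" "\<alpha> \<rhd> (X + Y) = \<alpha> \<rhd> X + \<alpha> \<rhd> Y"
  by (simp_all add: lhit_def psum_plus H.cop_add_form[OF bal_lhit])

lemma rhit_add [simp]: "(\<alpha> + \<beta>) \<unrhd> X = \<alpha> \<unrhd> X + \<beta> \<unrhd> X" "\<alpha> \<unrhd> (X + Y) = \<alpha> \<unrhd> X + \<alpha> \<unrhd> Y"
  by (simp_all add: rhit_def psum_plus H.tr_add[OF obal_rhit])

lemma lhit_psum [simp]: "psum u f \<rhd> X = (\<Sum>x y:u. f x y \<rhd> X)" "\<alpha> \<rhd> psum u f' = (\<Sum>x y:u. \<alpha> \<rhd> f' x y)"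
  by (rule additive_psum[where h = "\<lambda>w. w \<rhd> X"], simp) (rule additive_psum, simp)

lemma rhit_psum [simp]: "psum u f \<unrhd> X = (\<Sum>x y:u. f x y \<unrhd> X)" "\<alpha> \<unrhd> psum u f' = (\<Sum>x y:u. \<alpha> \<unrhd> f' x y)"
  by (rule additive_psum[where h = "\<lambda>w. w \<unrhd> X"], simp) (rule additive_psum, simp)

lemma lhit_mult: "(\<alpha> \<bullet> \<beta>) \<rhd> X = \<alpha> \<rhd> \<beta> \<rhd> X"
proof -
  have "H.bal3 (\<lambda>u v w. src H (br \<alpha> (src H (br \<beta> u) \<odot> v)) \<odot> w)"
    by (rule form3I) simp_all
  from H.coassoc_form[OF this, of X] show ?thesis
    by (simp add: lhit_def br_mult_left H.cop_psum[OF bal_lhit] H.cop_src_left[OF bal_lhit])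
qed

lemma lhit_one [simp]: "\<one>\<^bsub>Lam\<^esub> \<rhd> X = X"
  by (simp add: lhit_def)

lemma lhit_tgt [simp]: "tgt Lam b \<rhd> X = X \<odot> src H b"
  by (simp add: lhit_def H.counit_left_mult)

lemma lhit_src [simp]: "src Lam b \<rhd> X = src H b \<odot> X"
  by (simp add: lhit_def flip: H.L.mult_psum(2))

lemma rhit_mult: "(\<alpha> \<bullet> \<beta>) \<unrhd> X = \<alpha> \<unrhd> \<beta> \<unrhd> X"
proof -
  have 1: "H.bal (\<lambda>y z. p \<odot> tgt H (br \<alpha> (src H (br \<beta> y) \<odot> z)))" for p
    by (rule formI) simp_all
  have 2: "H.obal (\<lambda>p z. p \<odot> tgt H (br \<alpha> (src H (br \<beta> y) \<odot> z)))" for y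
    by (rule formI) simp_all
  from H.tr_cop[OF 1 2, of X] show ?thesis
    by (simp add: rhit_def br_mult_left H.tr_psum[OF obal_rhit] H.tr_tgt_right[OF obal_rhit])
qed

lemma obal_counit: "H.obal (\<lambda>x y. x \<odot> tgt H (cou H y))"
  by (rule formI) simp_all

lemma rhit_one [simp]: "\<one>\<^bsub>Lam\<^esub> \<unrhd> X = X"
  by (simp add: rhit_def H.tr_counit)

lemma rhit_tgt [simp]: "tgt Lam b \<unrhd> X = tgt H b \<odot> X"
proof -
  have "tgt H b \<odot> (\<Sum>p m:H.tr X. p \<odot> tgt H (cou H m)) = tgt Lam b \<unrhd> X"
    using H.tr_tgt[OF obal_counit, of X b] by (simp add: rhit_def)
  then show ?thesis unfolding H.tr_counit by simp
qed

lemma rhit_src [simp]: "src Lam b \<unrhd> X = X \<odot> tgt H b"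
proof -
  have "(\<Sum>p m:H.tr X. p \<odot> tgt H (cou H m)) \<odot> tgt H b = src Lam b \<unrhd> X"
    by (simp add: rhit_def)
  then show ?thesis unfolding H.tr_counit by simp
qed

text \<open>
  The actions commute since the first uses the left end of \<open>\<Delta> X\<close> and the second the right end; this is
  the content of \<open>cop_tr\<close>.
\<close>

lemma lhit_rhit: "\<alpha> \<rhd> \<beta> \<unrhd> X = \<beta> \<unrhd> \<alpha> \<rhd> X"
proof -
  have 1: "H.bal (\<lambda>x y. src H (br \<alpha> x) \<odot> (y \<odot> tgt H (br \<beta> m)))" for m
    by (rule formI) simp_all
  have 2: "H.obal (\<lambda>y m. src H (br \<alpha> x) \<odot> (y \<odot> tgt H (br \<beta> m)))" for x
    by (rule formI) simp_all
  have "\<alpha> \<rhd> \<beta> \<unrhd> X = (\<Sum>p m:H.tr X. \<Sum>p1 p2:cop H p. src H (br \<alpha> p1) \<odot> (p2 \<odot> tgt H (br \<beta> m)))"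
    by (simp add: lhit_def rhit_def H.cop_psum[OF bal_lhit] H.cop_tgt_right[OF bal_lhit])
  also have "\<dots> = \<beta> \<unrhd> \<alpha> \<rhd> X"
    unfolding H.cop_tr[OF 1 2]
    by (simp add: lhit_def rhit_def H.tr_psum[OF obal_rhit] H.tr_src_left[OF obal_rhit])
  finally show ?thesis .
qed

lemma lhit_tgt_left: "\<alpha> \<rhd> (tgt H b \<odot> X) = tgt H b \<odot> (\<alpha> \<rhd> X)"
  and lhit_tgt_right: "\<alpha> \<rhd> (X \<odot> tgt H b) = (\<alpha> \<rhd> X) \<odot> tgt H b"
  and rhit_src_left: "\<alpha> \<unrhd> (src H b \<odot> X) = src H b \<odot> (\<alpha> \<unrhd> X)"
  and rhit_src_right: "\<alpha> \<unrhd> (X \<odot> src H b) = (\<alpha> \<unrhd> X) \<odot> src H b"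
  using lhit_rhit[of \<alpha> "tgt Lam b" X] lhit_rhit[of \<alpha> "src Lam b" X]
    lhit_rhit[of "src Lam b" \<alpha> X] lhit_rhit[of "tgt Lam b" \<alpha> X] by simp_all

lemma cop_lhit:
  assumes "H.bal \<phi>"
  shows "psum (cop H (\<alpha> \<rhd> X)) \<phi> = (\<Sum>x1 x2:cop H X. \<phi> (\<alpha> \<rhd> x1) x2)"
proof -
  note \<phi> = form_simps[OF assms]
  have "H.bal3 (\<lambda>u v w. \<phi> (src H (br \<alpha> u) \<odot> v) w)"
    by (rule form3I) (simp_all add: \<phi> H.tgt_src_left[symmetric])
  from H.coassoc_form[OF this, of X] show ?thesis
    by (simp add: lhit_def H.cop_psum[OF assms] H.cop_src_left[OF assms] \<phi>)
qed

lemma cop_rhit: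
  assumes "H.bal \<phi>"
  shows "psum (cop H (\<alpha> \<unrhd> X)) \<phi> = (\<Sum>x1 x2:cop H X. \<phi> x1 (\<alpha> \<unrhd> x2))"
proof -
  note \<phi> = form_simps[OF assms]
  have 1: "H.bal (\<lambda>x y. \<phi> x (y \<odot> tgt H (br \<alpha> m)))" for m
    by (rule formI) (simp_all add: \<phi>)
  have 2: "H.obal (\<lambda>y m. \<phi> x (y \<odot> tgt H (br \<alpha> m)))" for x
    by (rule formI) (simp_all add: \<phi>)
  from H.cop_tr[OF 1 2, of X] show ?thesis
    by (simp add: rhit_def H.cop_psum[OF assms] H.cop_tgt_right[OF assms] \<phi>)
qed

text \<open>
  In the scalar products the two halves of \<open>\<Delta> \<alpha>\<close> meet \<open>X\<^sub>1\<^sub>- \<otimes> X\<^sub>2\<close> and combine to \<open>\<langle>\<alpha>|X\<^sub>1\<^sub>- X\<^sub>2\<rangle>\<close>, which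
  \<open>tr_inverse\<close> collapses. This is where the property of an antipode enters.
\<close>

lemma link:
  assumes "H.bal \<phi>"
  shows "(\<Sum>\<alpha>1 \<alpha>2:cop Lam \<alpha>. \<Sum>x1 x2:cop H X. \<phi> (\<alpha>1 \<unrhd> x1) (\<alpha>2 \<rhd> x2))
    = (\<Sum>x1 x2:cop H X. \<phi> (x1 \<odot> tgt H (cou Lam \<alpha>)) x2)"
proof -
  note \<phi> = form_simps[OF assms]
  have ob: "H.obal (\<lambda>p m. \<phi> (p \<odot> tgt H (br \<beta> m)) w)" for \<beta> w
    by (rule formI) (simp_all add: \<phi>)
  have ob': "H.obal (\<lambda>p m. \<phi> (p \<odot> tgt H (br \<beta> (m \<odot> v))) w)" for \<beta> v w
    by (rule formI) (simp_all add: \<phi>)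
  have b3: "H.bal3 (\<lambda>u v w. \<Sum>p m:H.tr u. \<phi> (p \<odot> tgt H (br \<alpha> (m \<odot> v))) w)"
    by (rule form3I) (simp_all add: \<phi> psum_plus H.tr_add[OF ob'] H.tr_tgt_left[OF ob']
        flip: H.tr_tgt[OF ob', simplified])
  \<comment> \<open>The scalar of the second factor is moved into the first, and by \<open>tr_tgt\<close> behind \<open>m\<close>.\<close>
  have "\<phi> (\<alpha>1 \<unrhd> x1) (\<alpha>2 \<rhd> x2) = (\<Sum>x21 x22:cop H x2. \<Sum>p m:H.tr x1.
      \<phi> (p \<odot> tgt H (br \<alpha>1 (m \<odot> tgt H (br \<alpha>2 x21)))) x22)" for \<alpha>1 \<alpha>2 x1 x2
  proof -
    have "\<phi> (\<alpha>1 \<unrhd> x1) (\<alpha>2 \<rhd> x2) = (\<Sum>x21 x22:cop H x2. \<Sum>p m:H.tr x1.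
      \<phi> (tgt H (br \<alpha>2 x21) \<odot> p \<odot> tgt H (br \<alpha>1 m)) x22)"
      by (simp add: lhit_def rhit_def \<phi>)
    then show ?thesis unfolding H.tr_tgt[OF ob] .
  qed
  then have "(\<Sum>\<alpha>1 \<alpha>2:cop Lam \<alpha>. \<Sum>x1 x2:cop H X. \<phi> (\<alpha>1 \<unrhd> x1) (\<alpha>2 \<rhd> x2))
      = (\<Sum>x1 x2:cop H X. \<Sum>x21 x22:cop H x2. \<Sum>p m:H.tr x1. \<Sum>\<alpha>1 \<alpha>2:cop Lam \<alpha>.
         \<phi> (p \<odot> tgt H (br \<alpha>1 (m \<odot> tgt H (br \<alpha>2 x21)))) x22)"
    by (simp only: psum_swap[of "cop Lam \<alpha>"])
  also have "\<dots> = (\<Sum>x1 x2:cop H X. \<Sum>x21 x22:cop H x2. \<Sum>p m:H.tr x1.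
         \<phi> (p \<odot> tgt H (br \<alpha> (m \<odot> x21))) x22)"
    by (simp add: br_mult_right[of \<alpha>] \<phi>)
  also have "\<dots> = (\<Sum>x1 x2:cop H X. \<Sum>x11 x12:cop H x1. \<Sum>p m:H.tr x11.
         \<phi> (p \<odot> tgt H (br \<alpha> (m \<odot> x12))) x2)"
    by (rule H.coassoc_form[OF b3, symmetric])
  also have "\<dots> = (\<Sum>x1 x2:cop H X. \<phi> (x1 \<odot> tgt H (cou Lam \<alpha>)) x2)"
    using H.tr_inverse[OF ob, where Y = "\<one>\<^bsub>H\<^esub>"] by simp
  finally show ?thesis .
qed

lemma lhit_prod: "\<alpha> \<rhd> (X \<odot> Y) = (\<Sum>\<alpha>1 \<alpha>2:cop Lam \<alpha>. (\<alpha>1 \<rhd> X) \<odot> (\<alpha>2 \<rhd> Y))"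
proof -
  have b: "H.bal (\<lambda>x z. src H (br \<beta> x) \<odot> (z \<odot> y))" for \<beta> y
    by (rule formI) simp_all
  have "\<alpha> \<rhd> (X \<odot> Y) = (\<Sum>y1 y2:cop H Y. \<Sum>x1 x2:cop H X. src H (br \<alpha> (x1 \<odot> y1)) \<odot> (x2 \<odot> y2))"
    unfolding lhit_def by (rule H.cop_mult_right_form[OF bal_lhit])
  also have "\<dots> = (\<Sum>\<alpha>1 \<alpha>2:cop Lam \<alpha>. \<Sum>y1 y2:cop H Y. \<Sum>x1 x2:cop H X.
      src H (br \<alpha>1 (x1 \<odot> tgt H (br \<alpha>2 y1))) \<odot> (x2 \<odot> y2))"
    by (simp add: br_mult_right[of \<alpha>] psum_swap[of "cop Lam \<alpha>"])
  also have "\<dots> = (\<Sum>\<alpha>1 \<alpha>2:cop Lam \<alpha>. (\<alpha>1 \<rhd> X) \<odot> (\<alpha>2 \<rhd> Y))"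
    unfolding H.cop_takeuchi_form[OF b] by (simp add: lhit_def)
  finally show ?thesis .
qed

lemma rhit_prod: "\<alpha> \<unrhd> (X \<odot> Y) = (\<Sum>\<alpha>1 \<alpha>2:cop Lam \<alpha>. (\<alpha>2 \<unrhd> X) \<odot> (\<alpha>1 \<unrhd> Y))"
proof -
  have ob: "H.obal (\<lambda>p' m'. p \<odot> (p' \<odot> tgt H (br \<beta> m')))" for \<beta> p
    by (rule formI) simp_all
  have "\<alpha> \<unrhd> (X \<odot> Y) = (\<Sum>p m:H.tr X. \<Sum>p' m':H.tr Y. p \<odot> (p' \<odot> tgt H (br \<alpha> (m' \<odot> m))))"
    unfolding rhit_def using H.tr_mult[OF obal_rhit] by simp
  also have "\<dots> = (\<Sum>\<alpha>1 \<alpha>2:cop Lam \<alpha>. \<Sum>p m:H.tr X. \<Sum>p' m':H.tr Y.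
      p \<odot> (p' \<odot> tgt H (br \<alpha>1 (m' \<odot> tgt H (br \<alpha>2 m)))))"
    by (simp add: br_mult_right[of \<alpha>] psum_swap[of "cop Lam \<alpha>"])
  also have "\<dots> = (\<Sum>\<alpha>1 \<alpha>2:cop Lam \<alpha>. (\<alpha>2 \<unrhd> X) \<odot> (\<alpha>1 \<unrhd> Y))"
    unfolding H.tr_tgt[OF ob, symmetric] by (simp add: rhit_def psum_swap[of "H.tr X" "H.tr Y"])
  finally show ?thesis .
qed

lemma lhit_unit: "\<alpha> \<rhd> \<one>\<^bsub>H\<^esub> = src H (cou Lam \<alpha>)"
  by (simp add: lhit_def H.cop_one_form[OF bal_lhit])

lemma rhit_unit: "\<alpha> \<unrhd> \<one>\<^bsub>H\<^esub> = tgt H (cou Lam \<alpha>)"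
  by (simp add: rhit_def H.tr_of_one[OF obal_rhit])

lemma lhit_of_src: "\<alpha> \<rhd> src H a = src H (cou Lam (\<alpha> \<bullet> src Lam a))"
  using lhit_mult[of \<alpha> "src Lam a" "\<one>\<^bsub>H\<^esub>"] by (simp add: lhit_unit)

lemma rhit_of_tgt: "\<alpha> \<unrhd> tgt H a = tgt H (cou Lam (\<alpha> \<bullet> src Lam a))"
  using rhit_mult[of \<alpha> "src Lam a" "\<one>\<^bsub>H\<^esub>"] by (simp add: rhit_unit)

lemma lhit_of_tgt: "\<alpha> \<rhd> tgt H b = tgt H b \<odot> src H (cou Lam \<alpha>)"
  using lhit_tgt_left[of \<alpha> b "\<one>\<^bsub>H\<^esub>"] by (simp add: lhit_unit)

lemma rhit_of_src: "\<alpha> \<unrhd> src H a = src H a \<odot> tgt H (cou Lam \<alpha>)"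
  using rhit_src_left[of \<alpha> a "\<one>\<^bsub>H\<^esub>"] by (simp add: rhit_unit)

lemma cou_lhit: "cou H (\<alpha> \<rhd> X) = br \<alpha> X"
proof -
  have "cou H (\<alpha> \<rhd> X) = br \<alpha> (\<Sum>x1 x2:cop H X. tgt H (cou H x2) \<odot> x1)"
    by (simp add: lhit_def del: H.counit_right')
  then show ?thesis by simp
qed

text \<open>
  As in \<open>link\<close>, with \<open>X\<^sub>+ X\<^sub>- = \<epsilon>(X)\<close> instead.
\<close>

lemma cou_lhit_rhit: "(\<Sum>\<alpha>1 \<alpha>2:cop Lam \<alpha>. cou H (\<alpha>1 \<rhd> \<alpha>2 \<unrhd> X)) = cou Lam (\<alpha> \<bullet> src Lam (cou H X))"
proof -
  have "(\<Sum>\<alpha>1 \<alpha>2:cop Lam \<alpha>. cou H (\<alpha>1 \<rhd> \<alpha>2 \<unrhd> X)) = br \<alpha> (\<Sum>p m:H.tr X. p \<odot> m)"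
    by (simp add: cou_lhit rhit_def br_mult_right[of \<alpha>] psum_swap[of "cop Lam \<alpha>"])
  also have "\<dots> = br (\<alpha> \<bullet> src Lam (cou H X)) \<one>\<^bsub>H\<^esub>"
    unfolding H.tr_mult_self by (simp add: br_src_right del: pair_one_right)
  finally show ?thesis by simp
qed

lemma lhit_smul [simp]: "smul Lam k \<alpha> \<rhd> X = smul H k (\<alpha> \<rhd> X)" "\<alpha> \<rhd> smul H k X = smul H k (\<alpha> \<rhd> X)"
proof -
  show "smul Lam k \<alpha> \<rhd> X = smul H k (\<alpha> \<rhd> X)" by (simp add: lhit_def H.L.smul_psum)
  show "\<alpha> \<rhd> smul H k X = smul H k (\<alpha> \<rhd> X)"
    using lhit_tgt_left[of \<alpha> "smul B k \<one>\<^bsub>B\<^esub>" X] by simp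
qed

lemma rhit_smul [simp]: "smul Lam k \<alpha> \<unrhd> X = smul H k (\<alpha> \<unrhd> X)" "\<alpha> \<unrhd> smul H k X = smul H k (\<alpha> \<unrhd> X)"
proof -
  show "smul Lam k \<alpha> \<unrhd> X = smul H k (\<alpha> \<unrhd> X)" by (simp add: rhit_def H.L.smul_psum)
  show "\<alpha> \<unrhd> smul H k X = smul H k (\<alpha> \<unrhd> X)"
    using rhit_src_left[of \<alpha> "smul B k \<one>\<^bsub>B\<^esub>" X] by simp
qed

end

section \<open>Twisting a module algebra\<close>

context cocycle_twist
begin

text \<open>
  An algebra, possibly without unit, with a compatible action and a product that is balanced over the
  base.
\<close>

definition module_algebra :: "('a \<Rightarrow> 'm::ab_group_add \<Rightarrow> 'm) \<Rightarrow> ('m \<Rightarrow> 'm \<Rightarrow> 'm) \<Rightarrow> bool" where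
  "module_algebra hit pr \<longleftrightarrow>
     (\<forall>x y m. hit (x + y) m = hit x m + hit y m) \<and> (\<forall>x m n. hit x (m + n) = hit x m + hit x n)
   \<and> (\<forall>x y m. hit (x \<odot> y) m = hit x (hit y m))
   \<and> (\<forall>m n k. pr (m + n) k = pr m k + pr n k) \<and> (\<forall>m n k. pr k (m + n) = pr k m + pr k n)
   \<and> (\<forall>m n k. pr (pr m n) k = pr m (pr n k))
   \<and> (\<forall>b m n. pr (hit (tgt L b) m) n = pr m (hit (src L b) n))
   \<and> (\<forall>x m n. hit x (pr m n) = (\<Sum>x1 x2:cop L x. pr (hit x1 m) (hit x2 n)))"

definition twisted_product :: "('a \<Rightarrow> 'm::ab_group_add \<Rightarrow> 'm) \<Rightarrow> ('m \<Rightarrow> 'm \<Rightarrow> 'm) \<Rightarrow> 'm \<Rightarrow> 'm \<Rightarrow> 'm" where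
  "twisted_product hit pr m n = (\<Sum>p q:F. pr (hit p m) (hit q n))"

lemma module_algebraD:
  assumes "module_algebra hit pr"
  shows "hit (x + y) m = hit x m + hit y m" "hit x (m + n) = hit x m + hit x n"
    "hit (x \<odot> y) m = hit x (hit y m)" "pr (m + n) k = pr m k + pr n k" "pr k (m + n) = pr k m + pr k n"
    "pr (pr m n) k = pr m (pr n k)" "pr (hit (tgt L b) m) n = pr m (hit (src L b) n)"
    "hit x (pr m n) = (\<Sum>x1 x2:cop L x. pr (hit x1 m) (hit x2 n))"
  using assms by (simp_all add: module_algebra_def)

lemma module_algebra_psum:
  fixes hit :: "'a \<Rightarrow> 'm::ab_group_add \<Rightarrow> 'm"
  assumes "module_algebra hit pr"
  shows "hit x (psum u f) = (\<Sum>y z:u. hit x (f y z))" "pr (psum u f) n = (\<Sum>y z:u. pr (f y z) n)"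
    "pr n (psum u f) = (\<Sum>y z:u. pr n (f y z))"
proof -
  note 1 = module_algebraD[OF assms]
  show "hit x (psum u f) = (\<Sum>y z:u. hit x (f y z))" by (rule additive_psum) (rule 1)
  show "pr (psum u f) n = (\<Sum>y z:u. pr (f y z) n)"
    by (rule additive_psum[where h = "\<lambda>w. pr w n"]) (rule 1)
  show "pr n (psum u f) = (\<Sum>y z:u. pr n (f y z))" by (rule additive_psum) (rule 1)
qed

lemma bal_module_algebra:
  assumes "module_algebra hit pr"
  shows "bal (\<lambda>x y. pr (hit x m) (hit y n))"
  by (rule formI) (simp_all add: module_algebraD[OF assms])

lemma hit_twisted_product:
  assumes "module_algebra hit pr"
  shows "hit x (twisted_product hit pr m n)
    = (\<Sum>x1 x2:cop L x. \<Sum>p q:F. pr (hit (x1 \<odot> p) m) (hit (x2 \<odot> q) n))"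
  by (simp add: twisted_product_def module_algebra_psum[OF assms] module_algebraD(3,8)[OF assms]
      psum_swap[of F])

lemma hit_twisted_product_LF:
  assumes "module_algebra hit pr"
  shows "hit x (twisted_product hit pr m n)
    = (\<Sum>x1 x2:cop LF x. twisted_product hit pr (hit x1 m) (hit x2 n))"
  unfolding hit_twisted_product[OF assms] cop_LF[OF bal_module_algebra[OF assms], symmetric]
  by (simp add: twisted_product_def module_algebraD(3)[OF assms])

text \<open>
  The cocycle identity, evaluated at the form \<open>(x m)(y n)(z k)\<close>.
\<close>

lemma twisted_product_assoc:
  assumes "module_algebra hit pr"
  shows "twisted_product hit pr (twisted_product hit pr m n) k
    = twisted_product hit pr m (twisted_product hit pr n k)"
proof -
  note [simp] = module_algebraD[OF assms] module_algebra_psum[OF assms]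
  have "bal3 (\<lambda>x y z. pr (pr (hit x m) (hit y n)) (hit z k))"
    by (rule form3I) simp_all
  from F_cocycle[OF this] show ?thesis
    unfolding twisted_product_def[of _ _ "twisted_product hit pr m n" k]
      twisted_product_def[of _ _ m "twisted_product hit pr n k"]
    by (simp add: hit_twisted_product[OF assms] del: module_algebraD(8)[OF assms])
qed

end

section \<open>The twisted product on the dual\<close>

locale twisted_pairing = hopf_pairing B Lam H br + Lam: cocycle_twist B Lam F
  for B :: "('k::field, 'b::ab_group_add) algebra"
    and Lam :: "('k, 'b, 'l::ab_group_add) bialgebroid"
    and H :: "('k, 'b, 'h::ab_group_add) bialgebroid"
    and br :: "'l \<Rightarrow> 'h \<Rightarrow> 'b"
    and F :: "('l \<times> 'l) multiset"
begin

text \<open>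
  The products twisted by the first action, by the second, and by both. The second action is one on the
  opposite algebra, hence the exchanged arguments.
\<close>

definition star1 where "star1 = Lam.twisted_product (\<rhd>) (\<odot>)"
definition star2 where "star2 X Y = Lam.twisted_product (\<unrhd>) (\<lambda>Y X. X \<odot> Y) Y X"
definition star (infixl "\<star>" 70) where "X \<star> Y = Lam.twisted_product (\<unrhd>) (\<lambda>Y X. star1 X Y) Y X"

lemma star1_eq: "star1 X Y = (\<Sum>p q:F. (p \<rhd> X) \<odot> (q \<rhd> Y))"
  by (simp add: star1_def Lam.twisted_product_def)

lemma star2_eq: "star2 X Y = (\<Sum>p q:F. (q \<unrhd> X) \<odot> (p \<unrhd> Y))"
  by (simp add: star2_def Lam.twisted_product_def)

lemma star_eq1: "X \<star> Y = (\<Sum>p q:F. star1 (q \<unrhd> X) (p \<unrhd> Y))"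
  by (simp add: star_def Lam.twisted_product_def)

text \<open>
  The two twists may be carried out in either order.
\<close>

lemma star_eq2: "X \<star> Y = (\<Sum>p q:F. star2 (p \<rhd> X) (q \<rhd> Y))"
  unfolding star_eq1 star1_eq star2_eq by (subst psum_swap) (simp add: lhit_rhit)

lemma ma_lhit: "Lam.module_algebra (\<rhd>) (\<odot>)"
  unfolding Lam.module_algebra_def by (simp add: lhit_mult lhit_prod)

lemma ma_rhit: "Lam.module_algebra (\<unrhd>) (\<lambda>Y X. X \<odot> Y)"
  unfolding Lam.module_algebra_def by (simp add: rhit_mult rhit_prod)

lemma star1_add [simp]: "star1 (X + X') Y = star1 X Y + star1 X' Y" "star1 X (Y + Y') = star1 X Y + star1 X Y'"
  and star2_add [simp]: "star2 (X + X') Y = star2 X Y + star2 X' Y" "star2 X (Y + Y') = star2 X Y + star2 X Y'"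
  by (simp_all add: star1_eq star2_eq psum_plus)

lemma star1_psum [simp]: "star1 (psum u f) Y = (\<Sum>x y:u. star1 (f x y) Y)"
    "star1 X (psum u f) = (\<Sum>x y:u. star1 X (f x y))"
  by (rule additive_psum[where h = "\<lambda>w. star1 w Y"], simp) (rule additive_psum, simp)

lemma star2_psum [simp]: "star2 (psum u f) Y = (\<Sum>x y:u. star2 (f x y) Y)"
    "star2 X (psum u f) = (\<Sum>x y:u. star2 X (f x y))"
  by (rule additive_psum[where h = "\<lambda>w. star2 w Y"], simp) (rule additive_psum, simp)

lemma star1_tgt: "star1 (tgt H b \<odot> X) Y = tgt H b \<odot> star1 X Y" "star1 X (Y \<odot> tgt H b) = star1 X Y \<odot> tgt H b"
    "star1 (X \<odot> tgt H b) Y = star1 X (tgt H b \<odot> Y)"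
  by (simp_all add: star1_eq lhit_tgt_left lhit_tgt_right)

lemma star2_src: "star2 (src H b \<odot> X) Y = src H b \<odot> star2 X Y" "star2 X (Y \<odot> src H b) = star2 X Y \<odot> src H b"
    "star2 (X \<odot> src H b) Y = star2 X (src H b \<odot> Y)"
  by (simp_all add: star2_eq rhit_src_left rhit_src_right)

lemma star1_rhit: "\<alpha> \<unrhd> star1 X Y = (\<Sum>\<alpha>1 \<alpha>2:cop Lam \<alpha>. star1 (\<alpha>2 \<unrhd> X) (\<alpha>1 \<unrhd> Y))"
  by (simp add: star1_eq rhit_prod lhit_rhit psum_swap[of F])

lemma star2_lhit: "\<alpha> \<rhd> star2 X Y = (\<Sum>\<alpha>1 \<alpha>2:cop Lam \<alpha>. star2 (\<alpha>1 \<rhd> X) (\<alpha>2 \<rhd> Y))"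
  by (simp add: star2_eq lhit_prod lhit_rhit psum_swap[of F])

lemma star1_assoc: "star1 (star1 X Y) Z = star1 X (star1 Y Z)"
  unfolding star1_def by (rule Lam.twisted_product_assoc[OF ma_lhit])

lemma star2_assoc: "star2 (star2 X Y) Z = star2 X (star2 Y Z)"
  unfolding star2_def using Lam.twisted_product_assoc[OF ma_rhit] by simp

lemma ma_rhit_star1: "Lam.module_algebra (\<unrhd>) (\<lambda>Y X. star1 X Y)"
  unfolding Lam.module_algebra_def by (simp add: rhit_mult star1_rhit star1_assoc star1_tgt)

lemma ma_lhit_star2: "Lam.module_algebra (\<rhd>) star2"
  unfolding Lam.module_algebra_def by (simp add: lhit_mult star2_lhit star2_assoc star2_src)

lemma star_def2: "X \<star> Y = Lam.twisted_product (\<rhd>) star2 X Y"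
  by (simp add: star_eq2 Lam.twisted_product_def)

lemma star_assoc: "X \<star> Y \<star> Z = X \<star> (Y \<star> Z)"
  unfolding star_def2 by (rule Lam.twisted_product_assoc[OF ma_lhit_star2])

lemma star_add [simp]: "(X + X') \<star> Y = X \<star> Y + X' \<star> Y" "X \<star> (Y + Y') = X \<star> Y + X \<star> Y'"
  by (simp_all add: star_eq1 psum_plus)

lemma star_psum [simp]: "psum u f \<star> Y = (\<Sum>x y:u. f x y \<star> Y)" "X \<star> psum u f = (\<Sum>x y:u. X \<star> f x y)"
  by (rule additive_psum[where h = "\<lambda>w. w \<star> Y"], simp) (rule additive_psum, simp)

lemma star_smul: "smul H k X \<star> Y = smul H k (X \<star> Y)" "X \<star> smul H k Y = smul H k (X \<star> Y)"
  by (simp_all add: star_eq1 star1_eq H.L.smul_psum)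

lemma rhit_star: "\<alpha> \<unrhd> (X \<star> Y)
    = (\<Sum>\<alpha>1 \<alpha>2:cop Lam \<alpha>. \<Sum>p q:F. star1 (\<alpha>2 \<unrhd> q \<unrhd> X) (\<alpha>1 \<unrhd> p \<unrhd> Y))"
  unfolding star_def Lam.hit_twisted_product[OF ma_rhit_star1] by (simp add: rhit_mult)

lemma lhit_star: "\<alpha> \<rhd> (X \<star> Y)
    = (\<Sum>\<alpha>1 \<alpha>2:cop Lam \<alpha>. \<Sum>p q:F. star2 (\<alpha>1 \<rhd> p \<rhd> X) (\<alpha>2 \<rhd> q \<rhd> Y))"
  unfolding star_def2 Lam.hit_twisted_product[OF ma_lhit_star2] by (simp add: lhit_mult)

lemma lhit_star_LF: "\<alpha> \<rhd> (X \<star> Y) = (\<Sum>\<alpha>1 \<alpha>2:cop Lam.LF \<alpha>. (\<alpha>1 \<rhd> X) \<star> (\<alpha>2 \<rhd> Y))"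
  unfolding star_def2 by (rule Lam.hit_twisted_product_LF[OF ma_lhit_star2])

text \<open>
  One copy of the cocycle meets a base element, on which one of the actions reduces to the counit; so the
  copy disappears by normalization, and the other copy becomes \<open>s\<^sup>F\<close> or \<open>t\<^sup>F\<close>.
\<close>

lemma star_src_left: "src H a \<star> X = Lam.sF a \<rhd> X"
proof -
  have "src H a \<star> X = star1 (src H a) ((\<Sum>p q:F. tgt Lam (cou Lam q) \<bullet> p) \<unrhd> X)"
    by (simp add: star_eq1 rhit_of_src star1_tgt rhit_mult)
  also have "\<dots> = Lam.sF a \<rhd> X"
    unfolding Lam.F_normal_right by (simp add: star1_eq lhit_of_src Lam.sF_eq lhit_mult)
  finally show ?thesis .
qed

lemma star_tgt_left: "tgt H a \<star> X = Lam.tF a \<unrhd> X"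
proof -
  have "tgt H a \<star> X = star2 (tgt H a) ((\<Sum>p q:F. src Lam (cou Lam p) \<bullet> q) \<rhd> X)"
    by (simp add: star_eq2 lhit_of_tgt star2_src lhit_mult)
  also have "\<dots> = Lam.tF a \<unrhd> X"
    unfolding Lam.F_normal_left by (simp add: star2_eq rhit_of_tgt Lam.tF_eq rhit_mult)
  finally show ?thesis .
qed

lemma star_src_right: "X \<star> src H a = Lam.tF a \<rhd> X"
proof -
  have "X \<star> src H a = star1 ((\<Sum>p q:F. src Lam (cou Lam p) \<bullet> q) \<unrhd> X) (src H a)"
    by (simp add: star_eq1 rhit_of_src star1_tgt rhit_mult flip: H.tgt_src)
  also have "\<dots> = Lam.tF a \<rhd> X"
    unfolding Lam.F_normal_left by (simp add: star1_eq lhit_of_src Lam.tF_eq lhit_mult)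
  finally show ?thesis .
qed

lemma star_tgt_right: "X \<star> tgt H a = Lam.sF a \<unrhd> X"
proof -
  have "X \<star> tgt H a = star2 ((\<Sum>p q:F. tgt Lam (cou Lam q) \<bullet> p) \<rhd> X) (tgt H a)"
    by (simp add: star_eq2 lhit_of_tgt star2_src lhit_mult H.tgt_src)
  also have "\<dots> = Lam.sF a \<unrhd> X"
    unfolding Lam.F_normal_right by (simp add: star2_eq rhit_of_tgt Lam.sF_eq rhit_mult)
  finally show ?thesis .
qed

lemma star_one [simp]: "\<one>\<^bsub>H\<^esub> \<star> X = X" "X \<star> \<one>\<^bsub>H\<^esub> = X"
  using star_src_left[of "\<one>\<^bsub>B\<^esub>" X] star_src_right[of X "\<one>\<^bsub>B\<^esub>"] by simp_all

section \<open>The twisted Hopf algebroid\<close>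

definition \<Gamma> where "\<Gamma> X Y = (\<Sum>p q:F. br p (X \<odot> tgt H (br q Y)))"

abbreviation "HG \<equiv> cotwist H \<Gamma>"

lemma \<Gamma>_eq: "\<Gamma> X Y = cou H (star1 X Y)"
proof -
  have "br p (X \<odot> tgt H (br q Y)) = cou H ((p \<rhd> X) \<odot> (q \<rhd> Y))" for p q
    using H.cou_tgt[of "p \<rhd> X" "q \<rhd> Y"] by (simp add: lhit_tgt_right flip: cou_lhit)
  then show ?thesis by (simp add: \<Gamma>_def star1_eq)
qed

text \<open>
  The scalars \<open>\<langle>F\<^sup>i|X\<^sub>1\<rangle>\<close> and \<open>\<langle>F\<^sub>i|Y\<^sub>1\<rangle>\<close> produced by the two actions combine to \<open>\<Gamma>(X\<^sub>1, Y\<^sub>1)\<close>, once the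
  second is moved past \<open>X\<^sub>2\<close> by the Takeuchi condition.
\<close>

lemma \<Gamma>_act:
  assumes add: "\<And>X X' Y. \<theta> (X + X') Y = \<theta> X Y + \<theta> X' Y" "\<And>X Y Y'. \<theta> X (Y + Y') = \<theta> X Y + \<theta> X Y'"
    and src: "\<And>b X Y. \<theta> (src H b \<odot> X) Y = src H b \<odot> \<theta> X Y" "\<And>b X Y. \<theta> (X \<odot> src H b) Y = \<theta> X (src H b \<odot> Y)"
  shows "(\<Sum>X1 X2:cop H X. \<Sum>Y1 Y2:cop H Y. src H (\<Gamma> X1 Y1) \<odot> \<theta> X2 Y2)
    = (\<Sum>p q:F. \<theta> (p \<rhd> X) (q \<rhd> Y))"
proof -
  have ps: "\<theta> (psum u f) Y = (\<Sum>x y:u. \<theta> (f x y) Y)" "\<theta> X (psum u f) = (\<Sum>x y:u. \<theta> X (f x y))"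
    for X Y and f :: "'d \<Rightarrow> 'e \<Rightarrow> 'h" and u
    by (rule additive_psum[where h = "\<lambda>w. \<theta> w Y"], rule add) (rule additive_psum, rule add)
  have b: "H.bal (\<lambda>x z. src H (br p x) \<odot> \<theta> z y)" for p y
    by (rule formI) (simp_all add: add src)
  have "(\<Sum>p q:F. \<theta> (p \<rhd> X) (q \<rhd> Y)) = (\<Sum>p q:F. \<Sum>Y1 Y2:cop H Y. \<Sum>X1 X2:cop H X.
      src H (br p X1) \<odot> \<theta> (X2 \<odot> src H (br q Y1)) Y2)"
    by (simp add: lhit_def ps src psum_swap[of "cop H X" "cop H Y"])
  also have "\<dots> = (\<Sum>p q:F. \<Sum>X1 X2:cop H X. \<Sum>Y1 Y2:cop H Y.
      src H (br p (X1 \<odot> tgt H (br q Y1))) \<odot> \<theta> X2 Y2)"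
    unfolding H.cop_takeuchi_form[OF b, symmetric] by (subst psum_swap) (rule HOL.refl)
  also have "\<dots> = (\<Sum>X1 X2:cop H X. \<Sum>Y1 Y2:cop H Y. src H (\<Gamma> X1 Y1) \<odot> \<theta> X2 Y2)"
    by (simp add: \<Gamma>_def psum_swap[of F])
  finally show ?thesis by simp
qed

lemma star2_\<Gamma>: "(\<Sum>Xp Xm:H.tr X. \<Sum>Yp Ym:H.tr Y. Xp \<odot> (Yp \<odot> tgt H (\<Gamma> Ym Xm))) = star2 X Y"
proof -
  have ob: "H.obal (\<lambda>p' m'. p \<odot> (p' \<odot> tgt H (br \<beta> m')))" for \<beta> p
    by (rule formI) simp_all
  have "star2 X Y = (\<Sum>p q:F. \<Sum>Xp Xm:H.tr X. \<Sum>Yp Ym:H.tr Y.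
      Xp \<odot> (tgt H (br q Xm) \<odot> Yp \<odot> tgt H (br p Ym)))"
    by (simp add: star2_eq rhit_def psum_swap[of "H.tr X" "H.tr Y"])
  also have "\<dots> = (\<Sum>p q:F. \<Sum>Xp Xm:H.tr X. \<Sum>Yp Ym:H.tr Y.
      Xp \<odot> (Yp \<odot> tgt H (br p (Ym \<odot> tgt H (br q Xm)))))"
    unfolding H.tr_tgt[OF ob] ..
  finally show ?thesis by (simp add: \<Gamma>_def psum_swap[of F])
qed

lemma HG_simps [simp]: "smul HG = smul H" "car HG = UNIV" "\<one>\<^bsub>HG\<^esub> = \<one>\<^bsub>H\<^esub>" "src HG = src H" "tgt HG = tgt H"
  by (simp_all add: cotwist_def)

lemma HG_mult [simp]: "X \<cdot>\<^bsub>HG\<^esub> Y = X \<star> Y"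
proof -
  have "X \<cdot>\<^bsub>HG\<^esub> Y = (\<Sum>X1 X2:cop H X. \<Sum>Y1 Y2:cop H Y. \<Sum>Xp Xm:H.tr X2.
      \<Sum>Yp Ym:H.tr Y2. src H (\<Gamma> X1 Y1) \<odot> (Xp \<odot> (Yp \<odot> tgt H (\<Gamma> Ym Xm))))"
    unfolding cotwist_def psum_def[symmetric] by simp
  also have "\<dots> = (\<Sum>X1 X2:cop H X. \<Sum>Y1 Y2:cop H Y. src H (\<Gamma> X1 Y1) \<odot> star2 X2 Y2)"
    by (simp flip: star2_\<Gamma>)
  also have "\<dots> = X \<star> Y"
    unfolding star_eq2 by (rule \<Gamma>_act) (simp_all add: star2_src)
  finally show ?thesis .
qed

lemma HG_algebra: "unital_algebra HG"
proof (rule unital_algebra.intro)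
  show "vector_space (smul HG)" "car HG = UNIV" using H.L.vspace by simp_all
  show "Vector_Spaces.linear (smul HG) (smul HG) (\<lambda>x. x \<cdot>\<^bsub>HG\<^esub> y)"
       "Vector_Spaces.linear (smul HG) (smul HG) (\<lambda>x. y \<cdot>\<^bsub>HG\<^esub> x)" for y
    using H.L.vspace by (simp_all add: Vector_Spaces.linear_iff star_smul)
qed (simp_all add: star_assoc)

abbreviation "hit_F \<phi> \<equiv> (\<lambda>X Y. \<Sum>p q:F. \<phi> (p \<unrhd> X) (q \<rhd> Y))"

text \<open>
  So \<open>\<Gamma>\<^sup>#\<close> is the action of \<open>F\<close> on the Hopf algebroid with \<open>\<unrhd>\<close> tensored with itself with \<open>\<rhd>\<close>. In the
  same way as for \<open>\<Lambda>\<^sup>F\<close>, \<open>G\<close> provides its inverse, and equality over the twisted base can be tested after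
  \<open>\<Gamma>\<^sup>#\<close> (\<open>HG_eqI\<close>).
\<close>

lemma psum_Gamma_sharp:
  assumes "H.bal \<phi>"
  shows "psum (Gamma_sharp H \<Gamma> u) \<phi> = psum u (hit_F \<phi>)"
proof -
  note \<phi> = form_simps[OF assms]
  have ob: "H.obal (\<lambda>p m. \<phi> (p \<odot> tgt H (br \<beta> m)) w)" for \<beta> w
    by (rule formI) (simp_all add: \<phi>)
  have "\<phi> (p \<unrhd> X) (q \<rhd> Y) = (\<Sum>Y1 Y2:cop H Y. \<Sum>Xp Xm:H.tr X.
      \<phi> (tgt H (br q Y1) \<odot> Xp \<odot> tgt H (br p Xm)) Y2)" for p q X Y
    by (simp add: lhit_def rhit_def \<phi>)
  then have 1: "\<phi> (p \<unrhd> X) (q \<rhd> Y) = (\<Sum>Xp Xm:H.tr X. \<Sum>Y1 Y2:cop H Y.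
      \<phi> (Xp \<odot> tgt H (br p (Xm \<odot> tgt H (br q Y1)))) Y2)" for p q X Y
    unfolding H.tr_tgt[OF ob] by (simp add: psum_swap[of "H.tr X" "cop H Y"])
  show ?thesis
    unfolding 1 Gamma_sharp_def psum_def[symmetric]
    by (simp add: psum_psum \<Gamma>_def \<phi> psum_swap[of F])
qed

abbreviation "Gbal \<equiv> form (\<lambda>b X. Lam.tF b \<unrhd> X) (\<lambda>b Y. Lam.sF b \<rhd> Y)"

lemma bal_hits:
  assumes "H.bal \<phi>"
  shows "Lam.bal (\<lambda>x y. \<phi> (x \<unrhd> X) (y \<rhd> Y))"
  by (rule formI) (simp_all add: form_simps[OF assms] lhit_mult rhit_mult)

lemma Gbal_hits:
  assumes "Gbal \<phi>"
  shows "Lam.Fbal (\<lambda>x y. \<phi> (x \<unrhd> X) (y \<rhd> Y))"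
  by (rule formI) (simp_all add: form_simps[OF assms] lhit_mult rhit_mult)

lemma bal_Gbal:
  assumes "Gbal \<psi>"
  shows "H.bal (\<lambda>X Y. \<Sum>g h:Lam.G. \<psi> (g \<unrhd> X) (h \<rhd> Y))"
proof (rule formI)
  fix b X Y
  show "(\<Sum>g h:Lam.G. \<psi> (g \<unrhd> (tgt H b \<odot> X)) (h \<rhd> Y)) = (\<Sum>g h:Lam.G. \<psi> (g \<unrhd> X) (h \<rhd> (src H b \<odot> Y)))"
    using Lam.G_balance[OF Gbal_hits[OF assms, of X Y], of b "\<one>\<^bsub>Lam\<^esub>" "\<one>\<^bsub>Lam\<^esub>"]
    by (simp add: lhit_mult rhit_mult)
qed (simp_all add: form_simps[OF assms] psum_plus)

lemma GF_hits:
  assumes "Gbal \<psi>"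
  shows "(\<Sum>p q:F. \<Sum>g h:Lam.G. \<psi> (g \<unrhd> p \<unrhd> X) (h \<rhd> q \<rhd> Y)) = \<psi> X Y"
  using Lam.GF_act[OF Gbal_hits[OF assms, of X Y], of "\<one>\<^bsub>Lam\<^esub>" "\<one>\<^bsub>Lam\<^esub>"]
  by (simp add: lhit_mult rhit_mult)

lemma FG_hits:
  assumes "H.bal \<phi>"
  shows "(\<Sum>g h:Lam.G. \<Sum>p q:F. \<phi> (p \<unrhd> g \<unrhd> X) (q \<rhd> h \<rhd> Y)) = \<phi> X Y"
  using Lam.FG_act[OF bal_hits[OF assms, of X Y], of "\<one>\<^bsub>Lam\<^esub>" "\<one>\<^bsub>Lam\<^esub>"]
  by (simp add: lhit_mult rhit_mult)

lemma HG_eqI: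
  assumes eq: "\<And>\<phi> :: 'h \<Rightarrow> 'h \<Rightarrow> 'k. H.bal \<phi> \<Longrightarrow> psum u (hit_F \<phi>)
      = psum v (hit_F \<phi>)"
  shows "diamond_eq HG u v"
  unfolding diamond_eq_def HG_simps HG_mult star_src_left star_tgt_left
proof (rule tensor2_eq_formI)
  fix \<psi> :: "'h \<Rightarrow> 'h \<Rightarrow> 'k" assume \<psi>: "Gbal \<psi>"
  show "psum u \<psi> = psum v \<psi>"
    using eq[OF bal_Gbal[OF \<psi>]] unfolding GF_hits[OF \<psi>] by simp
qed (use H.L.vspace in simp_all)

lemma cop_HG:
  assumes "H.bal \<phi>"
  shows "psum (cop HG X) (hit_F \<phi>) = psum (cop H X) \<phi>"
proof -
  let ?u = "(\<Sum>X1 X2:cop H X. \<Sum>g h:Lam.G. {#(g \<unrhd> X1, h \<rhd> X2)#})"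
  have "diamond_eq H (Gamma_sharp H \<Gamma> ?u) (cop H X)"
  proof (rule H.diamond_eqI)
    fix \<phi> :: "'h \<Rightarrow> 'h \<Rightarrow> 'k" assume \<phi>: "H.bal \<phi>"
    show "psum (Gamma_sharp H \<Gamma> ?u) \<phi> = psum (cop H X) \<phi>"
      by (simp add: psum_Gamma_sharp[OF \<phi>] psum_psum FG_hits[OF \<phi>])
  qed
  then have "diamond_eq H (Gamma_sharp H \<Gamma> (cop HG X)) (cop H X)"
    using someI[of "\<lambda>u. diamond_eq H (Gamma_sharp H \<Gamma> u) (cop H X)" ?u] by (simp add: cotwist_def)
  from H.diamond_eq_form[OF this assms] show ?thesis
    by (simp add: psum_Gamma_sharp[OF assms])
qed

lemma cop_HG_Gbal:
  assumes "Gbal \<psi>"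
  shows "psum (cop HG X) \<psi> = (\<Sum>X1 X2:cop H X. \<Sum>g h:Lam.G. \<psi> (g \<unrhd> X1) (h \<rhd> X2))"
  using cop_HG[OF bal_Gbal[OF assms], of X] by (simp add: GF_hits[OF assms])

lemma psum_swap22:
  "(\<Sum>a b:u. \<Sum>c d:v. \<Sum>e f:w. \<Sum>g h:z. t a b c d e f g h)
   = (\<Sum>e f:w. \<Sum>g h:z. \<Sum>a b:u. \<Sum>c d:v. t a b c d e f g h)"
  by (simp only: psum_swap[of v w] psum_swap[of v z]) (simp only: psum_swap[of u w] psum_swap[of u z])

lemma bal_hits_cop:
  assumes "H.bal \<phi>"
  shows "H.bal (\<lambda>X Y. \<Sum>\<alpha>1 \<alpha>2:cop Lam \<alpha>. \<phi> (\<alpha>1 \<unrhd> X) (\<alpha>2 \<rhd> Y))"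
proof (rule formI)
  fix b X Y
  show "(\<Sum>\<alpha>1 \<alpha>2:cop Lam \<alpha>. \<phi> (\<alpha>1 \<unrhd> (tgt H b \<odot> X)) (\<alpha>2 \<rhd> Y))
      = (\<Sum>\<alpha>1 \<alpha>2:cop Lam \<alpha>. \<phi> (\<alpha>1 \<unrhd> X) (\<alpha>2 \<rhd> (src H b \<odot> Y)))"
    using Lam.cop_takeuchi_form[OF bal_hits[OF assms, of X Y], of \<alpha> b] by (simp add: lhit_mult rhit_mult)
qed (simp_all add: form_simps[OF assms] psum_plus)

lemma cou_HG: "cou HG X = (\<Sum>p q:F. cou H (p \<rhd> q \<unrhd> X))"
proof -
  have "cou HG X = (\<Sum>Xp Xm:H.tr X. \<Gamma> Xp Xm)"
    by (simp add: cotwist_def psum_def)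
  also have "\<dots> = (\<Sum>p q:F. cou H (p \<rhd> q \<unrhd> X))"
    unfolding \<Gamma>_def cou_lhit rhit_def by (subst psum_swap) simp
  finally show ?thesis .
qed

lemma bal_cou_hits: "Lam.bal (\<lambda>x y. cou H (x \<rhd> y \<unrhd> X))"
  by (rule formI) (simp_all add: lhit_mult rhit_mult lhit_tgt_right H.cou_tgt_right)

lemma cou_HG_add [simp]: "cou HG (X + Y) = cou HG X + cou HG Y"
  by (simp add: cou_HG psum_plus)

lemma cou_HG_psum [simp]: "cou HG (psum u f) = (\<Sum>x y:u. cou HG (f x y))"
  by (rule additive_psum) simp

lemma cou_HG_smul [simp]: "cou HG (smul H k X) = smul B k (cou HG X)"
  by (simp add: cou_HG Lam.B.smul_psum)

lemma hits_mult: "(\<alpha> \<bullet> p) \<rhd> (\<beta> \<bullet> q) \<unrhd> X = \<alpha> \<rhd> \<beta> \<unrhd> p \<rhd> q \<unrhd> X"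
  by (simp add: lhit_mult rhit_mult lhit_rhit)

lemma cou_HG_act: "(\<Sum>p q:F. \<Sum>\<alpha>1 \<alpha>2:cop Lam \<alpha>. cou H ((\<alpha>1 \<bullet> p) \<rhd> (\<alpha>2 \<bullet> q) \<unrhd> X))
    = cou Lam (\<alpha> \<bullet> src Lam (cou HG X))"
  unfolding hits_mult cou_lhit_rhit by (simp add: cou_HG)

text \<open>
  By \<open>cop_sF_tF\<close> the elements \<open>s\<^sup>F(a)\<close> and \<open>t\<^sup>F(b)\<close> behind \<open>F\<close> turn into a coproduct in front of it, which
  \<open>cou_HG_act\<close> evaluates.
\<close>

lemma cou_HG_sF_tF: "cou HG (Lam.sF a \<rhd> Lam.tF b \<unrhd> X) = a \<cdot>\<^bsub>Lam.BF\<^esub> (cou HG X \<cdot>\<^bsub>Lam.BF\<^esub> b)"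
proof -
  have "cou HG (Lam.sF a \<rhd> Lam.tF b \<unrhd> X)
      = (\<Sum>p q:F. cou H ((p \<bullet> Lam.sF a) \<rhd> (q \<bullet> Lam.tF b) \<unrhd> X))"
    unfolding hits_mult by (simp add: cou_HG)
  also have "\<dots> = (\<Sum>p q:F. \<Sum>x1 x2:cop Lam (Lam.sF a \<bullet> Lam.tF b). cou H ((x1 \<bullet> p) \<rhd> (x2 \<bullet> q) \<unrhd> X))"
    unfolding Lam.cop_sF_tF[OF bal_cou_hits, symmetric] by (rule psum_swap)
  also have "\<dots> = cou Lam (Lam.sF a \<bullet> Lam.tF b \<bullet> src Lam (cou HG X))"
    by (rule cou_HG_act)
  finally show ?thesis by (simp add: Lam.cou_sF_mult Lam.cou_tF_mult)
qed

lemma BF_one [simp]: "\<one>\<^bsub>B\<^esub> \<cdot>\<^bsub>Lam.BF\<^esub> a = a" "a \<cdot>\<^bsub>Lam.BF\<^esub> \<one>\<^bsub>B\<^esub> = a"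
  using unital_algebra.one_left[OF Lam.BF_algebra, of a] unital_algebra.one_right[OF Lam.BF_algebra, of a] by simp_all

lemma cou_HG_sF [simp]: "cou HG (Lam.sF a \<rhd> X) = a \<cdot>\<^bsub>Lam.BF\<^esub> cou HG X"
  using cou_HG_sF_tF[of a "\<one>\<^bsub>B\<^esub>" X] by simp

lemma cou_HG_tF [simp]: "cou HG (Lam.tF b \<unrhd> X) = cou HG X \<cdot>\<^bsub>Lam.BF\<^esub> b"
  using cou_HG_sF_tF[of "\<one>\<^bsub>B\<^esub>" b X] by simp

lemma cou_HG_tF_lhit: "cou HG (Lam.tF b \<rhd> X) = cou HG (Lam.sF b \<unrhd> X)"
  using Lam.F_balance[OF bal_cou_hits, of b X] unfolding cou_HG
  by (simp add: lhit_mult rhit_mult lhit_rhit)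

lemma cou_HG_unit [simp]: "cou HG \<one>\<^bsub>H\<^esub> = \<one>\<^bsub>B\<^esub>"
  using Lam.BF_mult[of "\<one>\<^bsub>B\<^esub>" "\<one>\<^bsub>B\<^esub>"]
  by (simp add: cou_HG rhit_unit lhit_of_tgt)

lemma cou_HG_src [simp]: "cou HG (src H c) = c"
  using cou_HG_sF[of c "\<one>\<^bsub>H\<^esub>"] by (simp add: lhit_unit)

lemma cou_HG_tgt [simp]: "cou HG (tgt H c) = c"
  using cou_HG_tF[of c "\<one>\<^bsub>H\<^esub>"] by (simp add: rhit_unit)

text \<open>
  In \<open>\<epsilon>\<^sup>\<Gamma>(X \<star> Y)\<close> the factors acting on \<open>X\<close> are the outer ones of \<open>F_cocycle4\<close> and those acting on \<open>Y\<close> are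
  the middle ones; the latter contribute only \<open>\<epsilon>\<^sup>\<Gamma>(Y)\<close>.
\<close>

lemma cou_HG_star_cong:
  assumes "cou HG Y = cou HG Y'"
  shows "cou HG (X \<star> Y) = cou HG (X \<star> Y')"
proof -
  have b12: "Lam.bal (\<lambda>w x. cou H ((w \<rhd> z \<unrhd> X) \<odot> (x \<rhd> y \<unrhd> Y)))" for y z Y
    by (rule formI) (simp_all add: lhit_mult)
  have b23: "Lam.bal (\<lambda>x y. cou H (W \<odot> (x \<rhd> y \<unrhd> Y)))" for W Y
  proof (rule formI)
    fix b x y
    show "cou H (W \<odot> ((tgt Lam b \<bullet> x) \<rhd> y \<unrhd> Y)) = cou H (W \<odot> (x \<rhd> (src Lam b \<bullet> y) \<unrhd> Y))"
      using H.cou_tgt_right[of "W \<odot> (x \<rhd> y \<unrhd> Y)" b] by (simp add: lhit_mult rhit_mult lhit_tgt_right)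
  qed simp_all
  have b34: "Lam.bal (\<lambda>y z. cou H ((w \<rhd> z \<unrhd> X) \<odot> (x \<rhd> y \<unrhd> Y)))" for w x Y
    by (rule formI) (simp_all add: rhit_mult lhit_tgt_left lhit_tgt_right)
  have inner: "(\<Sum>y1 y2:cop Lam \<alpha>. \<Sum>p'' q'':F. cou H (W \<odot> ((y1 \<bullet> p'') \<rhd> (y2 \<bullet> q'') \<unrhd> Y)))
        = cou H (W \<odot> src H (cou Lam (\<alpha> \<bullet> src Lam (cou HG Y))))" for \<alpha> W Y
    proof -
      have "(\<Sum>y1 y2:cop Lam \<alpha>. \<Sum>p'' q'':F. cou H (W \<odot> ((y1 \<bullet> p'') \<rhd> (y2 \<bullet> q'') \<unrhd> Y)))
        = (\<Sum>y1 y2:cop Lam \<alpha>. \<Sum>p'' q'':F. cou H (W \<odot> src H (cou H ((y1 \<bullet> p'') \<rhd> (y2 \<bullet> q'') \<unrhd> Y))))"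
        by (simp only: H.cou_src)
      also have "\<dots> = cou H (W \<odot> src H (\<Sum>p'' q'':F. \<Sum>y1 y2:cop Lam \<alpha>. cou H ((y1 \<bullet> p'') \<rhd> (y2 \<bullet> q'') \<unrhd> Y)))"
        by (simp add: psum_swap[of F "cop Lam \<alpha>"])
      finally show ?thesis unfolding cou_HG_act .
    qed
  have *: "cou HG (X \<star> Y) = (\<Sum>p q:F. \<Sum>q1 q2:cop Lam q. \<Sum>p' q':F.
        cou H ((p \<rhd> (q2 \<bullet> q') \<unrhd> X) \<odot> src H (cou Lam (q1 \<bullet> p' \<bullet> src Lam (cou HG Y)))))" for Y
  proof -
    have "cou HG (X \<star> Y) = (\<Sum>p q:F. \<Sum>p1 p2:cop Lam p. \<Sum>p' q':F. \<Sum>q1 q2:cop Lam q. \<Sum>p'' q'':F.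
        cou H (((p1 \<bullet> p') \<rhd> (q2 \<bullet> q'') \<unrhd> X) \<odot> ((p2 \<bullet> q') \<rhd> (q1 \<bullet> p'') \<unrhd> Y)))"
    proof -
      have "cou HG (X \<star> Y) = (\<Sum>p q:F. \<Sum>q1 q2:cop Lam q. \<Sum>p'' q'':F. \<Sum>p1 p2:cop Lam p. \<Sum>p' q':F.
        cou H (((p1 \<bullet> p') \<rhd> (q2 \<bullet> q'') \<unrhd> X) \<odot> ((p2 \<bullet> q') \<rhd> (q1 \<bullet> p'') \<unrhd> Y)))"
        unfolding cou_HG rhit_star
        by (simp add: star1_def Lam.hit_twisted_product[OF ma_lhit] rhit_mult)
      also have "\<dots> = (\<Sum>p q:F. \<Sum>p1 p2:cop Lam p. \<Sum>p' q':F. \<Sum>q1 q2:cop Lam q. \<Sum>p'' q'':F.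
        cou H (((p1 \<bullet> p') \<rhd> (q2 \<bullet> q'') \<unrhd> X) \<odot> ((p2 \<bullet> q') \<rhd> (q1 \<bullet> p'') \<unrhd> Y)))"
        by (rule psum_cong[OF HOL.refl]) (rule psum_swap22)
      finally show ?thesis .
    qed
    also have "\<dots> = (\<Sum>p q:F. \<Sum>q1 q2:cop Lam q. \<Sum>p' q':F. \<Sum>y1 y2:cop Lam (q1 \<bullet> p'). \<Sum>p'' q'':F.
        cou H ((p \<rhd> (q2 \<bullet> q') \<unrhd> X) \<odot> ((y1 \<bullet> p'') \<rhd> (y2 \<bullet> q'') \<unrhd> Y)))"
      by (rule Lam.F_cocycle4[OF b12 b23 b34])
    finally show ?thesis unfolding inner .
  qed
  show ?thesis unfolding * assms ..
qed

section \<open>The twisted dual is a bialgebroid\<close>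

lemma HG_cop_add: "diamond_eq HG (cop HG (X + Y)) (cop HG X + cop HG Y)"
proof (rule HG_eqI)
  fix \<phi> :: "'h \<Rightarrow> 'h \<Rightarrow> 'k" assume \<phi>: "H.bal \<phi>"
  show "psum (cop HG (X + Y)) (hit_F \<phi>)
    = psum (cop HG X + cop HG Y) (hit_F \<phi>)"
    by (simp add: cop_HG[OF \<phi>] H.cop_add_form[OF \<phi>])
qed

lemma HG_cop_smul: "diamond_eq HG (cop HG (smul H k X)) (\<Sum>X1 X2:cop HG X. {#(smul H k X1, X2)#})"
proof (rule HG_eqI)
  fix \<phi> :: "'h \<Rightarrow> 'h \<Rightarrow> 'k" assume \<phi>: "H.bal \<phi>"
  have 1: "H.bal (\<lambda>x y. \<phi> (smul H k x) y)"
    by (rule formI) (simp_all add: form_simps[OF \<phi>] flip: H.L.mult_smul_right)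
  show "psum (cop HG (smul H k X)) (hit_F \<phi>)
    = psum (\<Sum>X1 X2:cop HG X. {#(smul H k X1, X2)#}) (hit_F \<phi>)"
    using H.diamond_eq_form[OF H.cop_smul[where k = k and X = X, folded psum_def] \<phi>]
    by (simp add: cop_HG[OF \<phi>] cop_HG[OF 1] psum_psum)
qed

lemma HG_cop_bimodule: "diamond_eq HG (cop HG (src H a \<star> tgt H b \<star> X))
    (\<Sum>X1 X2:cop HG X. {#(src H a \<star> X1, tgt H b \<star> X2)#})"
  unfolding star_assoc unfolding star_src_left star_tgt_left
proof (rule HG_eqI)
  fix \<phi> :: "'h \<Rightarrow> 'h \<Rightarrow> 'k" assume \<phi>: "H.bal \<phi>"
  have 1: "H.bal (\<lambda>X Y. \<phi> (Lam.sF a \<rhd> X) (Lam.tF b \<unrhd> Y))"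
    by (rule formI) (simp_all add: form_simps[OF \<phi>] lhit_tgt_left rhit_src_left)
  have 2: "H.bal (\<lambda>X Y. \<phi> (Lam.sF a \<rhd> X) Y)"
    by (rule formI) (simp_all add: form_simps[OF \<phi>] lhit_tgt_left)
  show "psum (cop HG (Lam.sF a \<rhd> Lam.tF b \<unrhd> X)) (hit_F \<phi>)
    = psum (\<Sum>X1 X2:cop HG X. {#(Lam.sF a \<rhd> X1, Lam.tF b \<unrhd> X2)#})
        (hit_F \<phi>)"
    using cop_HG[OF 1, of X]
    unfolding cop_HG[OF \<phi>] cop_lhit[OF \<phi>] cop_rhit[OF 2] by (simp add: psum_psum lhit_rhit)
qed

lemma HG_cop_takeuchi: "diamond_eq HG (\<Sum>X1 X2:cop HG X. {#(X1 \<star> tgt H b, X2)#})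
    (\<Sum>X1 X2:cop HG X. {#(X1, X2 \<star> src H b)#})"
  unfolding star_src_right star_tgt_right
proof (rule HG_eqI)
  fix \<phi> :: "'h \<Rightarrow> 'h \<Rightarrow> 'k" assume \<phi>: "H.bal \<phi>"
  have link': "(\<Sum>X1 X2:cop HG X. \<Sum>p q:F. \<Sum>x1 x2:cop Lam \<alpha>. \<phi> (x1 \<unrhd> p \<unrhd> X1) (x2 \<rhd> q \<rhd> X2))
     = (\<Sum>X1 X2:cop H X. \<phi> (X1 \<odot> tgt H (cou Lam \<alpha>)) X2)" for \<alpha>
    unfolding cop_HG[OF bal_hits_cop[OF \<phi>]] by (subst psum_swap) (rule link[OF \<phi>])
  have "(\<Sum>X1 X2:cop HG X. \<Sum>p q:F. \<phi> (p \<unrhd> Lam.sF b \<unrhd> X1) (q \<rhd> X2))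
     = (\<Sum>X1 X2:cop H X. \<phi> (X1 \<odot> tgt H b) X2)"
    using link'[of "Lam.sF b"] Lam.cop_sF[OF bal_hits[OF \<phi>], of b]
    by (simp add: lhit_mult rhit_mult psum_swap[of F "cop Lam (Lam.sF b)"])
  moreover have "(\<Sum>X1 X2:cop HG X. \<Sum>p q:F. \<phi> (p \<unrhd> X1) (q \<rhd> Lam.tF b \<rhd> X2))
     = (\<Sum>X1 X2:cop H X. \<phi> (X1 \<odot> tgt H b) X2)"
    using link'[of "Lam.tF b"] Lam.cop_tF[OF bal_hits[OF \<phi>], of b]
    by (simp add: lhit_mult rhit_mult psum_swap[of F "cop Lam (Lam.tF b)"])
  ultimately show "psum (\<Sum>X1 X2:cop HG X. {#(Lam.sF b \<unrhd> X1, X2)#}) (hit_F \<phi>)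
    = psum (\<Sum>X1 X2:cop HG X. {#(X1, Lam.tF b \<rhd> X2)#}) (hit_F \<phi>)"
    by (simp add: psum_psum)
qed

lemma HG_cop_one: "diamond_eq HG (cop HG \<one>\<^bsub>H\<^esub>) {#(\<one>\<^bsub>H\<^esub>, \<one>\<^bsub>H\<^esub>)#}"
proof (rule HG_eqI)
  fix \<phi> :: "'h \<Rightarrow> 'h \<Rightarrow> 'k" assume \<phi>: "H.bal \<phi>"
  have 1: "\<phi> (tgt H a) (src H c) = \<phi> (tgt H (a \<cdot>\<^bsub>B\<^esub> c)) \<one>\<^bsub>H\<^esub>" for a c
    using form_simps(3)[OF \<phi>, of c "tgt H a" "\<one>\<^bsub>H\<^esub>"] by simp
  have "(\<Sum>p q:F. \<phi> (tgt H (cou Lam p)) (src H (cou Lam q)))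
     = \<phi> (tgt H (\<Sum>p q:F. cou Lam p \<cdot>\<^bsub>B\<^esub> cou Lam q)) \<one>\<^bsub>H\<^esub>"
    unfolding 1 by (simp add: form_simps[OF \<phi>])
  also have "(\<Sum>p q:F. cou Lam p \<cdot>\<^bsub>B\<^esub> cou Lam q) = \<one>\<^bsub>B\<^esub>"
    using Lam.BF_mult[of "\<one>\<^bsub>B\<^esub>" "\<one>\<^bsub>B\<^esub>"] by simp
  finally show "psum (cop HG \<one>\<^bsub>H\<^esub>) (hit_F \<phi>)
    = psum {#(\<one>\<^bsub>H\<^esub>, \<one>\<^bsub>H\<^esub>)#} (hit_F \<phi>)"
    by (simp add: cop_HG[OF \<phi>] H.cop_one_form[OF \<phi>] lhit_unit rhit_unit)
qed

lemma sF_eq_hit: "Lam.sF c \<rhd> Z = (\<Sum>p q:F. src H (cou Lam (p \<bullet> src Lam c)) \<odot> (q \<rhd> Z))"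
  by (simp add: Lam.sF_eq lhit_mult)

lemma tF_eq_hit: "Lam.tF c \<unrhd> Z = (\<Sum>p q:F. tgt H (cou Lam (q \<bullet> src Lam c)) \<odot> (p \<unrhd> Z))"
  by (simp add: Lam.tF_eq rhit_mult)

text \<open>
  Here \<open>\<epsilon>\<^sup>\<Gamma>\<close> contributes a copy of \<open>F\<close>, and so does \<open>s\<^sup>F\<close>. The cocycle identity makes one of them act on
  \<open>X\<^sub>(\<^sub>1\<^sub>) \<diamond> X\<^sub>(\<^sub>2\<^sub>)\<close> last, where it turns the twisted coproduct back into \<open>\<Delta> X\<close>; then \<open>link\<close> removes the
  remaining coproduct, and normalization the remaining copy. The other counit axiom is the mirror image.
\<close>

lemma HG_counit_left: "(\<Sum>X1 X2:cop HG X. src H (cou HG X1) \<star> X2) = X"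
proof -
  have b0: "H.bal (\<lambda>u v. src H (cou H (p \<rhd> u)) \<odot> v)" for p
    by (rule formI) (simp_all add: lhit_tgt_left)
  have b3: "Lam.bal3 (\<lambda>x y z. src H (cou H (x \<rhd> y \<unrhd> Y)) \<odot> (z \<rhd> Z))" for Y Z
    by (rule form3I) (simp_all add: lhit_mult rhit_mult lhit_tgt_left lhit_tgt_right H.cou_tgt_right)
  have "src H (cou HG Y) \<star> Z = (\<Sum>p q:F. \<Sum>q1 q2:cop Lam q. \<Sum>p' q':F.
      src H (cou H (p \<rhd> q1 \<unrhd> p' \<unrhd> Y)) \<odot> (q2 \<rhd> q' \<rhd> Z))" for Y Z
  proof -
    have "src H (cou HG Y) \<star> Z = (\<Sum>p q:F. \<Sum>p1 p2:cop Lam p. \<Sum>p' q':F.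
      src H (cou H ((p1 \<bullet> p') \<rhd> (p2 \<bullet> q') \<unrhd> Y)) \<odot> (q \<rhd> Z))"
      unfolding star_src_left sF_eq_hit cou_HG_act[symmetric]
      by (simp add: psum_swap[of F "cop Lam p" for p])
    also have "\<dots> = (\<Sum>p q:F. \<Sum>q1 q2:cop Lam q. \<Sum>p' q':F.
      src H (cou H (p \<rhd> (q1 \<bullet> p') \<unrhd> Y)) \<odot> ((q2 \<bullet> q') \<rhd> Z))"
      by (rule Lam.F_cocycle[OF b3])
    finally show ?thesis by (simp add: lhit_mult rhit_mult)
  qed
  then have "(\<Sum>X1 X2:cop HG X. src H (cou HG X1) \<star> X2)
     = (\<Sum>X1 X2:cop HG X. \<Sum>p q:F. \<Sum>q1 q2:cop Lam q. \<Sum>p' q':F.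
      src H (cou H (p \<rhd> q1 \<unrhd> p' \<unrhd> X1)) \<odot> (q2 \<rhd> q' \<rhd> X2))"
    by simp
  also have "\<dots> = (\<Sum>p q:F. \<Sum>X1 X2:cop HG X. \<Sum>p' q':F. \<Sum>q1 q2:cop Lam q.
      src H (cou H (p \<rhd> q1 \<unrhd> p' \<unrhd> X1)) \<odot> (q2 \<rhd> q' \<rhd> X2))"
    by (simp only: psum_swap[of "cop HG X" F] psum_swap[of "cop Lam q" F for q])
  also have "\<dots> = (\<Sum>p q:F. \<Sum>q1 q2:cop Lam q. \<Sum>X1 X2:cop H X.
      src H (cou H (p \<rhd> q1 \<unrhd> X1)) \<odot> (q2 \<rhd> X2))"
    unfolding cop_HG[OF bal_hits_cop[OF b0]] by (rule psum_cong[OF HOL.refl]) (rule psum_swap)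
  also have "\<dots> = (\<Sum>p q:F. \<Sum>X1 X2:cop H X. src H (br (tgt Lam (cou Lam q) \<bullet> p) X1) \<odot> X2)"
    unfolding link[OF b0] by (simp add: cou_lhit)
  also have "\<dots> = (\<Sum>p q:F. tgt Lam (cou Lam q) \<bullet> p) \<rhd> X"
    by (simp add: lhit_def psum_swap[of "cop H X" F])
  finally show ?thesis unfolding Lam.F_normal_right by simp
qed

lemma HG_counit_right: "(\<Sum>X1 X2:cop HG X. tgt H (cou HG X2) \<star> X1) = X"
proof -
  have b0: "H.bal (\<lambda>u v. tgt H (cou H (q \<unrhd> v)) \<odot> u)" for q
    by (rule formI) (simp_all add: rhit_src_left)
  have b3: "Lam.bal3 (\<lambda>x y z. tgt H (cou H (y \<rhd> z \<unrhd> Z)) \<odot> (x \<unrhd> Y))" for Y Z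
    by (rule form3I) (simp_all add: lhit_mult rhit_mult lhit_tgt_right H.cou_tgt_right)
  have "tgt H (cou HG Z) \<star> Y = (\<Sum>p q:F. \<Sum>p1 p2:cop Lam p. \<Sum>p' q':F.
      tgt H (cou H (q \<unrhd> p2 \<rhd> q' \<rhd> Z)) \<odot> (p1 \<unrhd> p' \<unrhd> Y))" for Y Z
  proof -
    have "tgt H (cou HG Z) \<star> Y = (\<Sum>p q:F. \<Sum>q1 q2:cop Lam q. \<Sum>p' q':F.
      tgt H (cou H ((q1 \<bullet> p') \<rhd> (q2 \<bullet> q') \<unrhd> Z)) \<odot> (p \<unrhd> Y))"
      unfolding star_tgt_left tF_eq_hit cou_HG_act[symmetric]
      by (simp add: psum_swap[of F "cop Lam p" for p])
    also have "\<dots> = (\<Sum>p q:F. \<Sum>p1 p2:cop Lam p. \<Sum>p' q':F.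
      tgt H (cou H ((p2 \<bullet> q') \<rhd> q \<unrhd> Z)) \<odot> ((p1 \<bullet> p') \<unrhd> Y))"
      by (rule Lam.F_cocycle[OF b3, symmetric])
    finally show ?thesis by (simp add: lhit_mult rhit_mult lhit_rhit)
  qed
  then have "(\<Sum>X1 X2:cop HG X. tgt H (cou HG X2) \<star> X1)
     = (\<Sum>X1 X2:cop HG X. \<Sum>p q:F. \<Sum>p1 p2:cop Lam p. \<Sum>p' q':F.
      tgt H (cou H (q \<unrhd> p2 \<rhd> q' \<rhd> X2)) \<odot> (p1 \<unrhd> p' \<unrhd> X1))"
    by simp
  also have "\<dots> = (\<Sum>p q:F. \<Sum>X1 X2:cop HG X. \<Sum>p' q':F. \<Sum>p1 p2:cop Lam p.
      tgt H (cou H (q \<unrhd> p2 \<rhd> q' \<rhd> X2)) \<odot> (p1 \<unrhd> p' \<unrhd> X1))"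
    by (simp only: psum_swap[of "cop HG X" F] psum_swap[of "cop Lam q" F for q])
  also have "\<dots> = (\<Sum>p q:F. \<Sum>p1 p2:cop Lam p. \<Sum>X1 X2:cop H X.
      tgt H (cou H (q \<unrhd> p2 \<rhd> X2)) \<odot> (p1 \<unrhd> X1))"
    unfolding cop_HG[OF bal_hits_cop[OF b0]] by (rule psum_cong[OF HOL.refl]) (rule psum_swap)
  also have "\<dots> = (\<Sum>p q:F. \<Sum>X1 X2:cop H X. tgt H (cou H ((src Lam (cou Lam p) \<bullet> q) \<unrhd> X2)) \<odot> X1)"
    unfolding link[OF b0] H.cop_takeuchi_form[OF b0]
    by (simp add: rhit_src_right rhit_mult H.cou_tgt_right)
  also have "\<dots> = (\<Sum>X1 X2:cop H X. tgt H (cou H ((\<Sum>p q:F. src Lam (cou Lam p) \<bullet> q) \<unrhd> X2)) \<odot> X1)"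
    by (simp add: psum_swap[of "cop H X" F])
  finally show ?thesis unfolding Lam.F_normal_left by simp
qed

lemma bal_star1_star2:
  assumes "H.bal \<phi>"
  shows "H.bal (\<lambda>X Y. \<phi> (star1 X A) (star2 Y C))"
  by (rule formI) (simp_all add: form_simps[OF assms] star1_tgt star2_src)

lemma bal_star1_star2_cop:
  assumes "H.bal \<phi>"
  shows "H.bal (\<lambda>A C. \<Sum>X1 X2:cop H X. \<phi> (star1 X1 A) (star2 X2 C))"
proof (rule formI)
  fix b A C
  show "(\<Sum>X1 X2:cop H X. \<phi> (star1 X1 (tgt H b \<odot> A)) (star2 X2 C))
      = (\<Sum>X1 X2:cop H X. \<phi> (star1 X1 A) (star2 X2 (src H b \<odot> C)))"
    using H.cop_takeuchi_form[OF bal_star1_star2[OF assms, of A C], of X b]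
    by (simp add: star1_tgt star2_src)
qed (simp_all add: form_simps[OF assms] psum_plus)

text \<open>
  \<open>\<Delta>\<close> sends the first action to the first tensor factor and the second action to the second one, so it
  separates the two twists in \<open>X \<star> Y\<close>.
\<close>

lemma cop_star:
  assumes "H.bal \<phi>"
  shows "psum (cop H (X \<star> Y)) \<phi> = (\<Sum>X1 X2:cop H X. \<Sum>Y1 Y2:cop H Y. \<phi> (star1 X1 Y1) (star2 X2 Y2))"
proof -
  note \<phi> = form_simps[OF assms]
  have b1: "H.bal (\<lambda>X Y. \<phi> ((p \<rhd> X) \<odot> A) ((q \<unrhd> Y) \<odot> C))" for p q A C
    by (rule formI) (simp_all add: \<phi> lhit_tgt_left rhit_src_left)
  have b2: "H.bal (\<lambda>A C. \<Sum>X1 X2:cop H X. \<phi> ((p \<rhd> X1) \<odot> (p' \<rhd> A)) ((q \<unrhd> X2) \<odot> (q' \<unrhd> C)))" for p q p' q' X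
  proof (rule formI)
    fix b A C
    show "(\<Sum>X1 X2:cop H X. \<phi> ((p \<rhd> X1) \<odot> (p' \<rhd> (tgt H b \<odot> A))) ((q \<unrhd> X2) \<odot> (q' \<unrhd> C)))
        = (\<Sum>X1 X2:cop H X. \<phi> ((p \<rhd> X1) \<odot> (p' \<rhd> A)) ((q \<unrhd> X2) \<odot> (q' \<unrhd> (src H b \<odot> C))))"
      using H.cop_takeuchi_form[OF b1[of p "p' \<rhd> A" q "q' \<unrhd> C"], of X b]
      by (simp add: lhit_tgt_left lhit_tgt_right rhit_src_left rhit_src_right)
  qed (simp_all add: \<phi> psum_plus)
  have "psum (cop H ((p \<rhd> q \<unrhd> X) \<odot> (p' \<rhd> q' \<unrhd> Y))) \<phi>
     = (\<Sum>X1 X2:cop H X. \<Sum>Y1 Y2:cop H Y. \<phi> ((p \<rhd> X1) \<odot> (p' \<rhd> Y1)) ((q \<unrhd> X2) \<odot> (q' \<unrhd> Y2)))" for p q p' q'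
  proof -
    have 1: "H.bal (\<lambda>u v. \<Sum>z1 z2:cop H Z. \<phi> (z1 \<odot> u) (z2 \<odot> v))" for Z
      by (rule H.bal_mult_cop[OF assms])
    have 2: "H.bal (\<lambda>u v. \<Sum>z1 z2:cop H Z. \<phi> (z1 \<odot> u) (z2 \<odot> (q' \<unrhd> v)))" for Z
      using b2[of Z "\<one>\<^bsub>Lam\<^esub>" "\<one>\<^bsub>Lam\<^esub>" "\<one>\<^bsub>Lam\<^esub>" q'] by simp
    have 3: "H.bal (\<lambda>u v. \<phi> (u \<odot> A) (v \<odot> C))" for A C
      by (rule H.bal_mult_right[OF assms])
    have 4: "H.bal (\<lambda>u v. \<phi> (u \<odot> A) ((q \<unrhd> v) \<odot> C))" for A C
      using b1[of "\<one>\<^bsub>Lam\<^esub>" A q C] by simp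
    have "psum (cop H ((p \<rhd> q \<unrhd> X) \<odot> (p' \<rhd> q' \<unrhd> Y))) \<phi>
       = (\<Sum>Y1 Y2:cop H Y. \<Sum>z1 z2:cop H (p \<rhd> q \<unrhd> X). \<phi> (z1 \<odot> (p' \<rhd> Y1)) (z2 \<odot> (q' \<unrhd> Y2)))"
      unfolding lhit_rhit[of p']
      by (simp add: H.cop_mult_right_form[OF assms] cop_rhit[OF 1] cop_lhit[OF 2])
    also have "\<dots> = (\<Sum>Y1 Y2:cop H Y. \<Sum>X1 X2:cop H X. \<phi> ((p \<rhd> X1) \<odot> (p' \<rhd> Y1)) ((q \<unrhd> X2) \<odot> (q' \<unrhd> Y2)))"
      unfolding lhit_rhit[of p] by (simp add: cop_rhit[OF 3] cop_lhit[OF 4])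
    finally show ?thesis by (subst psum_swap)
  qed
  then have "psum (cop H (X \<star> Y)) \<phi> = (\<Sum>p q:F. \<Sum>p' q':F. \<Sum>X1 X2:cop H X. \<Sum>Y1 Y2:cop H Y.
      \<phi> ((p' \<rhd> X1) \<odot> (q' \<rhd> Y1)) ((q \<unrhd> X2) \<odot> (p \<unrhd> Y2)))"
    unfolding star_eq1 star1_eq by (simp add: H.cop_psum[OF assms])
  then show ?thesis
    unfolding star1_eq star2_eq by (simp add: \<phi> psum_swap[of "cop H Z" F for Z] psum_swap[of "cop H X" "cop H Y"])
qed

text \<open>
  After acting with \<open>F\<close>, the right-hand side contains \<open>(\<Delta> \<diamond> \<Delta>)(F) (F \<otimes> F)\<close> acting on
  \<open>Y\<^sub>(\<^sub>1\<^sub>), X\<^sub>(\<^sub>1\<^sub>), X\<^sub>(\<^sub>2\<^sub>), Y\<^sub>(\<^sub>2\<^sub>)\<close>. By \<open>F_cocycle4\<close> the middle part first turns the twisted coproduct of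
  \<open>X\<close> into \<open>\<Delta> X\<close> and then disappears by \<open>link\<close>; what is left is a copy of \<open>F\<close> that does the same for \<open>Y\<close>,
  so the result is \<open>cop_star\<close>.
\<close>

lemma HG_cop_mult: "diamond_eq HG (cop HG (X \<star> Y))
    (\<Sum>X1 X2:cop HG X. \<Sum>Y1 Y2:cop HG Y. {#(X1 \<star> Y1, X2 \<star> Y2)#})"
proof (rule HG_eqI)
  fix \<phi> :: "'h \<Rightarrow> 'h \<Rightarrow> 'k" assume \<phi>: "H.bal \<phi>"
  note \<phi>_simps = form_simps[OF \<phi>]
  define \<Psi> where "\<Psi> X1 X2 Y1 Y2 w x y z = \<phi> (star1 (x \<unrhd> X1) (w \<unrhd> Y1)) (star2 (y \<rhd> X2) (z \<rhd> Y2))"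
    for X1 X2 Y1 Y2 w x y z
  have b12: "Lam.bal (\<lambda>w x. \<Psi> X1 X2 Y1 Y2 w x y z)" for X1 X2 Y1 Y2 y z
    by (rule formI) (simp_all add: \<Psi>_def \<phi>_simps lhit_mult rhit_mult star1_tgt)
  have b23: "Lam.bal (\<lambda>x y. \<Psi> X1 X2 Y1 Y2 w x y z)" for X1 X2 Y1 Y2 w z
    by (rule formI) (simp_all add: \<Psi>_def \<phi>_simps lhit_mult rhit_mult star1_tgt star2_src)
  have b34: "Lam.bal (\<lambda>y z. \<Psi> X1 X2 Y1 Y2 w x y z)" for X1 X2 Y1 Y2 w x
    by (rule formI) (simp_all add: \<Psi>_def \<phi>_simps lhit_mult rhit_mult star2_src)
  have expand: "(\<Sum>p q:F. \<phi> (p \<unrhd> (X1 \<star> Y1)) (q \<rhd> (X2 \<star> Y2)))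
    = (\<Sum>p q:F. \<Sum>q1 q2:cop Lam q. \<Sum>p' q':F. \<Sum>y1 y2:cop Lam (q1 \<bullet> p'). \<Sum>p'' q'':F.
        \<phi> (star1 (y1 \<unrhd> p'' \<unrhd> X1) (p \<unrhd> Y1)) (star2 (y2 \<rhd> q'' \<rhd> X2) ((q2 \<bullet> q') \<rhd> Y2)))" for X1 X2 Y1 Y2
  proof -
    have "(\<Sum>p q:F. \<phi> (p \<unrhd> (X1 \<star> Y1)) (q \<rhd> (X2 \<star> Y2)))
      = (\<Sum>p q:F. \<Sum>q1 q2:cop Lam q. \<Sum>p'' q'':F. \<Sum>p1 p2:cop Lam p. \<Sum>p' q':F.
          \<Psi> X1 X2 Y1 Y2 (p1 \<bullet> p') (p2 \<bullet> q') (q1 \<bullet> p'') (q2 \<bullet> q''))"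
      unfolding rhit_star lhit_star \<Psi>_def by (simp add: \<phi>_simps rhit_mult lhit_mult)
    also have "\<dots> = (\<Sum>p q:F. \<Sum>p1 p2:cop Lam p. \<Sum>p' q':F. \<Sum>q1 q2:cop Lam q. \<Sum>p'' q'':F.
          \<Psi> X1 X2 Y1 Y2 (p1 \<bullet> p') (p2 \<bullet> q') (q1 \<bullet> p'') (q2 \<bullet> q''))"
      by (rule psum_cong[OF HOL.refl]) (rule psum_swap22)
    also have "\<dots> = (\<Sum>p q:F. \<Sum>q1 q2:cop Lam q. \<Sum>p' q':F. \<Sum>y1 y2:cop Lam (q1 \<bullet> p'). \<Sum>p'' q'':F.
          \<Psi> X1 X2 Y1 Y2 p (y1 \<bullet> p'') (y2 \<bullet> q'') (q2 \<bullet> q'))"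
      by (rule Lam.F_cocycle4[OF b12 b23 b34])
    finally show ?thesis by (simp add: \<Psi>_def rhit_mult lhit_mult)
  qed
  have inner: "(\<Sum>X1 X2:cop HG X. \<Sum>y1 y2:cop Lam \<xi>. \<Sum>p'' q'':F.
        \<phi> (star1 (y1 \<unrhd> p'' \<unrhd> X1) A) (star2 (y2 \<rhd> q'' \<rhd> X2) C))
      = (\<Sum>X1 X2:cop H X. \<phi> (star1 X1 (tgt H (cou Lam \<xi>) \<odot> A)) (star2 X2 C))" for \<xi> A C
  proof -
    have "(\<Sum>X1 X2:cop HG X. \<Sum>p'' q'':F. \<Sum>y1 y2:cop Lam \<xi>.
        \<phi> (star1 (y1 \<unrhd> p'' \<unrhd> X1) A) (star2 (y2 \<rhd> q'' \<rhd> X2) C))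
      = (\<Sum>X1 X2:cop H X. \<phi> (star1 (X1 \<odot> tgt H (cou Lam \<xi>)) A) (star2 X2 C))"
      unfolding cop_HG[OF bal_hits_cop[OF bal_star1_star2[OF \<phi>]]]
      by (subst psum_swap) (rule link[OF bal_star1_star2[OF \<phi>]])
    then show ?thesis by (simp add: star1_tgt psum_swap[of F "cop Lam \<xi>"])
  qed
  define \<eta> where "\<eta> Y1 Y2 x y = (\<Sum>X1 X2:cop H X. \<phi> (star1 X1 (x \<unrhd> Y1)) (star2 X2 (y \<rhd> Y2)))" for Y1 Y2 x y
  have \<eta>: "Lam.bal (\<eta> Y1 Y2)" for Y1 Y2
    unfolding \<eta>_def by (rule bal_hits[OF bal_star1_star2_cop[OF \<phi>]])
  have "(\<Sum>X1 X2:cop HG X. \<Sum>p q:F. \<phi> (p \<unrhd> (X1 \<star> Y1)) (q \<rhd> (X2 \<star> Y2)))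
      = (\<Sum>p q:F. \<eta> Y1 Y2 p q)" for Y1 Y2
  proof -
    have "(\<Sum>X1 X2:cop HG X. \<Sum>p q:F. \<phi> (p \<unrhd> (X1 \<star> Y1)) (q \<rhd> (X2 \<star> Y2)))
      = (\<Sum>p q:F. \<Sum>q1 q2:cop Lam q. \<Sum>p' q':F. \<Sum>X1 X2:cop HG X. \<Sum>y1 y2:cop Lam (q1 \<bullet> p'). \<Sum>p'' q'':F.
        \<phi> (star1 (y1 \<unrhd> p'' \<unrhd> X1) (p \<unrhd> Y1)) (star2 (y2 \<rhd> q'' \<rhd> X2) ((q2 \<bullet> q') \<rhd> Y2)))"
      unfolding expand by (subst psum_swap, rule psum_cong[OF HOL.refl], subst psum_swap, rule psum_cong[OF HOL.refl],
        rule psum_swap)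
    also have "\<dots> = (\<Sum>p q:F. \<Sum>q1 q2:cop Lam q. \<Sum>p' q':F. \<eta> Y1 Y2 (tgt Lam (cou Lam (q1 \<bullet> p')) \<bullet> p) (q2 \<bullet> q'))"
      unfolding inner by (simp add: \<eta>_def rhit_mult)
    also have "\<dots> = (\<Sum>p q:F. \<Sum>p' q':F. \<Sum>q1 q2:cop Lam q. \<eta> Y1 Y2 p (src Lam (cou Lam (q1 \<bullet> p')) \<bullet> q2 \<bullet> q'))"
      by (simp add: form_simps(3)[OF \<eta>] psum_swap[of "cop Lam q" F for q])
    also have "\<dots> = (\<Sum>p q:F. \<eta> Y1 Y2 p (\<Sum>p' q':F. (\<Sum>q1 q2:cop Lam q. src Lam (cou Lam (q1 \<bullet> p')) \<bullet> q2) \<bullet> q'))"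
      by (simp add: form_simps[OF \<eta>])
    also have "\<dots> = (\<Sum>p q:F. \<eta> Y1 Y2 p (q \<bullet> (\<Sum>p' q':F. src Lam (cou Lam p') \<bullet> q')))"
      unfolding Lam.counit_left_mult by simp
    finally show ?thesis unfolding Lam.F_normal_left by simp
  qed
  then have "(\<Sum>X1 X2:cop HG X. \<Sum>Y1 Y2:cop HG Y. \<Sum>p q:F. \<phi> (p \<unrhd> (X1 \<star> Y1)) (q \<rhd> (X2 \<star> Y2)))
      = (\<Sum>Y1 Y2:cop HG Y. \<Sum>p q:F. \<Sum>X1 X2:cop H X. \<phi> (star1 X1 (p \<unrhd> Y1)) (star2 X2 (q \<rhd> Y2)))"
    by (subst psum_swap) (simp add: \<eta>_def)
  also have "\<dots> = psum (cop H (X \<star> Y)) \<phi>"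
    unfolding cop_HG[OF bal_star1_star2_cop[OF \<phi>]] cop_star[OF \<phi>] by (rule psum_swap)
  finally show "psum (cop HG (X \<star> Y)) (hit_F \<phi>)
    = psum (\<Sum>X1 X2:cop HG X. \<Sum>Y1 Y2:cop HG Y. {#(X1 \<star> Y1, X2 \<star> Y2)#})
        (hit_F \<phi>)"
    by (simp add: psum_psum cop_HG[OF \<phi>])
qed

abbreviation "Gbal3 \<equiv> form3 (\<lambda>b X. Lam.tF b \<unrhd> X) (\<lambda>b Y. Lam.sF b \<rhd> Y) (\<lambda>b X. Lam.tF b \<unrhd> X) (\<lambda>b Y. Lam.sF b \<rhd> Y)"

text \<open>
  The twisted coproduct is \<open>G\<^sup>i \<unrhd> X\<^sub>1 \<diamond> G\<^sub>i \<rhd> X\<^sub>2\<close>. Its two iterations differ only by the order of the two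
  actions on the middle factor, and these commute.
\<close>

lemma HG_coassoc_form:
  assumes "Gbal3 \<psi>"
  shows "(\<Sum>X1 X2:cop HG X. \<Sum>X11 X12:cop HG X1. \<psi> X11 X12 X2)
       = (\<Sum>X1 X2:cop HG X. \<Sum>X21 X22:cop HG X2. \<psi> X1 X21 X22)"
proof -
  note \<psi> = form3_simps[OF assms]
  have \<psi>1: "Gbal (\<lambda>x y. \<psi> x y z)" and \<psi>2: "Gbal (\<lambda>y z. \<psi> x y z)" for x z
    by (rule form3_form[OF assms])+
  have b1: "H.bal (\<lambda>x y. \<Sum>g h:Lam.G. \<psi> (g \<unrhd> x) (h \<rhd> y) z)" for z
    by (rule bal_Gbal[OF \<psi>1])
  have b2: "H.bal (\<lambda>y z. \<Sum>g h:Lam.G. \<psi> x (g \<unrhd> y) (h \<rhd> z))" for x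
    by (rule bal_Gbal[OF \<psi>2])
  define \<theta> where "\<theta> x z = (\<Sum>x1 x2:cop H x. \<Sum>g h:Lam.G. \<psi> (g \<unrhd> x1) (h \<rhd> x2) z)" for x z
  define \<theta>' where "\<theta>' x z = (\<Sum>z1 z2:cop H z. \<Sum>g h:Lam.G. \<psi> x (g \<unrhd> z1) (h \<rhd> z2))" for x z
  have \<theta>: "Gbal \<theta>"
    by (rule formI) (simp_all add: \<theta>_def H.cop_add_form[OF b1] cop_rhit[OF b1] \<psi> psum_plus lhit_rhit)
  have \<theta>': "Gbal \<theta>'"
    by (rule formI) (simp_all add: \<theta>'_def H.cop_add_form[OF b2] cop_lhit[OF b2] \<psi> psum_plus flip: lhit_rhit)
  have b3: "H.bal3 (\<lambda>x y z. \<Sum>g' h':Lam.G. \<Sum>g h:Lam.G. \<psi> (g \<unrhd> x) (h \<rhd> g' \<unrhd> y) (h' \<rhd> z))"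
  proof (rule form3I)
    fix b x y z
    show "(\<Sum>g' h':Lam.G. \<Sum>g h:Lam.G. \<psi> (g \<unrhd> (tgt H b \<odot> x)) (h \<rhd> g' \<unrhd> y) (h' \<rhd> z))
        = (\<Sum>g' h':Lam.G. \<Sum>g h:Lam.G. \<psi> (g \<unrhd> x) (h \<rhd> g' \<unrhd> (src H b \<odot> y)) (h' \<rhd> z))"
      using form_simps(3)[OF b1] by (simp add: rhit_src_left)
    have "(\<Sum>g' h':Lam.G. \<Sum>g h:Lam.G. \<psi> (g' \<unrhd> x) (g \<unrhd> h' \<rhd> (tgt H b \<odot> y)) (h \<rhd> z))
        = (\<Sum>g' h':Lam.G. \<Sum>g h:Lam.G. \<psi> (g' \<unrhd> x) (g \<unrhd> h' \<rhd> y) (h \<rhd> (src H b \<odot> z)))"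
      using form_simps(3)[OF b2] by (simp add: lhit_tgt_left)
    then show "(\<Sum>g' h':Lam.G. \<Sum>g h:Lam.G. \<psi> (g \<unrhd> x) (h \<rhd> g' \<unrhd> (tgt H b \<odot> y)) (h' \<rhd> z))
        = (\<Sum>g' h':Lam.G. \<Sum>g h:Lam.G. \<psi> (g \<unrhd> x) (h \<rhd> g' \<unrhd> y) (h' \<rhd> (src H b \<odot> z)))"
      unfolding lhit_rhit by (subst (1 2) psum_swap)
  qed (simp_all add: \<psi> psum_plus)
  have "(\<Sum>X1 X2:cop HG X. \<Sum>X11 X12:cop HG X1. \<psi> X11 X12 X2)
      = (\<Sum>X1 X2:cop H X. \<Sum>g' h':Lam.G. \<Sum>x1 x2:cop H X1. \<Sum>g h:Lam.G.
         \<psi> (g \<unrhd> x1) (h \<rhd> g' \<unrhd> x2) (h' \<rhd> X2))"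
  proof -
    have "(\<Sum>X1 X2:cop HG X. \<Sum>X11 X12:cop HG X1. \<psi> X11 X12 X2) = psum (cop HG X) \<theta>"
      by (simp add: cop_HG_Gbal[OF \<psi>1] \<theta>_def[abs_def])
    then show ?thesis
      unfolding cop_HG_Gbal[OF \<theta>] by (simp add: \<theta>_def cop_rhit[OF b1])
  qed
  also have "\<dots> = (\<Sum>X1 X2:cop H X. \<Sum>x1 x2:cop H X1. \<Sum>g' h':Lam.G. \<Sum>g h:Lam.G.
         \<psi> (g \<unrhd> x1) (h \<rhd> g' \<unrhd> x2) (h' \<rhd> X2))"
    by (simp only: psum_swap[of Lam.G "cop H x" for x])
  also have "\<dots> = (\<Sum>X1 X2:cop H X. \<Sum>x1 x2:cop H X2. \<Sum>g' h':Lam.G. \<Sum>g h:Lam.G.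
         \<psi> (g \<unrhd> X1) (h \<rhd> g' \<unrhd> x1) (h' \<rhd> x2))"
    by (rule H.coassoc_form[OF b3])
  also have "\<dots> = (\<Sum>X1 X2:cop H X. \<Sum>x1 x2:cop H X2. \<Sum>g h:Lam.G. \<Sum>g' h':Lam.G.
         \<psi> (g \<unrhd> X1) (g' \<unrhd> h \<rhd> x1) (h' \<rhd> x2))"
    unfolding lhit_rhit by (subst (3) psum_swap) (rule HOL.refl)
  also have "\<dots> = (\<Sum>X1 X2:cop H X. \<Sum>g h:Lam.G. \<Sum>x1 x2:cop H X2. \<Sum>g' h':Lam.G.
         \<psi> (g \<unrhd> X1) (g' \<unrhd> h \<rhd> x1) (h' \<rhd> x2))"
    by (simp only: psum_swap[of Lam.G "cop H x" for x])
  also have "\<dots> = (\<Sum>X1 X2:cop HG X. \<Sum>X21 X22:cop HG X2. \<psi> X1 X21 X22)"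
  proof -
    have "(\<Sum>X1 X2:cop HG X. \<Sum>X21 X22:cop HG X2. \<psi> X1 X21 X22) = psum (cop HG X) \<theta>'"
      by (simp add: cop_HG_Gbal[OF \<psi>2] \<theta>'_def[abs_def])
    then show ?thesis
      unfolding cop_HG_Gbal[OF \<theta>'] by (simp add: \<theta>'_def cop_lhit[OF b2])
  qed
  finally show ?thesis .
qed

lemma HG_coassoc: "diamond3_eq HG
   (\<Sum>X1 X2:cop HG X. \<Sum>X11 X12:cop HG X1. {#(X11, X12, X2)#})
   (\<Sum>X1 X2:cop HG X. \<Sum>X21 X22:cop HG X2. {#(X1, X21, X22)#})"
  unfolding diamond3_eq_def HG_simps HG_mult star_src_left star_tgt_left
proof (rule tensor3_eqI)
  fix \<psi> :: "'h \<Rightarrow> 'h \<Rightarrow> 'h \<Rightarrow> 'k"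
  assume "form3_on HG HG HG (\<lambda>b X. Lam.tF b \<unrhd> X) (\<lambda>b Y. Lam.sF b \<rhd> Y) (\<lambda>b X. Lam.tF b \<unrhd> X) (\<lambda>b Y. Lam.sF b \<rhd> Y) \<psi>"
  then have "Gbal3 \<psi>" by (simp add: form3_on_def form3_def)
  from HG_coassoc_form[OF this]
  show "tsum (\<Sum>X1 X2:cop HG X. \<Sum>X11 X12:cop HG X1. {#(X11, X12, X2)#}) \<psi>
      = tsum (\<Sum>X1 X2:cop HG X. \<Sum>X21 X22:cop HG X2. {#(X1, X21, X22)#}) \<psi>"
    by (simp add: tsum_psum)
qed (use H.L.vspace in \<open>auto simp: is_vspace_def module.subspace_UNIV module_iff_vector_space\<close>)

theorem HG_bialgebroid: "left_bialgebroid Lam.BF HG"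
proof (intro left_bialgebroid.intro Lam.BF_algebra HG_algebra left_bialgebroid_axioms.intro,
    unfold psum_def[symmetric] HG_simps Lam.BF_simps HG_mult)
  interpret BF: unital_algebra Lam.BF by (rule Lam.BF_algebra)
  show "Vector_Spaces.linear (smul B) (smul H) (src H)" "Vector_Spaces.linear (smul B) (smul H) (tgt H)"
    by (rule H.src_linear H.tgt_linear)+
  show "src H (a \<cdot>\<^bsub>Lam.BF\<^esub> b) = src H a \<star> src H b" for a b
    by (simp add: star_src_left lhit_of_src Lam.cou_sF_mult)
  show "tgt H (a \<cdot>\<^bsub>Lam.BF\<^esub> b) = tgt H b \<star> tgt H a" for a b
    by (simp add: star_tgt_left rhit_of_tgt Lam.cou_tF_mult)
  show "src H a \<star> tgt H b = tgt H b \<star> src H a" for a b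
    unfolding star_src_left star_tgt_left by (simp add: lhit_of_tgt rhit_of_src H.tgt_src)
  show "Vector_Spaces.linear (smul H) (smul B) (cou HG)"
    using Lam.B.vspace H.L.vspace by (simp add: Vector_Spaces.linear_iff)
  show "cou HG (src H a \<star> tgt H b \<star> X) = a \<cdot>\<^bsub>Lam.BF\<^esub> cou HG X \<cdot>\<^bsub>Lam.BF\<^esub> b" for a b X
    unfolding star_assoc unfolding star_src_left star_tgt_left by simp
  show "cou HG (X \<star> src H (cou HG Y)) = cou HG (X \<star> Y)" "cou HG (X \<star> tgt H (cou HG Y)) = cou HG (X \<star> Y)" for X Y
    by (rule cou_HG_star_cong, simp)+
qed (simp_all add: HG_cop_add HG_cop_smul HG_cop_bimodule HG_coassoc
   HG_counit_left HG_counit_right HG_cop_takeuchi HG_cop_one HG_cop_mult)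

end

section \<open>The twisted pairing\<close>

context twisted_pairing
begin

definition tpair where
  "tpair \<alpha> X = (\<Sum>p q:F. \<Sum>Xp Xm:H.tr X. br (p \<bullet> \<alpha>) (Xp \<odot> tgt H (br q Xm)))"

text \<open>
  The pairing with \<open>\<alpha>\<close> is the twisted counit of \<open>\<alpha> \<rhd> X\<close>; all axioms of a pairing are deduced from this.
\<close>

lemma tpair_eq: "tpair \<alpha> X = cou HG (\<alpha> \<rhd> X)"
proof -
  have "tpair \<alpha> X = (\<Sum>p q:F. br (p \<bullet> \<alpha>) (q \<unrhd> X))"
    by (simp add: tpair_def rhit_def)
  then show ?thesis
    unfolding cou_HG by (simp add: lhit_mult lhit_rhit flip: cou_lhit)
qed

text \<open>
  The action \<open>\<rhd>\<close> on the first factor commutes with the action \<open>\<unrhd>\<close> of \<open>G\<close> on it.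
\<close>

lemma cop_HG_lhit:
  assumes "Gbal \<psi>"
  shows "psum (cop HG (\<alpha> \<rhd> X)) \<psi> = (\<Sum>X1 X2:cop HG X. \<psi> (\<alpha> \<rhd> X1) X2)"
proof -
  have 1: "Gbal (\<lambda>X Y. \<psi> (\<alpha> \<rhd> X) Y)"
    by (rule formI) (simp_all add: form_simps[OF assms] lhit_rhit)
  show ?thesis
    unfolding cop_HG_Gbal[OF assms] cop_HG_Gbal[OF 1] cop_lhit[OF bal_Gbal[OF assms]] lhit_rhit ..
qed

lemma lhit_counit: "(\<Sum>X1 X2:cop HG X. src H (cou HG (\<alpha> \<rhd> X1)) \<star> X2) = \<alpha> \<rhd> X"
proof -
  have "Gbal (\<lambda>X Y. src H (cou HG X) \<star> Y)"
    by (rule formI) (simp_all add: star_src_left Lam.sF_mult lhit_mult)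
  from cop_HG_lhit[OF this] show ?thesis
    using HG_counit_left[of "\<alpha> \<rhd> X"] by simp
qed

theorem tpair_dual_pairing: "dual_pairing Lam.BF Lam.LF HG tpair"
proof (intro dual_pairing.intro Lam.LF_bialgebroid HG_bialgebroid dual_pairing_axioms.intro,
    unfold psum_def[symmetric] HG_simps Lam.BF_simps Lam.LF_simps HG_mult tpair_eq)
  interpret BF: unital_algebra Lam.BF by (rule Lam.BF_algebra)
  show "Vector_Spaces.linear (smul Lam) (smul B) (\<lambda>x. cou HG (x \<rhd> g))"
       "Vector_Spaces.linear (smul H) (smul B) (\<lambda>g. cou HG (x \<rhd> g))" for x g
    using Lam.B.vspace Lam.L.vspace H.L.vspace by (simp_all add: Vector_Spaces.linear_iff)
  show "cou HG ((Lam.sF a \<bullet> Lam.tF b \<bullet> x \<bullet> Lam.sF c \<bullet> Lam.tF d) \<rhd> g) \<cdot>\<^bsub>Lam.BF\<^esub> f =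
      a \<cdot>\<^bsub>Lam.BF\<^esub> cou HG (x \<rhd> (src H c \<star> tgt H f \<star> g \<star> src H d \<star> tgt H b))" for a b c d f x g
  proof -
    have "src H c \<star> tgt H f \<star> g \<star> src H d \<star> tgt H b
        = Lam.sF b \<unrhd> Lam.tF d \<rhd> Lam.sF c \<rhd> Lam.tF f \<unrhd> g"
      unfolding star_tgt_right[of "src H c \<star> tgt H f \<star> g \<star> src H d" b]
      unfolding star_src_right[of "src H c \<star> tgt H f \<star> g" d] unfolding star_assoc
      unfolding star_src_left star_tgt_left ..
    also have "\<dots> = Lam.tF f \<unrhd> Lam.sF b \<unrhd> Lam.sF c \<rhd> Lam.tF d \<rhd> g"
      unfolding lhit_rhit rhit_mult[symmetric] lhit_mult[symmetric] Lam.tF_sF ..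
    finally show ?thesis
      by (simp add: lhit_mult lhit_rhit cou_HG_tF_lhit)
  qed
  show "cou HG (x \<rhd> (g \<star> h)) = (\<Sum>x1 x2:cop Lam.LF x. cou HG (x1 \<rhd> (g \<star> tgt H (cou HG (x2 \<rhd> h)))))"
    and "cou HG (x \<rhd> (g \<star> h)) = (\<Sum>x1 x2:cop Lam.LF x. cou HG ((Lam.tF (cou HG (x2 \<rhd> h)) \<bullet> x1) \<rhd> g))" for x g h
  proof -
    have "cou HG ((x1 \<rhd> g) \<star> (x2 \<rhd> h)) = cou HG ((x1 \<rhd> g) \<star> tgt H (cou HG (x2 \<rhd> h)))" for x1 x2
      by (rule cou_HG_star_cong) simp
    then have 1: "cou HG (x \<rhd> (g \<star> h)) = (\<Sum>x1 x2:cop Lam.LF x. cou HG ((x1 \<rhd> g) \<star> tgt H (cou HG (x2 \<rhd> h))))"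
      by (simp add: lhit_star_LF)
    then show "cou HG (x \<rhd> (g \<star> h)) = (\<Sum>x1 x2:cop Lam.LF x. cou HG (x1 \<rhd> (g \<star> tgt H (cou HG (x2 \<rhd> h)))))"
      by (simp add: star_tgt_right lhit_rhit)
    from 1 show "cou HG (x \<rhd> (g \<star> h)) = (\<Sum>x1 x2:cop Lam.LF x. cou HG ((Lam.tF (cou HG (x2 \<rhd> h)) \<bullet> x1) \<rhd> g))"
      by (simp add: star_tgt_right lhit_mult cou_HG_tF_lhit)
  qed
  have 2: "cou HG (x \<rhd> y \<rhd> g) = (\<Sum>g1 g2:cop HG g. cou HG (x \<rhd> (src H (cou HG (y \<rhd> g1)) \<star> g2)))" for x y g
    by (subst lhit_counit[of g y, symmetric]) simp
  show "cou HG ((x \<bullet> y) \<rhd> g) = (\<Sum>g1 g2:cop HG g. cou HG ((x \<bullet> Lam.sF (cou HG (y \<rhd> g1))) \<rhd> g2))" for x y g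
    unfolding lhit_mult star_src_left[symmetric] by (rule 2)
  show "cou HG ((x \<bullet> y) \<rhd> g) = (\<Sum>g1 g2:cop HG g. cou HG (x \<rhd> (src H (cou HG (y \<rhd> g1)) \<star> g2)))" for x y g
    unfolding lhit_mult by (rule 2)
  show "cou HG (x \<rhd> \<one>\<^bsub>H\<^esub>) = cou Lam x" for x by (simp add: lhit_unit)
  show "cou HG (\<one>\<^bsub>Lam\<^esub> \<rhd> g) = cou HG g" for g by simp
qed

section \<open>The cocycle on the dual\<close>

lemma star1_unit: "star1 \<one>\<^bsub>H\<^esub> X = X" "star1 X \<one>\<^bsub>H\<^esub> = X"
proof -
  have "star1 \<one>\<^bsub>H\<^esub> X = (\<Sum>p q:F. src Lam (cou Lam p) \<bullet> q) \<rhd> X"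
    by (simp add: star1_eq lhit_unit lhit_mult)
  then show "star1 \<one>\<^bsub>H\<^esub> X = X" unfolding Lam.F_normal_left by simp
  have "star1 X \<one>\<^bsub>H\<^esub> = (\<Sum>p q:F. tgt Lam (cou Lam q) \<bullet> p) \<rhd> X"
    by (simp add: star1_eq lhit_unit lhit_mult)
  then show "star1 X \<one>\<^bsub>H\<^esub> = X" unfolding Lam.F_normal_right by simp
qed

lemma star1_smul: "star1 (smul H k X) Y = smul H k (star1 X Y)" "star1 X (smul H k Y) = smul H k (star1 X Y)"
  by (simp_all add: star1_eq H.L.smul_psum)

lemma star1_\<Gamma>: "(\<Sum>X1 X2:cop H X. \<Sum>Y1 Y2:cop H Y. src H (\<Gamma> X1 Y1) \<odot> (X2 \<odot> Y2)) = star1 X Y"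
  unfolding star1_eq by (rule \<Gamma>_act) simp_all

lemma \<Gamma>_psum: "\<Gamma> X (psum u f) = (\<Sum>x y:u. \<Gamma> X (f x y))" "\<Gamma> (psum u f) X = (\<Sum>x y:u. \<Gamma> (f x y) X)"
  by (simp_all add: \<Gamma>_eq)

text \<open>
  Both sides of the cocycle identity are \<open>\<epsilon>\<close> of a threefold product for \<open>star1\<close>, by \<open>\<Gamma>_eq\<close> and
  \<open>star1_\<Gamma>\<close>.
\<close>

theorem \<Gamma>_cocycle: "left_2_cocycle_on B H \<Gamma>"
proof -
  have "(\<Sum>Y1 Y2:cop H Y. \<Sum>Z1 Z2:cop H Z. \<Gamma> X (src H (\<Gamma> Y1 Z1) \<odot> Y2 \<odot> Z2))
      = (\<Sum>X1 X2:cop H X. \<Sum>Y1 Y2:cop H Y. \<Gamma> (src H (\<Gamma> X1 Y1) \<odot> X2 \<odot> Y2) Z)" for X Y Z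
  proof -
    have "\<Gamma> X (star1 Y Z) = \<Gamma> (star1 X Y) Z" by (simp add: \<Gamma>_eq star1_assoc)
    then show ?thesis unfolding star1_\<Gamma>[symmetric] by (simp add: \<Gamma>_psum)
  qed
  moreover have "Vector_Spaces.linear (smul H) (smul B) (\<lambda>X. \<Gamma> X Y)"
      "Vector_Spaces.linear (smul H) (smul B) (\<lambda>X. \<Gamma> Y X)" for Y
    using H.L.vspace Lam.B.vspace by (simp_all add: Vector_Spaces.linear_iff \<Gamma>_eq star1_smul)
  moreover have "\<Gamma> (X \<odot> tgt H b) Y = \<Gamma> X (tgt H b \<odot> Y)" "\<Gamma> (tgt H b \<odot> X) Y = \<Gamma> X Y \<cdot>\<^bsub>B\<^esub> b"
      "\<Gamma> \<one>\<^bsub>H\<^esub> X = cou H X" "\<Gamma> X \<one>\<^bsub>H\<^esub> = cou H X" for b X Y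
    by (simp_all add: \<Gamma>_eq star1_tgt star1_unit)
  ultimately show ?thesis
    unfolding left_2_cocycle_on_def psum_def[symmetric] by blast
qed

lemma \<Gamma>_src: "\<Gamma> (src H a) (src H b) = a \<cdot>\<^bsub>Lam.BF\<^esub> b"
  by (simp add: \<Gamma>_eq star1_eq lhit_of_src Lam.BF_mult)

theorem cotwist_base_eq: "cotwist_base B H \<Gamma> = Lam.BF"
proof -
  have "(\<lambda>a b. \<Gamma> (src H a) (src H b)) = mult Lam.BF"
    by (intro ext) (rule \<Gamma>_src)
  then show ?thesis by (simp add: cotwist_base_def twist_base_def)
qed

end

section \<open>Comodules\<close>

lemma psum_mem:
  assumes "0 \<in> S" "\<And>x y. x \<in> S \<Longrightarrow> y \<in> S \<Longrightarrow> x + y \<in> S" "\<And>x y. (x, y) \<in># u \<Longrightarrow> f x y \<in> S"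
  shows "psum u f \<in> S"
  using assms(3) by (induction u) (auto simp: psum_add_mset assms(1,2))

lemma psum_additive_on:
  fixes h :: "'c::ab_group_add \<Rightarrow> 'd::ab_group_add"
  assumes S: "0 \<in> S" "\<And>x y. x \<in> S \<Longrightarrow> y \<in> S \<Longrightarrow> x + y \<in> S"
    and h: "\<And>x y. x \<in> S \<Longrightarrow> y \<in> S \<Longrightarrow> h (x + y) = h x + h y"
    and f: "\<And>x y. (x, y) \<in># u \<Longrightarrow> f x y \<in> S"
  shows "h (psum u f) = (\<Sum>x y:u. h (f x y))"
  using f
proof (induction u)
  case empty
  then show ?case using h[OF S(1) S(1)] by simp
next
  case (add z u)
  obtain x y where z: "z = (x, y)" by fastforce
  have "psum u f \<in> S" using add.prems by (intro psum_mem S) auto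
  then show ?case using add by (simp add: z psum_add_mset h)
qed

locale comodule_pairing = hopf_pairing B Lam H br
  for B :: "('k::field, 'b::ab_group_add) algebra"
    and Lam :: "('k, 'b, 'l::ab_group_add) bialgebroid"
    and H :: "('k, 'b, 'h::ab_group_add) bialgebroid"
    and br :: "'l \<Rightarrow> 'h \<Rightarrow> 'b" +
  fixes M :: "('k, 'b, 'h, 'm::ab_group_add) comod"
  assumes comod: "left_comodule B H M"
begin

lemma M_lact: "left_module B (mod_of M (lact M))" and M_ract: "left_module (opposite B) (mod_of M (ract M))"
  using comod unfolding left_comodule_def by blast+

lemma M_vspace: "is_vspace M"
  using M_lact by (simp add: left_module_def is_vspace_def mod_of_def)

lemma M_vector_space: "vector_space (smul M)"
  using M_vspace by (simp add: is_vspace_def)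

lemma M_closed [simp]: "0 \<in> car M" "\<And>x y. x \<in> car M \<Longrightarrow> y \<in> car M \<Longrightarrow> x + y \<in> car M"
    "\<And>k x. x \<in> car M \<Longrightarrow> smul M k x \<in> car M"
  using M_vspace unfolding is_vspace_def
  by (auto simp: module.subspace_def module_iff_vector_space)

lemma lact_simps [simp]:
  assumes "m \<in> car M"
  shows "lact M a m \<in> car M" "lact M (a + b) m = lact M a m + lact M b m"
    "lact M (smul B k a) m = smul M k (lact M a m)" "lact M a (smul M k m) = smul M k (lact M a m)"
    "lact M (a \<cdot>\<^bsub>B\<^esub> b) m = lact M a (lact M b m)" "lact M \<one>\<^bsub>B\<^esub> m = m"
  using M_lact assms by (simp_all add: left_module_def mod_of_def)

lemma lact_add_right [simp]: "m \<in> car M \<Longrightarrow> n \<in> car M \<Longrightarrow> lact M a (m + n) = lact M a m + lact M a n"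
  using M_lact by (simp add: left_module_def mod_of_def)

lemma ract_simps [simp]:
  assumes "m \<in> car M"
  shows "ract M a m \<in> car M" "ract M (a + b) m = ract M a m + ract M b m"
    "ract M (smul B k a) m = smul M k (ract M a m)" "ract M a (smul M k m) = smul M k (ract M a m)"
    "ract M \<one>\<^bsub>B\<^esub> m = m"
  using M_ract assms by (simp_all add: left_module_def mod_of_def opposite_def)

lemma ract_add_right [simp]: "m \<in> car M \<Longrightarrow> n \<in> car M \<Longrightarrow> ract M a (m + n) = ract M a m + ract M a n"
  using M_ract by (simp add: left_module_def mod_of_def)

lemma lact_ract: "m \<in> car M \<Longrightarrow> lact M a (ract M b m) = ract M b (lact M a m)"
  using comod unfolding left_comodule_def by blast

lemma coact_mem: "m \<in> car M \<Longrightarrow> (X, m0) \<in># coact M m \<Longrightarrow> m0 \<in> car M"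
  using comod unfolding left_comodule_def formal_sums_def by fastforce

lemma lact_psum: "m \<in> car M \<Longrightarrow> lact M (psum u f) m = (\<Sum>x y:u. lact M (f x y) m)"
  by (rule additive_psum[where h = "\<lambda>a. lact M a m"]) simp

text \<open>
  The forms on the tensor product of the Hopf algebroid with \<open>M\<close> in which the coaction takes its values.
\<close>

definition cform :: "('h \<Rightarrow> 'm \<Rightarrow> 'c::ab_group_add) \<Rightarrow> bool" where
  "cform \<phi> \<longleftrightarrow> (\<forall>X X'. \<forall>m\<in>car M. \<phi> (X + X') m = \<phi> X m + \<phi> X' m)
     \<and> (\<forall>X. \<forall>m\<in>car M. \<forall>m'\<in>car M. \<phi> X (m + m') = \<phi> X m + \<phi> X m')
     \<and> (\<forall>b X. \<forall>m\<in>car M. \<phi> (tgt H b \<odot> X) m = \<phi> X (lact M b m))"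

lemma cform_smul:
  assumes "cform \<phi>" "m \<in> car M"
  shows "\<phi> (smul H k X) m = \<phi> X (smul M k m)"
proof -
  have "\<phi> (tgt H (smul B k \<one>\<^bsub>B\<^esub>) \<odot> X) m = \<phi> X (lact M (smul B k \<one>\<^bsub>B\<^esub>) m)"
    using assms unfolding cform_def by blast
  then show ?thesis using assms(2) by simp
qed

lemma coact_eq_cform:
  assumes "coact_eq H M u v" "cform \<phi>"
  shows "psum u \<phi> = psum v \<phi>"
  using assms(1) unfolding coact_eq_def
  by (rule tensor2_eq_psum)
    (use assms(2) cform_smul[OF assms(2)] in \<open>auto simp: form_on_def cform_def\<close>)

lemma coact_add:
  assumes "cform \<phi>" "m \<in> car M" "n \<in> car M"
  shows "psum (coact M (m + n)) \<phi> = psum (coact M m) \<phi> + psum (coact M n) \<phi>"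
proof -
  have "coact_eq H M (coact M (m + n)) (coact M m + coact M n)"
    using comod assms(2,3) unfolding left_comodule_def by blast
  from coact_eq_cform[OF this assms(1)] show ?thesis by simp
qed

lemma coact_psum:
  assumes "cform \<phi>" "\<And>x y. (x, y) \<in># u \<Longrightarrow> f x y \<in> car M"
  shows "psum (coact M (psum u f)) \<phi> = (\<Sum>x y:u. psum (coact M (f x y)) \<phi>)"
  by (rule psum_additive_on[where S = "car M"]) (simp_all add: coact_add[OF assms(1)] assms(2))

lemma coact_smul:
  assumes "cform \<phi>" "m \<in> car M"
  shows "psum (coact M (smul M k m)) \<phi> = (\<Sum>X m0:coact M m. \<phi> (smul H k X) m0)"
proof -
  have "coact_eq H M (coact M (smul M k m)) (\<Sum>X m0:coact M m. {#(smul H k X, m0)#})"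
    using comod assms(2) unfolding left_comodule_def psum_def[symmetric] by blast
  from coact_eq_cform[OF this assms(1)] show ?thesis by (simp add: psum_psum)
qed

lemma coact_lact:
  assumes "cform \<phi>" "m \<in> car M"
  shows "psum (coact M (lact M a m)) \<phi> = (\<Sum>X m0:coact M m. \<phi> (src H a \<odot> X) m0)"
proof -
  have "coact_eq H M (coact M (lact M a (ract M \<one>\<^bsub>B\<^esub> m)))
      (\<Sum>X m0:coact M m. {#(src H a \<odot> X \<odot> src H \<one>\<^bsub>B\<^esub>, m0)#})"
    using comod assms(2) unfolding left_comodule_def psum_def[symmetric] by blast
  from coact_eq_cform[OF this assms(1)] show ?thesis using assms(2) by (simp add: psum_psum)
qed

lemma coact_takeuchi:
  assumes "cform \<phi>" "m \<in> car M"
  shows "(\<Sum>X m0:coact M m. \<phi> (X \<odot> tgt H b) m0) = (\<Sum>X m0:coact M m. \<phi> X (ract M b m0))"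
proof -
  have "coact_eq H M (\<Sum>X m0:coact M m. {#(X \<odot> tgt H b, m0)#}) (\<Sum>X m0:coact M m. {#(X, ract M b m0)#})"
    using comod assms(2) unfolding left_comodule_def psum_def[symmetric] by blast
  from coact_eq_cform[OF this assms(1)] show ?thesis by (simp add: psum_psum)
qed

lemma coact_counit: "m \<in> car M \<Longrightarrow> (\<Sum>X m0:coact M m. lact M (cou H X) m0) = m"
  using comod unfolding left_comodule_def psum_def[symmetric] by blast

text \<open>
  The dual acts on every comodule, and source and target act as the two module structures over \<open>B\<close>.
\<close>

definition mhit (infixr "\<rightharpoonup>" 75) where
  "\<alpha> \<rightharpoonup> m = (\<Sum>X m0:coact M m. lact M (br \<alpha> X) m0)"

lemma cform_mhit: "cform (\<lambda>X m0. lact M (br \<alpha> X) m0)"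
  by (simp add: cform_def)

lemma mhit_mem [simp]: "m \<in> car M \<Longrightarrow> \<alpha> \<rightharpoonup> m \<in> car M"
  unfolding mhit_def by (intro psum_mem) (auto dest: coact_mem)

lemma mhit_add [simp]: "m \<in> car M \<Longrightarrow> (\<alpha> + \<beta>) \<rightharpoonup> m = \<alpha> \<rightharpoonup> m + \<beta> \<rightharpoonup> m"
  unfolding mhit_def by (subst psum_plus[symmetric]) (auto intro!: psum_cong dest: coact_mem)

lemma mhit_add_right [simp]: "m \<in> car M \<Longrightarrow> n \<in> car M \<Longrightarrow> \<alpha> \<rightharpoonup> (m + n) = \<alpha> \<rightharpoonup> m + \<alpha> \<rightharpoonup> n"
  unfolding mhit_def by (rule coact_add[OF cform_mhit])

lemma mhit_smul: "m \<in> car M \<Longrightarrow> \<alpha> \<rightharpoonup> smul M k m = smul M k (\<alpha> \<rightharpoonup> m)"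
proof -
  assume m: "m \<in> car M"
  interpret V: vector_space "smul M" by (rule M_vector_space)
  have "\<alpha> \<rightharpoonup> smul M k m = (\<Sum>X m0:coact M m. smul M k (lact M (br \<alpha> X) m0))"
    unfolding mhit_def coact_smul[OF cform_mhit m] by (rule psum_cong[OF HOL.refl]) (simp add: coact_mem[OF m])
  also have "\<dots> = smul M k (\<alpha> \<rightharpoonup> m)"
    unfolding mhit_def by (rule additive_psum[symmetric]) (rule V.scale_right_distrib)
  finally show ?thesis .
qed

lemma mhit_mult: "m \<in> car M \<Longrightarrow> (\<alpha> \<bullet> \<beta>) \<rightharpoonup> m = \<alpha> \<rightharpoonup> \<beta> \<rightharpoonup> m"
proof -
  assume m: "m \<in> car M"
  define \<psi> where "\<psi> X Y m0 = lact M (br \<alpha> (src H (br \<beta> X) \<odot> Y)) m0" for X Y m0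
  have t3: "tensor3_eq H H M (\<lambda>b x. tgt H b \<odot> x) (\<lambda>b y. src H b \<odot> y) (\<lambda>b x. tgt H b \<odot> x) (lact M)
        (\<Sum>X m0:coact M m. \<Sum>X1 X2:cop H X. {#(X1, X2, m0)#})
        (\<Sum>X m0:coact M m. \<Sum>Y m00:coact M m0. {#(X, Y, m00)#})"
    using comod m unfolding left_comodule_def psum_def[symmetric] by blast
  have "form3_on H H M (\<lambda>b x. tgt H b \<odot> x) (\<lambda>b y. src H b \<odot> y) (\<lambda>b x. tgt H b \<odot> x) (lact M) \<psi>"
    unfolding form3_on_def \<psi>_def by simp
  from tensor3_eq_tsum[OF t3 this]
  have "(\<Sum>X m0:coact M m. \<Sum>X1 X2:cop H X. \<psi> X1 X2 m0)
      = (\<Sum>X m0:coact M m. \<Sum>Y m00:coact M m0. \<psi> X Y m00)"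
    by (simp add: tsum_psum)
  also have "\<dots> = (\<Sum>X m0:coact M m. \<Sum>Y m00:coact M (lact M (br \<beta> X) m0). lact M (br \<alpha> Y) m00)"
    unfolding \<psi>_def by (rule psum_cong[OF HOL.refl]) (simp add: coact_lact[OF cform_mhit] coact_mem[OF m])
  also have "\<dots> = \<alpha> \<rightharpoonup> \<beta> \<rightharpoonup> m"
    unfolding mhit_def using coact_mem[OF m] by (subst coact_psum[OF cform_mhit]) auto
  also have "(\<Sum>X m0:coact M m. \<Sum>X1 X2:cop H X. \<psi> X1 X2 m0) = (\<alpha> \<bullet> \<beta>) \<rightharpoonup> m"
    unfolding mhit_def \<psi>_def br_mult_left
    by (rule psum_cong[OF HOL.refl]) (simp add: lact_psum coact_mem[OF m])
  finally show ?thesis .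
qed

lemma mhit_one [simp]: "m \<in> car M \<Longrightarrow> \<one>\<^bsub>Lam\<^esub> \<rightharpoonup> m = m"
  by (simp add: mhit_def coact_counit)

lemma mhit_src: "m \<in> car M \<Longrightarrow> src Lam b \<rightharpoonup> m = lact M b m"
proof -
  assume m: "m \<in> car M"
  have "src Lam b \<rightharpoonup> m = (\<Sum>X m0:coact M m. lact M b (lact M (cou H X) m0))"
    unfolding mhit_def by (rule psum_cong[OF HOL.refl]) (simp add: coact_mem[OF m])
  also have "\<dots> = lact M b (\<Sum>X m0:coact M m. lact M (cou H X) m0)"
    by (rule psum_additive_on[where S = "car M", symmetric]) (auto simp: coact_mem[OF m])
  finally show ?thesis by (simp add: coact_counit[OF m])
qed

lemma mhit_tgt: "m \<in> car M \<Longrightarrow> tgt Lam b \<rightharpoonup> m = ract M b m"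
proof -
  assume m: "m \<in> car M"
  have c: "cform (\<lambda>X m0. lact M (cou H X) m0)" by (simp add: cform_def)
  have "tgt Lam b \<rightharpoonup> m = (\<Sum>X m0:coact M m. lact M (cou H X) (ract M b m0))"
    unfolding mhit_def by (simp add: coact_takeuchi[OF c m])
  also have "\<dots> = (\<Sum>X m0:coact M m. ract M b (lact M (cou H X) m0))"
    by (rule psum_cong[OF HOL.refl]) (simp add: coact_mem[OF m] lact_ract)
  also have "\<dots> = ract M b (\<Sum>X m0:coact M m. lact M (cou H X) m0)"
    by (rule psum_additive_on[where S = "car M", symmetric]) (auto simp: coact_mem[OF m])
  finally show ?thesis by (simp add: coact_counit[OF m])
qed

end

context twisted_pairing
begin

lemma \<Gamma>_src_right: "\<Gamma> X (src H a) = br (Lam.tF a) X"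
  using br_src_right[of _ a "\<one>\<^bsub>H\<^esub>"] by (simp add: \<Gamma>_def Lam.tF_eq)

lemma \<Gamma>_src_left: "\<Gamma> (src H a) X = br (Lam.sF a) X"
proof -
  have "br p (src H a \<odot> tgt H c) = cou Lam (p \<bullet> src Lam a) \<cdot>\<^bsub>B\<^esub> c" for p c
    using br_src_right[of p a "\<one>\<^bsub>H\<^esub>"] br_tgt_H[of p c "src H a"] by (simp add: H.tgt_src)
  then show ?thesis by (simp add: \<Gamma>_def Lam.sF_eq)
qed

text \<open>
  In terms of \<open>\<rightharpoonup>\<close> the map in question is \<open>m \<otimes> n \<mapsto> F\<^sup>i \<rightharpoonup> m \<otimes> F\<^sub>i \<rightharpoonup> n\<close>, and the structures over the
  twisted base are the actions of \<open>t\<^sup>F\<close> and \<open>s\<^sup>F\<close>. For fixed \<open>m\<close> and \<open>n\<close> a form on the comodules gives one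
  on \<open>\<Lambda>\<close>, so the rules for \<open>F\<close> and \<open>G\<close> carry over, and \<open>G\<close> gives the inverse.
\<close>

theorem \<Gamma>_invertible: "cocycle_on_invertible TYPE('u::ab_group_add) B H \<Gamma>"
  unfolding cocycle_on_invertible_def psum_def[symmetric]
proof (intro allI impI, elim conjE)
  fix M N :: "('k, 'b, 'h, 'u) comod"
  assume "left_comodule B H M" "left_comodule B H N"
  interpret M: comodule_pairing B Lam H br M by unfold_locales fact
  interpret N: comodule_pairing B Lam H br N by unfold_locales fact
  define \<Phi> where "\<Phi> u = (\<Sum>m n:u. \<Sum>X m0:coact M m. \<Sum>Y n0:coact N n. {#(lact M (\<Gamma> X Y) m0, n0)#})"
    for u
  let ?E' = "tensor2_eq M N (ract M) (lact N)"
  let ?E = "tensor2_eq M N (ract_cotwist H \<Gamma> M) (lact_cotwist H \<Gamma> N)"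
  have racts: "ract_cotwist H \<Gamma> M b m = M.mhit (Lam.tF b) m" for b m
    by (simp add: ract_cotwist_def M.mhit_def \<Gamma>_src_right psum_def)
  have lacts: "lact_cotwist H \<Gamma> N b n = N.mhit (Lam.sF b) n" for b n
    by (simp add: lact_cotwist_def N.mhit_def \<Gamma>_src_left psum_def)
  have mem: "m \<in> car M" "n \<in> car N" if "(m, n) \<in># u" "u \<in> formal_sums M N" for m n u
    using that by (auto simp: formal_sums_def)
  have \<Phi>_mem: "\<Phi> u \<in> formal_sums M N" if "u \<in> formal_sums M N" for u
  proof -
    have "lact M (\<Gamma> X Y) m0 \<in> car M \<and> n0 \<in> car N"
      if "(m, n) \<in># u" "(X, m0) \<in># coact M m" "(Y, n0) \<in># coact N n" for m n X m0 Y n0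
      using mem[OF that(1) \<open>u \<in> _\<close>] that by (simp add: M.coact_mem[of m X] N.coact_mem[of n Y])
    then show ?thesis unfolding \<Phi>_def formal_sums_def by (fastforce simp: set_mset_psum)
  qed
  have bal: "Lam.bal (\<lambda>\<alpha> \<beta>. \<phi> (M.mhit \<alpha> m) (N.mhit \<beta> n))"
    if "form_on M N (ract M) (lact N) \<phi>" "m \<in> car M" "n \<in> car N" for \<phi> :: "'u \<Rightarrow> 'u \<Rightarrow> 'k" and m n
    using that by (intro formI) (simp_all add: form_on_def M.mhit_mult N.mhit_mult M.mhit_tgt N.mhit_src)
  have Fbal: "Lam.Fbal (\<lambda>\<alpha> \<beta>. \<phi> (M.mhit \<alpha> m) (N.mhit \<beta> n))"
    if "form_on M N (ract_cotwist H \<Gamma> M) (lact_cotwist H \<Gamma> N) \<phi>" "m \<in> car M" "n \<in> car N"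
    for \<phi> :: "'u \<Rightarrow> 'u \<Rightarrow> 'k" and m n
    using that by (intro formI) (simp_all add: form_on_def racts lacts M.mhit_mult N.mhit_mult)
  have \<Phi>_F: "psum (\<Phi> u) \<phi> = (\<Sum>m n:u. \<Sum>p q:F. \<phi> (M.mhit p m) (N.mhit q n))"
    if \<phi>: "form_on M N (ract M) (lact N) \<phi>" and u: "u \<in> formal_sums M N" for \<phi> :: "'u \<Rightarrow> 'u \<Rightarrow> 'k" and u
    unfolding \<Phi>_def psum_psum psum_single
  proof (rule psum_cong[OF HOL.refl])
    fix m n assume "(m, n) \<in># u"
    note mn = mem[OF this u]
    have M: "m0 \<in> car M" if "(X, m0) \<in># coact M m" for X m0 using M.coact_mem[OF mn(1) that] .
    have N: "n0 \<in> car N" if "(Y, n0) \<in># coact N n" for Y n0 using N.coact_mem[OF mn(2) that] .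
    have add1: "\<phi> (psum w f) y = (\<Sum>a b:w. \<phi> (f a b) y)"
      if "\<And>a b. (a, b) \<in># w \<Longrightarrow> f a b \<in> car M" "y \<in> car N" for w y and f :: "'x \<Rightarrow> 'y \<Rightarrow> 'u"
      by (rule psum_additive_on[where S = "car M" and h = "\<lambda>v. \<phi> v y"]) (use \<phi> that in \<open>auto simp: form_on_def\<close>)
    have add2: "\<phi> x (psum w f) = (\<Sum>a b:w. \<phi> x (f a b))"
      if "\<And>a b. (a, b) \<in># w \<Longrightarrow> f a b \<in> car N" "x \<in> car M" for w x and f :: "'x \<Rightarrow> 'y \<Rightarrow> 'u"
      by (rule psum_additive_on[where S = "car N"]) (use \<phi> that in \<open>auto simp: form_on_def\<close>)
    have hit: "\<phi> (M.mhit p m) (N.mhit q n) = (\<Sum>X m0:coact M m. \<Sum>Y n0:coact N n.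
        \<phi> (lact M (br p (X \<odot> tgt H (br q Y))) m0) n0)" for p q
    proof -
      have "\<phi> (M.mhit p m) (N.mhit q n) = (\<Sum>Y n0:coact N n. \<phi> (M.mhit p m) (lact N (br q Y) n0))"
        unfolding N.mhit_def by (rule add2) (auto simp: mn N)
      also have "\<dots> = (\<Sum>Y n0:coact N n. \<Sum>X m0:coact M m. \<phi> (lact M (br p (X \<odot> tgt H (br q Y))) m0) n0)"
      proof (rule psum_cong[OF HOL.refl])
        fix Y n0 assume "(Y, n0) \<in># coact N n"
        then have n0: "n0 \<in> car N" by (rule N)
        have c: "M.cform (\<lambda>X m0. \<phi> (lact M (br p X) m0) n0)"
          using \<phi> n0 by (simp add: M.cform_def form_on_def)
        have "\<phi> (M.mhit p m) (lact N (br q Y) n0) = (\<Sum>X m0:coact M m. \<phi> (lact M (br p X) m0) (lact N (br q Y) n0))"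
          unfolding M.mhit_def by (rule add1) (auto simp: n0 M)
        also have "\<dots> = (\<Sum>X m0:coact M m. \<phi> (lact M (br p X) (ract M (br q Y) m0)) n0)"
          using \<phi> n0 M by (intro psum_cong[OF HOL.refl]) (simp add: form_on_def M.lact_ract)
        finally show "\<phi> (M.mhit p m) (lact N (br q Y) n0)
          = (\<Sum>X m0:coact M m. \<phi> (lact M (br p (X \<odot> tgt H (br q Y))) m0) n0)"
          unfolding M.coact_takeuchi[OF c mn(1)] .
      qed
      finally show ?thesis by (subst psum_swap)
    qed
    have "(\<Sum>X m0:coact M m. \<Sum>Y n0:coact N n. \<phi> (lact M (\<Gamma> X Y) m0) n0)
      = (\<Sum>X m0:coact M m. \<Sum>Y n0:coact N n. \<Sum>p q:F. \<phi> (lact M (br p (X \<odot> tgt H (br q Y))) m0) n0)"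
      by (intro psum_cong HOL.refl) (simp add: \<Gamma>_def M.lact_psum M N add1)
    then show "(\<Sum>X m0:coact M m. \<Sum>Y n0:coact N n. \<phi> (lact M (\<Gamma> X Y) m0) n0)
        = (\<Sum>p q:F. \<phi> (M.mhit p m) (N.mhit q n))"
      by (simp add: hit psum_swap[of F])
  qed
  have form_F: "form_on M N (ract_cotwist H \<Gamma> M) (lact_cotwist H \<Gamma> N) (\<lambda>m n. \<Sum>p q:F. \<phi> (M.mhit p m) (N.mhit q n))"
    if \<phi>: "form_on M N (ract M) (lact N) \<phi>" for \<phi> :: "'u \<Rightarrow> 'u \<Rightarrow> 'k"
    unfolding form_on_def
  proof (intro conjI ballI allI)
    fix b m n assume mn: "m \<in> car M" "n \<in> car N"
    show "(\<Sum>p q:F. \<phi> (M.mhit p (ract_cotwist H \<Gamma> M b m)) (N.mhit q n))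
        = (\<Sum>p q:F. \<phi> (M.mhit p m) (N.mhit q (lact_cotwist H \<Gamma> N b n)))"
      using Lam.F_balance[OF bal[OF \<phi> mn], of b] mn by (simp add: racts lacts M.mhit_mult N.mhit_mult)
  qed (use \<phi> in \<open>simp_all add: form_on_def M.mhit_smul N.mhit_smul psum_plus\<close>)
  have form_G: "form_on M N (ract M) (lact N) (\<lambda>m n. \<Sum>g h:Lam.G. \<phi> (M.mhit g m) (N.mhit h n))"
    if \<phi>: "form_on M N (ract_cotwist H \<Gamma> M) (lact_cotwist H \<Gamma> N) \<phi>" for \<phi> :: "'u \<Rightarrow> 'u \<Rightarrow> 'k"
    unfolding form_on_def
  proof (intro conjI ballI allI)
    fix b m n assume mn: "m \<in> car M" "n \<in> car N"
    show "(\<Sum>g h:Lam.G. \<phi> (M.mhit g (ract M b m)) (N.mhit h n))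
        = (\<Sum>g h:Lam.G. \<phi> (M.mhit g m) (N.mhit h (lact N b n)))"
      using Lam.G_balance[OF Fbal[OF \<phi> mn], of b "\<one>\<^bsub>Lam\<^esub>" "\<one>\<^bsub>Lam\<^esub>"] mn
      by (simp add: M.mhit_mult N.mhit_mult M.mhit_tgt N.mhit_src)
  qed (use \<phi> in \<open>simp_all add: form_on_def M.mhit_smul N.mhit_smul psum_plus\<close>)
  have GF: "(\<Sum>p q:F. \<Sum>g h:Lam.G. \<phi> (M.mhit g (M.mhit p m)) (N.mhit h (N.mhit q n))) = \<phi> m n"
    if "form_on M N (ract_cotwist H \<Gamma> M) (lact_cotwist H \<Gamma> N) \<phi>" "m \<in> car M" "n \<in> car N"
    for \<phi> :: "'u \<Rightarrow> 'u \<Rightarrow> 'k" and m n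
    using Lam.GF_act[OF Fbal[OF that], of "\<one>\<^bsub>Lam\<^esub>" "\<one>\<^bsub>Lam\<^esub>"] that by (simp add: M.mhit_mult N.mhit_mult)
  have FG: "(\<Sum>g h:Lam.G. \<Sum>p q:F. \<phi> (M.mhit p (M.mhit g m)) (N.mhit q (N.mhit h n))) = \<phi> m n"
    if "form_on M N (ract M) (lact N) \<phi>" "m \<in> car M" "n \<in> car N"
    for \<phi> :: "'u \<Rightarrow> 'u \<Rightarrow> 'k" and m n
    using Lam.FG_act[OF bal[OF that], of "\<one>\<^bsub>Lam\<^esub>" "\<one>\<^bsub>Lam\<^esub>"] that by (simp add: M.mhit_mult N.mhit_mult)
  have E'I: "?E' u v" if "u \<in> formal_sums M N" "v \<in> formal_sums M N"
      "\<And>\<phi> :: 'u \<Rightarrow> 'u \<Rightarrow> 'k. form_on M N (ract M) (lact N) \<phi> \<Longrightarrow> psum u \<phi> = psum v \<phi>" for u v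
    by (rule tensor2_eqI[OF M.M_vspace N.M_vspace _ _ _ that]) simp_all
  have EI: "?E u v" if "u \<in> formal_sums M N" "v \<in> formal_sums M N"
      "\<And>\<phi> :: 'u \<Rightarrow> 'u \<Rightarrow> 'k. form_on M N (ract_cotwist H \<Gamma> M) (lact_cotwist H \<Gamma> N) \<phi> \<Longrightarrow> psum u \<phi> = psum v \<phi>" for u v
    by (rule tensor2_eqI[OF M.M_vspace N.M_vspace _ _ _ that]) (simp_all add: racts lacts M.mhit_smul)
  have "?E u v \<longleftrightarrow> ?E' (\<Phi> u) (\<Phi> v)" if u: "u \<in> formal_sums M N" and v: "v \<in> formal_sums M N" for u v
  proof
    assume uv: "?E u v"
    show "?E' (\<Phi> u) (\<Phi> v)"
    proof (rule E'I[OF \<Phi>_mem[OF u] \<Phi>_mem[OF v]])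
      fix \<phi> :: "'u \<Rightarrow> 'u \<Rightarrow> 'k" assume \<phi>: "form_on M N (ract M) (lact N) \<phi>"
      show "psum (\<Phi> u) \<phi> = psum (\<Phi> v) \<phi>"
        unfolding \<Phi>_F[OF \<phi> u] \<Phi>_F[OF \<phi> v] by (rule tensor2_eq_psum[OF uv form_F[OF \<phi>]]) simp
    qed
  next
    assume uv: "?E' (\<Phi> u) (\<Phi> v)"
    show "?E u v"
    proof (rule EI[OF u v])
      fix \<phi> :: "'u \<Rightarrow> 'u \<Rightarrow> 'k" assume \<phi>: "form_on M N (ract_cotwist H \<Gamma> M) (lact_cotwist H \<Gamma> N) \<phi>"
      have "psum w \<phi> = (\<Sum>m n:\<Phi> w. \<Sum>g h:Lam.G. \<phi> (M.mhit g m) (N.mhit h n))"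
        if "w \<in> formal_sums M N" for w
        unfolding \<Phi>_F[OF form_G[OF \<phi>] that] by (rule psum_cong[OF HOL.refl]) (simp add: GF[OF \<phi>] mem[OF _ that])
      then show "psum u \<phi> = psum v \<phi>"
        using tensor2_eq_psum[OF uv form_G[OF \<phi>]] u v by simp
    qed
  qed
  moreover have "\<exists>u\<in>formal_sums M N. ?E' (\<Phi> u) w" if w: "w \<in> formal_sums M N" for w
  proof (rule bexI)
    let ?u = "(\<Sum>m n:w. \<Sum>g h:Lam.G. {#(M.mhit g m, N.mhit h n)#})"
    show u: "?u \<in> formal_sums M N"
      using w by (auto simp: formal_sums_def set_mset_psum)
    show "?E' (\<Phi> ?u) w"
    proof (rule E'I[OF \<Phi>_mem[OF u] w])
      fix \<phi> :: "'u \<Rightarrow> 'u \<Rightarrow> 'k" assume \<phi>: "form_on M N (ract M) (lact N) \<phi>"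
      show "psum (\<Phi> ?u) \<phi> = psum w \<phi>"
        unfolding \<Phi>_F[OF \<phi> u] psum_psum psum_single
        by (rule psum_cong[OF HOL.refl]) (simp add: FG[OF \<phi>] mem[OF _ w])
    qed
  qed
  ultimately show "invertible_mod (formal_sums M N) ?E (formal_sums M N) ?E'
     (\<lambda>u. \<Sum>m n:u. \<Sum>X m0:coact M m. \<Sum>Y n0:coact N n. {#(lact M (\<Gamma> X Y) m0, n0)#})"
    unfolding \<Phi>_def[symmetric] invertible_mod_def using \<Phi>_mem by blast
qed

end

theorem theorem3p30:
  fixes B :: "('k::field, 'b::ab_group_add) algebra"
    and \<Lambda> :: "('k, 'b, 'l::ab_group_add) bialgebroid"
    and L :: "('k, 'b, 'h::ab_group_add) bialgebroid"
    and br :: "'l \<Rightarrow> 'h \<Rightarrow> 'b"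
    and F :: "('l \<times> 'l) multiset"
    and \<Gamma> :: "'h \<Rightarrow> 'h \<Rightarrow> 'b"
  assumes "dual_pairing B \<Lambda> L br"
    and "left_hopf_algebroid B L"
    and "faithfully_flat_structures B \<Lambda>"
    and "faithfully_flat_structures B L"
    and "left_2_cocycle_in \<Lambda> F"
    and "cocycle_in_invertible TYPE('l) \<Lambda> F"
    and "\<And>X Y. \<Gamma> X Y = (\<Sum>(p, q)\<in>#F. br p (X \<cdot>\<^bsub>L\<^esub> tgt L (br q Y)))"
  shows "left_2_cocycle_on B L \<Gamma>
    \<and> cocycle_on_invertible TYPE('u::ab_group_add) B L \<Gamma>
    \<and> cotwist_base B L \<Gamma> = twist_base B \<Lambda> F
    \<and> dual_pairing (twist_base B \<Lambda> F) (twist \<Lambda> F) (cotwist L \<Gamma>)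
        (\<lambda>\<alpha> X. \<Sum>(p, q)\<in>#F. \<Sum>(Xp, Xm)\<in>#translation L X.
           br (p \<cdot>\<^bsub>\<Lambda>\<^esub> \<alpha>) (Xp \<cdot>\<^bsub>L\<^esub> tgt L (br q Xm)))"
proof -
  interpret P: dual_pairing B \<Lambda> L br by fact
  interpret H: left_hopf_algebroid B L by fact
  interpret T: twisted_pairing B \<Lambda> L br F
    by unfold_locales fact+
  have \<Gamma>: "\<Gamma> = T.\<Gamma>"
    using assms(7) by (intro ext) (simp add: T.\<Gamma>_def psum_def)
  have pair: "(\<lambda>\<alpha> X. \<Sum>(p, q)\<in>#F. \<Sum>(Xp, Xm)\<in>#translation L X.
           br (p \<cdot>\<^bsub>\<Lambda>\<^esub> \<alpha>) (Xp \<cdot>\<^bsub>L\<^esub> tgt L (br q Xm))) = T.tpair"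
    by (intro ext) (simp add: T.tpair_def psum_def)
  show ?thesis
    unfolding pair unfolding \<Gamma>
    using T.\<Gamma>_cocycle T.\<Gamma>_invertible T.cotwist_base_eq T.tpair_dual_pairing by blast
qed

end
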